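(* Let $(N(d))_{d\ge 3}$ be a sequence of even integers with $N(d)\ge 3$ for all $d$, such that $N(d)\to\infty$ and $\ln N(d)=o(\sqrt d)$ as $d\to\infty$. For each $d$, with $N=N(d)$, let $$V_N(d):=\max_{x_1,\ldots,x_{N/2}\in\mathbb{S}^{d-1}}\sigma_{d-1}\left(\bigcup_{i=1}^{N/2}\big[C(x_i)\cup C(-x_i)\big]\right),$$ where $C(x)$ denotes the geodesic cap of $\mathbb{S}^{d-1}$ centered at $x$ with $\sigma_{d-1}(C(x))=1/N$. Then $$\lim_{d\to\infty}V_{N(d)}(d)=1-e^{-1}.$$
   Context: $\mathbb{S}^{d-1}=\{u\in\mathbb{R}^d:\|u\|=1\}$ is the Euclidean unit sphere in $\mathbb{R}^d$, and $\sigma_{d-1}$ is the rotation-invariant surface measure on $\mathbb{S}^{d-1}$ normalized to be a probability measure. For $d,N\ge 3$ and $x\in\mathbb{S}^{d-1}$, the cap $C(x)$ of measure $1/N$ is $C(x)=\{u\in\mathbb{S}^{d-1}:\langle u,x\rangle\ge\alpha_{d,N}\}$, where $\alpha_{d,N}\in(0,1)$ is the unique number (independent of $x$) for which $\sigma_{d-1}(C(x))=1/N$. Thus $V_N(d)$ is the largest proportion of the sphere covered by $N/2$ antipodal pairs of caps, each cap having normalized measure $1/N$. *)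

theory Defs
  imports "HOL-Probability.Probability" "HOL-Library.Landau_Symbols"
begin

text \<open>
  The dimension varies inside a single statement, so \<open>\<real>\<^sup>d\<close> is represented by the functions on
  \<open>{..<d}\<close>, extended by \<^const>\<open>undefined\<close>. This is the carrier of the product measure below, which
  is Lebesgue measure on \<open>\<real>\<^sup>d\<close>. The Euclidean norm of \<open>u\<close> is \<^term>\<open>L2_set u {..<d}\<close>.
\<close>

definition lebesgue_Rn :: "nat \<Rightarrow> (nat \<Rightarrow> real) measure" where
  "lebesgue_Rn d = (\<Pi>\<^sub>M i\<in>{..<d}. lborel)"

definition inner_Rn :: "nat \<Rightarrow> (nat \<Rightarrow> real) \<Rightarrow> (nat \<Rightarrow> real) \<Rightarrow> real" where
  "inner_Rn d u v = (\<Sum>i<d. u i * v i)"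

definition scale_Rn :: "nat \<Rightarrow> real \<Rightarrow> (nat \<Rightarrow> real) \<Rightarrow> nat \<Rightarrow> real" where
  "scale_Rn d c u = (\<lambda>i\<in>{..<d}. c * u i)"

definition unit_ball :: "nat \<Rightarrow> (nat \<Rightarrow> real) set" where
  "unit_ball d = {u \<in> space (lebesgue_Rn d). L2_set u {..<d} \<le> 1}"

definition unit_sphere :: "nat \<Rightarrow> (nat \<Rightarrow> real) set" where
  "unit_sphere d = {u \<in> space (lebesgue_Rn d). L2_set u {..<d} = 1}"

definition radial_proj :: "nat \<Rightarrow> (nat \<Rightarrow> real) \<Rightarrow> nat \<Rightarrow> real" where
  "radial_proj d u = scale_Rn d (1 / L2_set u {..<d}) u"

text \<open>
  Normalized surface measure as it arises from polar coordinates: a Borel set \<open>A\<close> on the sphere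
  has measure \<open>vol {t a | 0 < t \<le> 1, a \<in> A} / vol (unit_ball d)\<close>. It is the rotation-invariant
  probability measure on the sphere, see \<open>prob_space_sphere_measure\<close> and
  \<open>sphere_measure_rotation_invariant\<close> below.
\<close>

definition sphere_measure :: "nat \<Rightarrow> (nat \<Rightarrow> real) measure" where
  "sphere_measure d =
     restrict_space
       (distr (uniform_measure (lebesgue_Rn d) (unit_ball d)) (lebesgue_Rn d) (radial_proj d))
       (unit_sphere d)"

definition cap_of_height :: "nat \<Rightarrow> real \<Rightarrow> (nat \<Rightarrow> real) \<Rightarrow> (nat \<Rightarrow> real) set" where
  "cap_of_height d a x = {u \<in> unit_sphere d. inner_Rn d u x \<ge> a}"

definition cap_height :: "nat \<Rightarrow> nat \<Rightarrow> real" where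
  "cap_height d N = (THE a. a \<in> {0<..<1} \<and>
     (\<forall>x\<in>unit_sphere d. measure (sphere_measure d) (cap_of_height d a x) = 1 / real N))"

definition cap :: "nat \<Rightarrow> nat \<Rightarrow> (nat \<Rightarrow> real) \<Rightarrow> (nat \<Rightarrow> real) set" where
  "cap d N x = cap_of_height d (cap_height d N) x"

definition antipodal_coverage :: "nat \<Rightarrow> nat \<Rightarrow> (nat \<Rightarrow> nat \<Rightarrow> real) \<Rightarrow> real" where
  "antipodal_coverage d N x =
     measure (sphere_measure d) (\<Union>i<N div 2. cap d N (x i) \<union> cap d N (scale_Rn d (-1) (x i)))"

text \<open>
  \<^const>\<open>Greatest\<close> is a genuine maximum, not merely a supremum: its value is unspecified unless the
  maximum is attained.
\<close>

definition max_antipodal_coverage :: "nat \<Rightarrow> nat \<Rightarrow> real" where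
  "max_antipodal_coverage d N =
     (GREATEST v. \<exists>x. (\<forall>i<N div 2. x i \<in> unit_sphere d) \<and> v = antipodal_coverage d N x)"

lemma sets_lebesgue_Rn [measurable_cong]: "sets (lebesgue_Rn d) = sets (\<Pi>\<^sub>M i\<in>{..<d}. borel)"
  unfolding lebesgue_Rn_def by (rule sets_PiM_cong) auto

lemma space_lebesgue_Rn: "space (lebesgue_Rn d) = extensional {..<d}"
  by (simp add: lebesgue_Rn_def space_PiM PiE_def)

lemma measurable_L2_set_Rn [measurable]: "(\<lambda>u. L2_set u {..<d}) \<in> borel_measurable (lebesgue_Rn d)"
  unfolding L2_set_def by measurable

lemma measurable_radial_proj [measurable]: "radial_proj d \<in> lebesgue_Rn d \<rightarrow>\<^sub>M lebesgue_Rn d"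
  unfolding radial_proj_def scale_Rn_def lebesgue_Rn_def[of d, abs_def]
  unfolding L2_set_def by measurable

lemma unit_ball_sets [measurable]: "unit_ball d \<in> sets (lebesgue_Rn d)"
  unfolding unit_ball_def by measurable

lemma unit_sphere_sets [measurable]: "unit_sphere d \<in> sets (lebesgue_Rn d)"
  unfolding unit_sphere_def by measurable

interpretation Rn: product_sigma_finite "\<lambda>i::nat. lborel :: real measure"
  by standard

lemma emeasure_box_Rn:
  assumes "\<And>i. i < d \<Longrightarrow> A i \<in> sets borel"
  shows "emeasure (lebesgue_Rn d) (Pi\<^sub>E {..<d} A) = (\<Prod>i<d. emeasure lborel (A i))"
  unfolding lebesgue_Rn_def using assms by (subst Rn.emeasure_PiM) auto

lemma emeasure_unit_ball_finite: "emeasure (lebesgue_Rn d) (unit_ball d) < \<infinity>"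
proof -
  have "unit_ball d \<subseteq> Pi\<^sub>E {..<d} (\<lambda>_. {-1..1})"
  proof
    fix u assume u: "u \<in> unit_ball d"
    have "\<bar>u i\<bar> \<le> 1" if "i < d" for i
    proof -
      have "\<bar>u i\<bar> \<le> L2_set (\<lambda>i. \<bar>u i\<bar>) {..<d}" by (rule member_le_L2_set) (use that in auto)
      also have "\<dots> = L2_set u {..<d}" by (simp add: L2_set_def)
      finally show ?thesis using u by (simp add: unit_ball_def)
    qed
    then show "u \<in> Pi\<^sub>E {..<d} (\<lambda>_. {-1..1})"
      using u by (force simp: unit_ball_def space_lebesgue_Rn PiE_def abs_le_iff)
  qed
  then have "emeasure (lebesgue_Rn d) (unit_ball d) \<le> emeasure (lebesgue_Rn d) (Pi\<^sub>E {..<d} (\<lambda>_. {-1..1}))"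
    by (rule emeasure_mono) (simp add: lebesgue_Rn_def sets_PiM_I_finite)
  also have "\<dots> = (\<Prod>i<d. 2)" by (subst emeasure_box_Rn) auto
  also have "\<dots> < \<infinity>" by (simp add: power_less_top_ennreal)
  finally show ?thesis .
qed

lemma emeasure_unit_ball_pos:
  assumes "d > 0"
  shows "emeasure (lebesgue_Rn d) (unit_ball d) > 0"
proof -
  let ?B = "Pi\<^sub>E {..<d} (\<lambda>_. {0..1 / real d})"
  have "?B \<subseteq> unit_ball d"
  proof
    fix u assume u: "u \<in> ?B"
    have "L2_set u {..<d} \<le> (\<Sum>i<d. u i)"
      by (rule L2_set_le_sum) (use u in \<open>auto simp: PiE_def Pi_def\<close>)
    also have "\<dots> \<le> (\<Sum>i<d. 1 / real d)"
      by (rule sum_mono) (use u in \<open>auto simp: PiE_def Pi_def\<close>)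
    also have "\<dots> = 1" using assms by simp
    finally show "u \<in> unit_ball d"
      using u by (simp add: unit_ball_def space_lebesgue_Rn PiE_def)
  qed
  then have "emeasure (lebesgue_Rn d) ?B \<le> emeasure (lebesgue_Rn d) (unit_ball d)"
    by (rule emeasure_mono) measurable
  moreover have "emeasure (lebesgue_Rn d) ?B = (\<Prod>i<d. ennreal (1 / real d))"
    by (subst emeasure_box_Rn) auto
  moreover have "(\<Prod>i<d. ennreal (1 / real d)) > 0"
    using assms by (subst prod_ennreal) (auto simp: )
  ultimately show ?thesis by simp
qed

lemma L2_set_radial_proj:
  assumes "L2_set u {..<d} \<noteq> 0"
  shows "L2_set (radial_proj d u) {..<d} = 1"
proof -
  have "L2_set (radial_proj d u) {..<d} = L2_set (\<lambda>i. 1 / L2_set u {..<d} * u i) {..<d}"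
    unfolding radial_proj_def scale_Rn_def by (rule L2_set_cong) auto
  also have "\<dots> = 1 / L2_set u {..<d} * L2_set u {..<d}"
    by (rule L2_set_right_distrib[symmetric]) simp
  finally show ?thesis using assms by simp
qed

lemma radial_proj_in_space: "radial_proj d u \<in> space (lebesgue_Rn d)"
  by (simp add: radial_proj_def scale_Rn_def space_lebesgue_Rn)

lemma AE_radial_proj_sphere:
  assumes "d > 0"
  shows "AE u in lebesgue_Rn d. radial_proj d u \<in> unit_sphere d"
proof (rule AE_I)
  show "{u \<in> space (lebesgue_Rn d). radial_proj d u \<notin> unit_sphere d} \<subseteq> Pi\<^sub>E {..<d} (\<lambda>_. {0})"
  proof
    fix u assume u: "u \<in> {u \<in> space (lebesgue_Rn d). radial_proj d u \<notin> unit_sphere d}"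
    then have "L2_set u {..<d} = 0"
      using L2_set_radial_proj[of u d] radial_proj_in_space[of d u] by (auto simp: unit_sphere_def)
    then have "\<forall>i\<in>{..<d}. u i = 0" by (subst (asm) L2_set_eq_0_iff) auto
    then show "u \<in> Pi\<^sub>E {..<d} (\<lambda>_. {0})"
      using u by (auto simp: space_lebesgue_Rn fun_eq_iff extensional_def restrict_def)
  qed
  show "emeasure (lebesgue_Rn d) (Pi\<^sub>E {..<d} (\<lambda>_. {0})) = 0"
    using assms by (subst emeasure_box_Rn) auto
  show "Pi\<^sub>E {..<d} (\<lambda>_. {0}) \<in> sets (lebesgue_Rn d)"
    by measurable
qed

lemma space_sphere_measure: "space (sphere_measure d) = unit_sphere d"
  by (auto simp: sphere_measure_def space_restrict_space unit_sphere_def)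

lemma emeasure_sphere_measure:
  assumes A: "A \<in> sets (lebesgue_Rn d)" "A \<subseteq> unit_sphere d"
  shows "emeasure (sphere_measure d) A =
    emeasure (lebesgue_Rn d) {u \<in> unit_ball d. radial_proj d u \<in> A} /
    emeasure (lebesgue_Rn d) (unit_ball d)"
proof -
  have "emeasure (sphere_measure d) A =
     emeasure (uniform_measure (lebesgue_Rn d) (unit_ball d))
       (radial_proj d -` A \<inter> space (lebesgue_Rn d))"
    unfolding sphere_measure_def using A
    by (subst emeasure_restrict_space) (auto simp: emeasure_distr)
  also have "\<dots> = emeasure (lebesgue_Rn d) (unit_ball d \<inter> (radial_proj d -` A \<inter> space (lebesgue_Rn d)))
      / emeasure (lebesgue_Rn d) (unit_ball d)"
    by (rule emeasure_uniform_measure) (use A in measurable)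
  also have "unit_ball d \<inter> (radial_proj d -` A \<inter> space (lebesgue_Rn d)) =
      {u \<in> unit_ball d. radial_proj d u \<in> A}"
    by (auto simp: unit_ball_def)
  finally show ?thesis .
qed

lemma prob_space_sphere_measure:
  assumes "d > 0"
  shows "prob_space (sphere_measure d)"
proof (rule prob_spaceI)
  have "emeasure (lebesgue_Rn d) {u \<in> unit_ball d. radial_proj d u \<in> unit_sphere d} =
        emeasure (lebesgue_Rn d) (unit_ball d)"
  proof (rule emeasure_eq_AE)
    show "AE u in lebesgue_Rn d.
      (u \<in> {u \<in> unit_ball d. radial_proj d u \<in> unit_sphere d}) = (u \<in> unit_ball d)"
      using AE_radial_proj_sphere[OF assms] by eventually_elim auto
    have "{u \<in> unit_ball d. radial_proj d u \<in> unit_sphere d} =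
      unit_ball d \<inter> (radial_proj d -` unit_sphere d \<inter> space (lebesgue_Rn d))"
      by (auto simp: unit_ball_def)
    also have "\<dots> \<in> sets (lebesgue_Rn d)" by measurable
    finally show "{u \<in> unit_ball d. radial_proj d u \<in> unit_sphere d} \<in> sets (lebesgue_Rn d)" .
  qed measurable
  then show "emeasure (sphere_measure d) (space (sphere_measure d)) = 1"
    using emeasure_unit_ball_pos[OF assms] emeasure_unit_ball_finite[of d]
    by (simp add: space_sphere_measure emeasure_sphere_measure ennreal_divide_self top.not_eq_extremum)
qed

definition add_Rn :: "nat \<Rightarrow> (nat \<Rightarrow> real) \<Rightarrow> (nat \<Rightarrow> real) \<Rightarrow> nat \<Rightarrow> real" where
  "add_Rn d u v = (\<lambda>i\<in>{..<d}. u i + v i)"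

definition apply_mat :: "nat \<Rightarrow> (nat \<Rightarrow> nat \<Rightarrow> real) \<Rightarrow> (nat \<Rightarrow> real) \<Rightarrow> nat \<Rightarrow> real" where
  "apply_mat d Q u = (\<lambda>i\<in>{..<d}. \<Sum>j<d. Q i j * u j)"

definition orthogonal_mat :: "nat \<Rightarrow> (nat \<Rightarrow> nat \<Rightarrow> real) \<Rightarrow> bool" where
  "orthogonal_mat d Q \<longleftrightarrow>
     (\<forall>i<d. \<forall>j<d. (\<Sum>k<d. Q i k * Q j k) = of_bool (i = j)) \<and>
     (\<forall>i<d. \<forall>j<d. (\<Sum>k<d. Q k i * Q k j) = of_bool (i = j))"

lemma measurable_Rn_component:
  assumes "f \<in> M \<rightarrow>\<^sub>M lebesgue_Rn d" "i < d"
  shows "(\<lambda>x. f x i) \<in> borel_measurable M"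
proof -
  have "i \<in> {..<d}" using assms(2) by simp
  from measurable_compose[OF assms(1)[unfolded lebesgue_Rn_def] measurable_component_singleton[OF this]]
  show ?thesis by simp
qed

lemma measurable_into_Rn:
  assumes "\<And>i. i < d \<Longrightarrow> (\<lambda>x. f x i) \<in> borel_measurable M"
  shows "(\<lambda>x. \<lambda>i\<in>{..<d}. f x i) \<in> M \<rightarrow>\<^sub>M lebesgue_Rn d"
  unfolding lebesgue_Rn_def by (rule measurable_restrict) (use assms in simp)

lemma measurable_add_Rn [measurable]:
  assumes "f \<in> M \<rightarrow>\<^sub>M lebesgue_Rn d" "g \<in> M \<rightarrow>\<^sub>M lebesgue_Rn d"
  shows "(\<lambda>x. add_Rn d (f x) (g x)) \<in> M \<rightarrow>\<^sub>M lebesgue_Rn d"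
  unfolding add_Rn_def
  by (intro measurable_into_Rn borel_measurable_add borel_measurable_times borel_measurable_sum
      borel_measurable_const measurable_Rn_component[OF assms(1)] measurable_Rn_component[OF assms(2)]) auto

lemma measurable_scale_Rn [measurable]:
  assumes "f \<in> M \<rightarrow>\<^sub>M lebesgue_Rn d"
  shows "(\<lambda>x. scale_Rn d c (f x)) \<in> M \<rightarrow>\<^sub>M lebesgue_Rn d"
  unfolding scale_Rn_def
  by (intro measurable_into_Rn borel_measurable_add borel_measurable_times borel_measurable_sum
      borel_measurable_const measurable_Rn_component[OF assms]) auto

lemma measurable_apply_mat [measurable]:
  assumes "f \<in> M \<rightarrow>\<^sub>M lebesgue_Rn d"
  shows "(\<lambda>x. apply_mat d Q (f x)) \<in> M \<rightarrow>\<^sub>M lebesgue_Rn d"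
  unfolding apply_mat_def
  by (intro measurable_into_Rn borel_measurable_add borel_measurable_times borel_measurable_sum
      borel_measurable_const measurable_Rn_component[OF assms]) auto

lemma lebesgue_Rn_translate:
  "distr (lebesgue_Rn d) (lebesgue_Rn d) (\<lambda>x. add_Rn d x y) = lebesgue_Rn d"
proof -
  have "distr (lebesgue_Rn d) (lebesgue_Rn d) (\<lambda>x. add_Rn d x y) = (\<Pi>\<^sub>M i\<in>{..<d}. lborel)"
  proof (rule Rn.PiM_eqI)
    show "sets (distr (lebesgue_Rn d) (lebesgue_Rn d) (\<lambda>x. add_Rn d x y)) = sets (\<Pi>\<^sub>M i\<in>{..<d}. lborel)"
      by (simp add: lebesgue_Rn_def)
    fix A :: "nat \<Rightarrow> real set" assume A: "\<And>i. i \<in> {..<d} \<Longrightarrow> A i \<in> sets lborel"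
    have meas: "(\<lambda>x. add_Rn d x y) \<in> lebesgue_Rn d \<rightarrow>\<^sub>M lebesgue_Rn d"
      unfolding add_Rn_def
      by (intro measurable_into_Rn borel_measurable_add measurable_Rn_component[OF measurable_ident_sets]) auto
    have eq: "(\<lambda>x. add_Rn d x y) -` Pi\<^sub>E {..<d} A \<inter> space (lebesgue_Rn d) =
      Pi\<^sub>E {..<d} (\<lambda>i. (\<lambda>t. y i + t) -` A i \<inter> space lborel)"
      by (auto simp: add_Rn_def space_lebesgue_Rn PiE_def Pi_def add.commute)
    have "emeasure (distr (lebesgue_Rn d) (lebesgue_Rn d) (\<lambda>x. add_Rn d x y)) (Pi\<^sub>E {..<d} A) =
      emeasure (lebesgue_Rn d) (Pi\<^sub>E {..<d} (\<lambda>i. (\<lambda>t. y i + t) -` A i \<inter> space lborel))"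
      unfolding eq[symmetric]
      by (rule emeasure_distr[OF meas]) (use A in \<open>auto simp: lebesgue_Rn_def intro!: sets_PiM_I_finite\<close>)
    also have "\<dots> = (\<Prod>i<d. emeasure lborel ((\<lambda>t. y i + t) -` A i \<inter> space lborel))"
    proof (rule emeasure_box_Rn)
      fix i assume "i < d"
      then have [measurable]: "A i \<in> sets borel" using A by auto
      show "(\<lambda>t. y i + t) -` A i \<inter> space lborel \<in> sets borel"
        using measurable_sets[of "\<lambda>t. y i + t" borel borel "A i"] by simp
    qed
    also have "\<dots> = (\<Prod>i<d. emeasure lborel (A i))"
    proof (rule prod.cong)
      fix i assume "i \<in> {..<d}"
      then have A': "A i \<in> sets borel" using A by auto
      have "emeasure lborel ((\<lambda>t. y i + t) -` A i \<inter> space lborel) =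
        emeasure (distr lborel borel ((+) (y i))) (A i)"
        using A' by (subst emeasure_distr) auto
      then show "emeasure lborel ((\<lambda>t. y i + t) -` A i \<inter> space lborel) = emeasure lborel (A i)"
        by (simp add: lborel_distr_plus)
    qed simp
    finally show "emeasure (distr (lebesgue_Rn d) (lebesgue_Rn d) (\<lambda>x. add_Rn d x y)) (Pi\<^sub>E {..<d} A) =
      (\<Prod>i\<in>{..<d}. emeasure lborel (A i))" .
  qed simp
  then show ?thesis by (simp add: lebesgue_Rn_def)
qed

lemma nn_integral_translate_Rn:
  assumes [measurable]: "f \<in> borel_measurable (lebesgue_Rn d)" and y: "y \<in> space (lebesgue_Rn d)"
  shows "(\<integral>\<^sup>+x. f (add_Rn d x y) \<partial>lebesgue_Rn d) = (\<integral>\<^sup>+x. f x \<partial>lebesgue_Rn d)"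
proof -
  have "(\<integral>\<^sup>+x. f x \<partial>lebesgue_Rn d) =
    (\<integral>\<^sup>+x. f x \<partial>distr (lebesgue_Rn d) (lebesgue_Rn d) (\<lambda>x. add_Rn d x y))"
    by (simp only: lebesgue_Rn_translate)
  also have "\<dots> = (\<integral>\<^sup>+x. f (add_Rn d x y) \<partial>lebesgue_Rn d)"
    by (rule nn_integral_distr) (use y in measurable)
  finally show ?thesis by simp
qed

lemma orthogonal_mat_transpose:
  "orthogonal_mat d Q \<Longrightarrow> orthogonal_mat d (\<lambda>i j. Q j i)"
  by (simp add: orthogonal_mat_def)

lemma apply_mat_transpose:
  assumes Q: "orthogonal_mat d Q" and u: "u \<in> space (lebesgue_Rn d)"
  shows "apply_mat d Q (apply_mat d (\<lambda>i j. Q j i) u) = u"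
proof (rule extensionalityI[of _ "{..<d}"])
  show "u \<in> extensional {..<d}" using u by (simp add: space_lebesgue_Rn)
  fix i assume i: "i \<in> {..<d}"
  have "apply_mat d Q (apply_mat d (\<lambda>i j. Q j i) u) i = (\<Sum>j<d. Q i j * (\<Sum>k<d. Q k j * u k))"
    using i by (simp add: apply_mat_def)
  also have "\<dots> = (\<Sum>j<d. \<Sum>k<d. (Q i j * Q k j) * u k)"
    by (simp add: sum_distrib_left mult.assoc)
  also have "\<dots> = (\<Sum>k<d. (\<Sum>j<d. Q i j * Q k j) * u k)"
    by (subst sum.swap) (simp add: sum_distrib_right)
  also have "\<dots> = (\<Sum>k<d. of_bool (i = k) * u k)"
    using Q i by (intro sum.cong) (auto simp: orthogonal_mat_def)
  also have "\<dots> = u i" using i by simp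
  finally show "apply_mat d Q (apply_mat d (\<lambda>i j. Q j i) u) i = u i" .
qed (simp add: apply_mat_def)

lemma L2_set_apply_mat:
  assumes Q: "orthogonal_mat d Q"
  shows "L2_set (apply_mat d Q u) {..<d} = L2_set u {..<d}"
proof -
  have "(\<Sum>i<d. (apply_mat d Q u i)\<^sup>2) = (\<Sum>i<d. (\<Sum>j<d. Q i j * u j) * (\<Sum>k<d. Q i k * u k))"
    by (simp add: apply_mat_def power2_eq_square)
  also have "\<dots> = (\<Sum>i<d. \<Sum>j<d. \<Sum>k<d. (Q i j * Q i k) * (u j * u k))"
    by (simp add: sum_product mult_ac)
  also have "\<dots> = (\<Sum>j<d. \<Sum>i<d. \<Sum>k<d. (Q i j * Q i k) * (u j * u k))"
    by (rule sum.swap)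
  also have "\<dots> = (\<Sum>j<d. \<Sum>k<d. (\<Sum>i<d. Q i j * Q i k) * (u j * u k))"
    unfolding sum_distrib_right by (rule sum.cong[OF refl], rule sum.swap)
  also have "\<dots> = (\<Sum>j<d. \<Sum>k<d. of_bool (j = k) * (u j * u k))"
    using Q by (intro sum.cong) (auto simp: orthogonal_mat_def)
  also have "\<dots> = (\<Sum>j<d. (u j)\<^sup>2)"
    by (simp add: power2_eq_square)
  finally show ?thesis by (simp add: L2_set_def)
qed

lemma apply_mat_add:
  "apply_mat d Q (add_Rn d u v) = add_Rn d (apply_mat d Q u) (apply_mat d Q v)"
  by (auto simp: apply_mat_def add_Rn_def sum.distrib algebra_simps)

lemma apply_mat_scale: "apply_mat d Q (scale_Rn d c u) = scale_Rn d c (apply_mat d Q u)"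
  by (auto simp: apply_mat_def scale_Rn_def sum_distrib_left mult_ac)

lemma apply_mat_in_space: "apply_mat d Q u \<in> space (lebesgue_Rn d)"
  by (simp add: apply_mat_def space_lebesgue_Rn)

lemma lebesgue_Rn_rotation_invariant:
  assumes Q: "orthogonal_mat d Q" and A[measurable]: "A \<in> sets (lebesgue_Rn d)" and d: "d > 0"
  shows "emeasure (lebesgue_Rn d) {u \<in> space (lebesgue_Rn d). apply_mat d Q u \<in> A} =
    emeasure (lebesgue_Rn d) A"
proof -
  let ?L = "lebesgue_Rn d" and ?T = "apply_mat d Q" and ?T' = "apply_mat d (\<lambda>i j. Q j i)"
  let ?B = "unit_ball d"
  interpret sigma_finite_measure ?L
    unfolding lebesgue_Rn_def by (rule Rn.sigma_finite) simp
  interpret P: pair_sigma_finite ?L ?L ..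
  have TT: "?T (?T' y) = y" if "y \<in> space ?L" for y
    using apply_mat_transpose[OF Q that] .
  have [measurable]: "?T \<in> ?L \<rightarrow>\<^sub>M ?L" "?T' \<in> ?L \<rightarrow>\<^sub>M ?L"
    using measurable_apply_mat[OF measurable_ident] by (auto simp: id_def)
  define LT where "LT = emeasure ?L {u \<in> space ?L. ?T u \<in> A}"
  have LT: "LT = (\<integral>\<^sup>+x. indicator A (?T x) \<partial>?L)"
  proof -
    have eq: "{u \<in> space ?L. ?T u \<in> A} = ?T -` A \<inter> space ?L" by auto
    have "LT = (\<integral>\<^sup>+x. indicator (?T -` A \<inter> space ?L) x \<partial>?L)"
      unfolding LT_def eq by (rule nn_integral_indicator[symmetric]) measurable
    also have "\<dots> = (\<integral>\<^sup>+x. indicator A (?T x) \<partial>?L)"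
      by (rule nn_integral_cong) (simp add: indicator_def)
    finally show ?thesis .
  qed
  have "LT * emeasure ?L ?B = (\<integral>\<^sup>+y. (\<integral>\<^sup>+x. indicator A (?T x) \<partial>?L) * indicator ?B y \<partial>?L)"
    by (simp add: LT nn_integral_cmult)
  also have "\<dots> = (\<integral>\<^sup>+y. (\<integral>\<^sup>+x. indicator A (add_Rn d (?T x) y) \<partial>?L) * indicator ?B y \<partial>?L)"
  proof (rule nn_integral_cong)
    fix y assume y: "y \<in> space ?L"
    have "(\<integral>\<^sup>+x. indicator A (?T x) \<partial>?L) = (\<integral>\<^sup>+x. indicator A (?T (add_Rn d x (?T' y))) \<partial>?L :: ennreal)"
      by (rule nn_integral_translate_Rn[symmetric]) (use apply_mat_in_space in \<open>measurable\<close>)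
    then show "(\<integral>\<^sup>+x. indicator A (?T x) \<partial>?L) * indicator ?B y =
      (\<integral>\<^sup>+x. indicator A (add_Rn d (?T x) y) \<partial>?L) * (indicator ?B y :: ennreal)"
      using TT[OF y] by (simp add: apply_mat_add)
  qed
  also have "\<dots> = (\<integral>\<^sup>+y. (\<integral>\<^sup>+x. indicator A (add_Rn d (?T x) y) * indicator ?B y \<partial>?L) \<partial>?L)"
    by (intro nn_integral_cong nn_integral_multc[symmetric]) measurable
  also have "\<dots> = (\<integral>\<^sup>+x. (\<integral>\<^sup>+y. indicator A (add_Rn d (?T x) y) * indicator ?B y \<partial>?L) \<partial>?L)"
    by (rule P.Fubini') measurable
  also have "\<dots> = (\<integral>\<^sup>+x. (\<integral>\<^sup>+y. indicator A y * indicator ?B (add_Rn d y (scale_Rn d (-1) (?T x))) \<partial>?L) \<partial>?L)"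
  proof (rule nn_integral_cong)
    fix x assume x: "x \<in> space ?L"
    have sp: "scale_Rn d (-1) (?T x) \<in> space ?L" "?T x \<in> space ?L"
      by (auto simp: scale_Rn_def space_lebesgue_Rn apply_mat_def)
    have *: "add_Rn d (add_Rn d y (?T x)) (scale_Rn d (-1) (?T x)) = y" if "y \<in> space ?L" for y
      using that by (auto simp: add_Rn_def scale_Rn_def space_lebesgue_Rn extensional_def)
    have "(\<integral>\<^sup>+y. indicator A y * indicator ?B (add_Rn d y (scale_Rn d (-1) (?T x))) \<partial>?L) =
      (\<integral>\<^sup>+y. indicator A (add_Rn d y (?T x)) *
         indicator ?B (add_Rn d (add_Rn d y (?T x)) (scale_Rn d (-1) (?T x))) \<partial>?L :: ennreal)"
      by (rule nn_integral_translate_Rn[symmetric]) (use sp in measurable)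
    also have "\<dots> = (\<integral>\<^sup>+y. indicator A (add_Rn d (?T x) y) * indicator ?B y \<partial>?L)"
      by (intro nn_integral_cong) (simp add: *, simp add: add_Rn_def add.commute)
    finally show "(\<integral>\<^sup>+y. indicator A (add_Rn d (?T x) y) * indicator ?B y \<partial>?L) =
      (\<integral>\<^sup>+y. indicator A y * indicator ?B (add_Rn d y (scale_Rn d (-1) (?T x))) \<partial>?L :: ennreal)" ..
  qed
  also have "\<dots> = (\<integral>\<^sup>+y. (\<integral>\<^sup>+x. indicator A y * indicator ?B (add_Rn d y (scale_Rn d (-1) (?T x))) \<partial>?L) \<partial>?L)"
    by (rule P.Fubini'[symmetric]) measurable
  also have "\<dots> = (\<integral>\<^sup>+y. indicator A y * (\<integral>\<^sup>+x. indicator ?B (add_Rn d y (scale_Rn d (-1) (?T x))) \<partial>?L) \<partial>?L)"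
    by (intro nn_integral_cong nn_integral_cmult) measurable
  also have "\<dots> = (\<integral>\<^sup>+y. indicator A y * emeasure ?L ?B \<partial>?L)"
  proof (rule nn_integral_cong)
    fix y assume y: "y \<in> space ?L"
    have "(\<integral>\<^sup>+x. indicator ?B (add_Rn d y (scale_Rn d (-1) (?T x))) \<partial>?L) =
      (\<integral>\<^sup>+x. indicator ?B (add_Rn d y (scale_Rn d (-1) (?T (add_Rn d x (?T' y))))) \<partial>?L :: ennreal)"
      by (rule nn_integral_translate_Rn[symmetric]) (use apply_mat_in_space y in \<open>measurable\<close>)
    also have "\<dots> = (\<integral>\<^sup>+x. indicator ?B x \<partial>?L)"
    proof (rule nn_integral_cong)
      fix x assume x: "x \<in> space ?L"
      have "add_Rn d y (scale_Rn d (-1) (?T (add_Rn d x (?T' y)))) = scale_Rn d (-1) (?T x)"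
        unfolding apply_mat_add TT[OF y] by (auto simp: add_Rn_def scale_Rn_def)
      moreover have "L2_set (scale_Rn d (-1) (?T x)) {..<d} = L2_set (?T x) {..<d}"
        by (simp add: L2_set_def scale_Rn_def)
      ultimately show "indicator ?B (add_Rn d y (scale_Rn d (-1) (?T (add_Rn d x (?T' y))))) =
          (indicator ?B x :: ennreal)"
        using x L2_set_apply_mat[OF Q]
        by (auto simp: indicator_def unit_ball_def space_lebesgue_Rn scale_Rn_def)
    qed
    finally show "indicator A y * (\<integral>\<^sup>+x. indicator ?B (add_Rn d y (scale_Rn d (-1) (?T x))) \<partial>?L) =
      indicator A y * emeasure ?L ?B" by simp
  qed
  also have "\<dots> = emeasure ?L A * emeasure ?L ?B"
    by (simp add: nn_integral_multc)
  finally have eq: "LT * emeasure ?L ?B = emeasure ?L A * emeasure ?L ?B" .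
  have "emeasure ?L ?B \<noteq> 0" "emeasure ?L ?B \<noteq> top"
    using emeasure_unit_ball_pos[OF d] emeasure_unit_ball_finite[of d] by auto
  then show ?thesis
    using eq unfolding LT_def by (metis mult_divide_eq_ennreal)
qed

lemma sphere_measure_rotation_invariant:
  assumes Q: "orthogonal_mat d Q" and A: "A \<in> sets (sphere_measure d)" and d: "d > 0"
  shows "emeasure (sphere_measure d) {u \<in> unit_sphere d. apply_mat d Q u \<in> A} =
    emeasure (sphere_measure d) A"
proof -
  let ?L = "lebesgue_Rn d" and ?T = "apply_mat d Q"
  have A'[measurable]: "A \<in> sets ?L" and AS: "A \<subseteq> unit_sphere d"
    using A unfolding sphere_measure_def by (auto simp: sets_restrict_space)
  have [measurable]: "?T \<in> ?L \<rightarrow>\<^sub>M ?L"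
    using measurable_apply_mat[OF measurable_ident] by (auto simp: id_def)
  have proj: "radial_proj d (?T u) = ?T (radial_proj d u)" for u
    by (simp add: radial_proj_def apply_mat_scale L2_set_apply_mat[OF Q])
  have "{u \<in> unit_sphere d. ?T u \<in> A} = unit_sphere d \<inter> (?T -` A \<inter> space ?L)"
    by (auto simp: unit_sphere_def)
  also have "\<dots> \<in> sets ?L" by measurable
  finally have S: "{u \<in> unit_sphere d. ?T u \<in> A} \<in> sets ?L" .
  have "{u \<in> unit_ball d. radial_proj d u \<in> A} = unit_ball d \<inter> (radial_proj d -` A \<inter> space ?L)"
    by (auto simp: unit_ball_def)
  also have "\<dots> \<in> sets ?L" by measurable
  finally have S2: "{u \<in> unit_ball d. radial_proj d u \<in> A} \<in> sets ?L" .
  have "radial_proj d u \<in> unit_sphere d"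
    if "u \<in> unit_ball d" "?T (radial_proj d u) \<in> A" for u
    using that(2) AS by (auto simp: unit_sphere_def L2_set_apply_mat[OF Q] radial_proj_in_space)
  moreover have "?T u \<in> unit_ball d \<longleftrightarrow> u \<in> unit_ball d" if "u \<in> space ?L" for u
    using that by (simp add: unit_ball_def L2_set_apply_mat[OF Q] apply_mat_in_space)
  ultimately have eq: "{u \<in> unit_ball d. radial_proj d u \<in> {u \<in> unit_sphere d. ?T u \<in> A}} =
     {u \<in> space ?L. ?T u \<in> {u \<in> unit_ball d. radial_proj d u \<in> A}}"
    unfolding mem_Collect_eq proj using sets.sets_into_space[OF unit_ball_sets[of d]] by blast
  have "{u \<in> unit_sphere d. ?T u \<in> A} \<subseteq> unit_sphere d"
    by blast
  then show ?thesis
    unfolding emeasure_sphere_measure[OF A' AS] emeasure_sphere_measure[OF S] eq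
    by (simp only: emeasure_sphere_measure[OF S] eq lebesgue_Rn_rotation_invariant[OF Q S2 d])
qed

end

theory Submission
  imports Defs
begin

text \<open>
  Choosing the centres one after another, each at least as good as the average over a random centre,
  leaves a proportion of at most \<open>(1 - 2/N)^(N/2) \<le> 1/e\<close> of the sphere uncovered. Conversely, the
  uncovered set is an intersection of \<open>N/2\<close> symmetric slabs. On the sphere slabs need not be positively
  correlated, but for the Gaussian measure they are (Sidak's inequality, a consequence of the
  log-concavity of marginals), and the normalized Gaussian vector is uniform on the sphere. Its norm
  is \<open>sqrt d + O(1)\<close>, and the caps are so small that they correspond to Gaussian
  thresholds of order \<open>sqrt (ln N)\<close>; passing between the two measures therefore changes the measure of a slab
  complement by a factor \<open>1 + o(1)\<close> precisely when \<open>ln N = o(sqrt d)\<close>.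
\<close>

section \<open>The Prekopa-Leindler inequality on the line\<close>

text \<open>The lower bound for the coverage is exact for every \<open>d >= 3\<close>; only the
  upper bound is asymptotic, and it needs just one direction of the Gaussian comparison: a two-sided
  Gaussian tail of at most \<open>(1 + o(1)) * 2 / N\<close>. A cap of height \<alpha> corresponds
  to a Gaussian threshold whose square is about \<alpha> squared times the squared norm, and a
  Gaussian tail keeps its size up to \<open>1 + o(1)\<close> as long as the squared threshold moves
  by \<open>o(1)\<close>. The crude estimate \<open>2 * ln N / d\<close> for \<alpha> squared, times
  norm fluctuations of order \<open>sqrt d\<close>, moves it by order
  \<open>e = ln N / sqrt d\<close>; this is where the growth hypothesis enters. As the squared norm
  is controlled by Chebyshev only, a deviation \<open>sqrt (d / e)\<close> is allowed: it costs
  \<open>2 * e\<close> in probability and order \<open>sqrt e\<close> in the squared threshold.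
  Marginals are taken one coordinate at a time, so Prekopa-Leindler is needed on the line only.
  There the dominating function has intervals as superlevel sets, which reduces Brunn-Minkowski to a
  comparison of diameters.\<close>

lemma emeasure_lborel_le_diam:
  fixes A :: "real set"
  assumes "A \<noteq> {}" and diam: "\<And>x y. x \<in> A \<Longrightarrow> y \<in> A \<Longrightarrow> y - x \<le> L"
  shows "emeasure lborel A \<le> ennreal L"
proof -
  obtain a where a: "a \<in> A" using assms(1) by blast
  have bdd: "bdd_above A"
  proof
    fix y assume "y \<in> A" with diam[OF a this] show "y \<le> a + L" by simp
  qed
  have sub: "A \<subseteq> {Sup A - L..Sup A}"
  proof
    fix x assume x: "x \<in> A"
    have "Sup A \<le> x + L"
      using assms(1) by (rule cSup_least) (use diam[OF x] in force)
    then show "x \<in> {Sup A - L..Sup A}" using cSup_upper[OF x bdd] by simp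
  qed
  have "L \<ge> 0" using diam[OF a a] by simp
  have "emeasure lborel A \<le> emeasure lborel {Sup A - L..Sup A}"
    using sub by (rule emeasure_mono) simp
  then show ?thesis using \<open>L \<ge> 0\<close> by simp
qed

lemma emeasure_lborel_convex_ge:
  fixes C :: "real set"
  assumes "convex C" "x \<in> C" "y \<in> C" and [measurable]: "C \<in> sets borel"
  shows "ennreal (y - x) \<le> emeasure lborel C"
proof (cases "x \<le> y")
  case True
  have "{x..y} \<subseteq> C"
    using assms closed_segment_subset[of x C y] closed_segment_eq_real_ivl[of x y] True by auto
  then have "emeasure lborel {x..y} \<le> emeasure lborel C"
    by (rule emeasure_mono) simp
  then show ?thesis using True by simp
qed (simp add: ennreal_neg)

text \<open>Since \<open>C\<close> is an interval, its length bounds the distance of any two points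
  that it contains, hence \<open>(1 - t)\<close> times any difference in \<open>A\<close> plus
  \<open>t\<close> times any difference in \<open>B\<close>. The measures of \<open>A\<close> and
  \<open>B\<close> are at most their diameters.\<close>

lemma brunn_minkowski_line:
  fixes A B C :: "real set"
  assumes "A \<noteq> {}" "B \<noteq> {}" and t: "0 < t" "t < 1"
    and C: "convex C" "C \<in> sets borel"
    and sub: "\<And>x y. x \<in> A \<Longrightarrow> y \<in> B \<Longrightarrow> (1 - t) * x + t * y \<in> C"
  shows "ennreal (1 - t) * emeasure lborel A + ennreal t * emeasure lborel B \<le> emeasure lborel C"
proof (cases "emeasure lborel C")
  case (real c)
  have *: "(1 - t) * (x' - x) + t * (y' - y) \<le> c"
    if "x \<in> A" "x' \<in> A" "y \<in> B" "y' \<in> B" for x x' y y'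
  proof -
    have "ennreal (((1 - t) * x' + t * y') - ((1 - t) * x + t * y)) \<le> ennreal c"
      unfolding real(2)[symmetric] by (rule emeasure_lborel_convex_ge) (use C sub that in auto)
    then show ?thesis using real(1) by (simp add: algebra_simps)
  qed
  obtain a0 where a0: "a0 \<in> A" using assms(1) by blast
  define a where "a = measure lborel A"
  have fin: "emeasure lborel A \<le> ennreal (c / (1 - t))"
  proof (rule emeasure_lborel_le_diam[OF assms(1)])
    fix x y assume xy: "x \<in> A" "y \<in> A"
    from assms(2) obtain b where "b \<in> B" by blast
    from *[OF xy this this] show "y - x \<le> c / (1 - t)" using t by (simp add: field_simps)
  qed
  then have ea: "emeasure lborel A = ennreal a"
    unfolding a_def by (intro emeasure_eq_ennreal_measure) (auto simp: top_unique)
  have a: "0 \<le> a" by (simp add: a_def)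
  \<comment> \<open>For fixed \<open>y\<close>, \<open>y'\<close> the estimate bounds the diameter
    of \<open>A\<close>, hence \<open>a\<close>; solved for \<open>y' - y\<close>, this bounds the
    diameter of \<open>B\<close>.\<close>
  have B: "emeasure lborel B \<le> ennreal ((c - (1 - t) * a) / t)"
  proof (rule emeasure_lborel_le_diam[OF assms(2)])
    fix y y' assume y: "y \<in> B" "y' \<in> B"
    have "emeasure lborel A \<le> ennreal ((c - t * (y' - y)) / (1 - t))"
    proof (rule emeasure_lborel_le_diam[OF assms(1)])
      fix x x' assume x: "x \<in> A" "x' \<in> A"
      show "x' - x \<le> (c - t * (y' - y)) / (1 - t)"
        using *[OF x y] t by (simp add: field_simps)
    qed
    moreover have "0 \<le> (c - t * (y' - y)) / (1 - t)" using *[OF a0 a0 y] t by simp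
    ultimately have "a \<le> (c - t * (y' - y)) / (1 - t)" unfolding ea using a by simp
    then show "y' - y \<le> (c - (1 - t) * a) / t" using t by (simp add: field_simps)
  qed
  obtain b0 where b0: "b0 \<in> B" using assms(2) by blast
  have "emeasure lborel A \<le> ennreal (c / (1 - t))" by (rule fin)
  then have "a \<le> c / (1 - t)" unfolding ea using a real(1) t by simp
  then have nn: "0 \<le> (c - (1 - t) * a) / t" using t by (simp add: field_simps)
  define b where "b = (c - (1 - t) * a) / t"
  have "ennreal (1 - t) * emeasure lborel A + ennreal t * emeasure lborel B \<le>
    ennreal (1 - t) * ennreal a + ennreal t * ennreal b"
    unfolding ea b_def by (intro add_left_mono mult_left_mono B) simp
  also have "\<dots> = ennreal ((1 - t) * a + t * b)"
    using t a nn[folded b_def] by (simp add: ennreal_mult')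
  also have "(1 - t) * a + t * b = c"
    using t by (simp add: b_def)
  finally show ?thesis using real by simp
qed simp

text \<open>The cap at 1 restricts the levels to those below the supremum of a normalized function,
  where the level sets to be compared are nonempty.\<close>

lemma nn_integral_layer_cake_min:
  fixes f :: "real \<Rightarrow> real"
  assumes [measurable]: "f \<in> borel_measurable borel"
  shows "(\<integral>\<^sup>+x. ennreal (min 1 (f x)) \<partial>lborel) =
    (\<integral>\<^sup>+s. emeasure lborel {x. s < f x} * indicator {0<..<1} s \<partial>lborel)"
proof -
  have "(\<integral>\<^sup>+x. ennreal (min 1 (f x)) \<partial>lborel) =
      (\<integral>\<^sup>+x. (\<integral>\<^sup>+s. indicator {x. s < f x} x * indicator {0<..<1} s \<partial>lborel) \<partial>lborel)"
  proof (rule nn_integral_cong)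
    fix x
    have "(\<integral>\<^sup>+s. indicator {x. s < f x} x * indicator {0<..<1} s \<partial>lborel) =
      (\<integral>\<^sup>+s. indicator {0<..<min 1 (f x)} s \<partial>lborel)"
      by (rule nn_integral_cong) (auto simp: indicator_def)
    also have "\<dots> = ennreal (min 1 (f x))"
      by (cases "0 \<le> f x") (auto simp: ennreal_neg min_def)
    finally show "ennreal (min 1 (f x)) = (\<integral>\<^sup>+s. indicator {x. s < f x} x * indicator {0<..<1} s \<partial>lborel)" ..
  qed
  also have "\<dots> = (\<integral>\<^sup>+s. (\<integral>\<^sup>+x. indicator {x. s < f x} x * indicator {0<..<1} s \<partial>lborel) \<partial>lborel)"
  proof (rule lborel_pair.Fubini'[symmetric])
    have "Measurable.pred (lborel \<Otimes>\<^sub>M lborel) (\<lambda>z. snd z < f (fst z))" by measurable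
    then show "(\<lambda>(x, s). indicator {x. s < f x} x * indicator {0<..<1} s :: ennreal) \<in>
       borel_measurable (lborel \<Otimes>\<^sub>M lborel)"
      unfolding split_beta' indicator_def mem_Collect_eq by measurable
  qed
  also have "\<dots> = (\<integral>\<^sup>+s. emeasure lborel {x. s < f x} * indicator {0<..<1} s \<partial>lborel)"
    by (intro nn_integral_cong) (simp add: nn_integral_multc)
  finally show ?thesis .
qed

text \<open>Dividing \<open>f\<close> and \<open>g\<close> by their suprema makes all level sets
  with \<open>s < 1\<close> nonempty, so Brunn-Minkowski applies level by level and gives an
  inequality with the arithmetic mean of the normalized integrals. The weighted inequality of
  arithmetic and geometric means finishes. The hypothesis \<open>qc\<close> makes the level sets of
  \<open>h\<close> intervals.\<close>

lemma prekopa_leindler_line: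
  fixes f g h :: "real \<Rightarrow> real"
  assumes t: "0 < t" "t < 1"
    and int: "integrable lborel f" "integrable lborel g" "integrable lborel h"
    and nn: "\<And>x. 0 \<le> f x" "\<And>x. 0 \<le> g x" "\<And>x. 0 \<le> h x"
    and bd: "\<And>x. f x \<le> c" "\<And>x. g x \<le> c"
    and fgh: "\<And>x y. f x powr (1 - t) * g y powr t \<le> h ((1 - t) * x + t * y)"
    and qc: "\<And>s. convex {x. s < h x}"
  shows "(\<integral>x. f x \<partial>lborel) powr (1 - t) * (\<integral>x. g x \<partial>lborel) powr t \<le> (\<integral>x. h x \<partial>lborel)"
proof -
  have [measurable]: "f \<in> borel_measurable borel" "g \<in> borel_measurable borel" "h \<in> borel_measurable borel"
    using int[THEN borel_measurable_integrable] by simp_all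
  define a b where "a = Sup (range f)" "b = Sup (range g)"
  define F G H where "F = (\<integral>x. f x \<partial>lborel)" "G = (\<integral>x. g x \<partial>lborel)" "H = (\<integral>x. h x \<partial>lborel)"
  have FGH0: "0 \<le> F" "0 \<le> G" "0 \<le> H"
    unfolding F_G_H_def by (simp_all add: nn integral_nonneg_AE)
  have bdd: "bdd_above (range f)" "bdd_above (range g)" using bd by (auto intro!: bdd_aboveI)
  have fa: "f x \<le> a" and gb: "g x \<le> b" for x
    unfolding a_b_def by (rule cSup_upper, simp, rule bdd)+
  show ?thesis
  proof (cases "F = 0 \<or> G = 0")
    case True
    then show ?thesis using FGH0 unfolding F_G_H_def by auto
  next
    case False
    have "0 < a"
    proof (rule ccontr)
      assume "\<not> 0 < a"
      then have "f = (\<lambda>_. 0)" using fa nn(1) by (intro ext antisym) (auto simp: not_less intro: order_trans)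
      with False show False by (simp add: F_G_H_def)
    qed
    have "0 < b"
    proof (rule ccontr)
      assume "\<not> 0 < b"
      then have "g = (\<lambda>_. 0)" using gb nn(2) by (intro ext antisym) (auto simp: not_less intro: order_trans)
      with False show False by (simp add: F_G_H_def)
    qed
    \<comment> \<open>The scale of \<open>h\<close> that matches the scales \<open>a\<close> and
      \<open>b\<close>: if \<open>f x > s * a\<close> and \<open>g y > s * b\<close>, then
      \<open>h > s * m\<close> at the intermediate point.\<close>
    define m where "m = a powr (1 - t) * b powr t"
    have m: "0 < m" using \<open>0 < a\<close> \<open>0 < b\<close> by (simp add: m_def)
    have level: "ennreal (1 - t) * emeasure lborel {x. s < f x / a} + ennreal t * emeasure lborel {x. s < g x / b}
        \<le> emeasure lborel {x. s < h x / m}" if s: "0 < s" "s < 1" for s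
    proof (rule brunn_minkowski_line[OF _ _ t])
      have "s * a < a" using s \<open>0 < a\<close> by simp
      then obtain x where "s * a < f x"
        unfolding a_b_def using less_cSup_iff[OF _ bdd(1)] by auto
      then show "{x. s < f x / a} \<noteq> {}" using \<open>0 < a\<close> by (auto simp: field_simps)
      have "s * b < b" using s \<open>0 < b\<close> by simp
      then obtain x where "s * b < g x"
        unfolding a_b_def using less_cSup_iff[OF _ bdd(2)] by auto
      then show "{x. s < g x / b} \<noteq> {}" using \<open>0 < b\<close> by (auto simp: field_simps)
      have "{x. s < h x / m} = {x. s * m < h x}" using m by (auto simp: field_simps)
      then show "convex {x. s < h x / m}" using qc by simp
      show "{x. s < h x / m} \<in> sets borel" by measurable
      fix x y assume "x \<in> {x. s < f x / a}" "y \<in> {x. s < g x / b}"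
      then have x: "s * a < f x" and y: "s * b < g y" using \<open>0 < a\<close> \<open>0 < b\<close> by (auto simp: field_simps)
      have "0 < s * a" "0 < s * b" using s \<open>0 < a\<close> \<open>0 < b\<close> by simp_all
      then have pos: "0 < f x" "0 < g y" using x y by linarith+
      have "s * m = (s powr (1 - t) * s powr t) * m" using s by (simp add: powr_add[symmetric])
      also have "\<dots> = (s * a) powr (1 - t) * (s * b) powr t"
        using s \<open>0 < a\<close> \<open>0 < b\<close> by (simp add: m_def powr_mult)
      also have "\<dots> < f x powr (1 - t) * g y powr t"
        using x y s t pos \<open>0 < a\<close> \<open>0 < b\<close> by (intro mult_strict_mono powr_less_mono2) auto
      also have "\<dots> \<le> h ((1 - t) * x + t * y)" by (rule fgh)
      finally show "(1 - t) * x + t * y \<in> {x. s < h x / m}" using m by (simp add: field_simps)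
    qed
    have "ennreal ((1 - t) * (F / a) + t * (G / b)) =
        ennreal (1 - t) * ennreal (F / a) + ennreal t * ennreal (G / b)"
      using t FGH0 \<open>0 < a\<close> \<open>0 < b\<close> by (simp add: ennreal_mult'[symmetric])
    also have "ennreal (F / a) = (\<integral>\<^sup>+x. ennreal (min 1 (f x / a)) \<partial>lborel)"
    proof -
      have "min 1 (f x / a) = f x / a" for x using fa[of x] \<open>0 < a\<close> by simp
      then show ?thesis using int(1) nn(1) \<open>0 < a\<close>
        by (subst nn_integral_eq_integral) (auto simp: F_G_H_def)
    qed
    also have "ennreal (G / b) = (\<integral>\<^sup>+x. ennreal (min 1 (g x / b)) \<partial>lborel)"
    proof -
      have "min 1 (g x / b) = g x / b" for x using gb[of x] \<open>0 < b\<close> by simp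
      then show ?thesis using int(2) nn(2) \<open>0 < b\<close>
        by (subst nn_integral_eq_integral) (auto simp: F_G_H_def)
    qed
    also have "ennreal (1 - t) * (\<integral>\<^sup>+x. ennreal (min 1 (f x / a)) \<partial>lborel) +
        ennreal t * (\<integral>\<^sup>+x. ennreal (min 1 (g x / b)) \<partial>lborel) =
       (\<integral>\<^sup>+s. (ennreal (1 - t) * emeasure lborel {x. s < f x / a} +
          ennreal t * emeasure lborel {x. s < g x / b}) * indicator {0<..<1} s \<partial>lborel)"
      by (simp add: nn_integral_layer_cake_min nn_integral_add nn_integral_cmult distrib_right mult.assoc)
    also have "\<dots> \<le> (\<integral>\<^sup>+s. emeasure lborel {x. s < h x / m} * indicator {0<..<1} s \<partial>lborel)"
      using level by (intro nn_integral_mono) (auto simp: indicator_def)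
    also have "\<dots> = (\<integral>\<^sup>+x. ennreal (min 1 (h x / m)) \<partial>lborel)"
      by (simp add: nn_integral_layer_cake_min)
    also have "\<dots> \<le> (\<integral>\<^sup>+x. ennreal (h x / m) \<partial>lborel)"
      by (intro nn_integral_mono ennreal_leI) simp
    also have "\<dots> = ennreal (H / m)"
      using int(3) nn(3) m by (subst nn_integral_eq_integral) (auto simp: F_G_H_def)
    finally have le: "(1 - t) * (F / a) + t * (G / b) \<le> H / m"
      using FGH0 m by (simp add: divide_nonneg_pos)
    have "F powr (1 - t) * G powr t = m * ((F / a) powr (1 - t) * (G / b) powr t)"
      using FGH0 \<open>0 < a\<close> \<open>0 < b\<close> by (simp add: m_def powr_divide)
    also have "\<dots> \<le> m * ((1 - t) * (F / a) + t * (G / b))"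
      using m False FGH0 t \<open>0 < a\<close> \<open>0 < b\<close> by (intro mult_left_mono Youngs_inequality_0) auto
    also have "\<dots> \<le> H" using le m by (simp add: field_simps)
    finally show ?thesis unfolding F_G_H_def .
  qed
qed

section \<open>Marginals of even log-concave functions\<close>

lemma std_normal_density_le_1: "std_normal_density x \<le> 1"
proof -
  have "sqrt (2 * pi) \<ge> 1" using pi_ge_two by simp
  then have "1 / sqrt (2 * pi) * exp (- x\<^sup>2 / 2) \<le> 1 * 1"
    by (intro mult_mono) auto
  then show ?thesis by (simp add: std_normal_density_def)
qed

lemma std_normal_density_log_concave:
  assumes t: "0 < t" "t < 1"
  shows "std_normal_density x powr (1 - t) * std_normal_density y powr t
    \<le> std_normal_density ((1 - t) * x + t * y)"
proof -
  define c where "c = 1 / sqrt (2 * pi)"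
  have c: "0 < c" by (simp add: c_def)
  have \<phi>: "std_normal_density z = c * exp (- z\<^sup>2 / 2)" for z
    by (simp add: std_normal_density_def c_def)
  have "((1 - t) * x + t * y)\<^sup>2 = (1 - t) * x\<^sup>2 + t * y\<^sup>2 - t * (1 - t) * (x - y)\<^sup>2"
    by (simp add: power2_eq_square algebra_simps)
  also have "\<dots> \<le> (1 - t) * x\<^sup>2 + t * y\<^sup>2" using t by simp
  finally have le: "(1 - t) * (- x\<^sup>2 / 2) + t * (- y\<^sup>2 / 2) \<le> - ((1 - t) * x + t * y)\<^sup>2 / 2" by simp
  have "std_normal_density x powr (1 - t) * std_normal_density y powr t =
    (c powr (1 - t) * c powr t) * (exp (- x\<^sup>2 / 2) powr (1 - t) * exp (- y\<^sup>2 / 2) powr t)"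
    unfolding \<phi> using c by (simp add: powr_mult)
  also have "\<dots> = c * exp ((1 - t) * (- x\<^sup>2 / 2) + t * (- y\<^sup>2 / 2))"
    using c by (simp add: powr_add[symmetric] exp_powr_real mult_exp_exp mult.commute)
  also have "\<dots> \<le> c * exp (- ((1 - t) * x + t * y)\<^sup>2 / 2)" using c le by simp
  finally show ?thesis by (simp add: \<phi>)
qed

text \<open>The functions live on all sequences rather than on \<open>{..<d}\<close>, so that
  integrating out a coordinate stays within the same class. The bound 1 supplies integrability, and
  since \<open>0 powr s = 0\<close> the last condition also covers functions with zeros, such as
  indicators of convex sets.\<close>

definition even_log_concave :: "((nat \<Rightarrow> real) \<Rightarrow> real) \<Rightarrow> bool" where
  "even_log_concave F \<longleftrightarrow> F \<in> borel_measurable (\<Pi>\<^sub>M i\<in>UNIV. borel) \<and>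
     (\<forall>u. 0 \<le> F u \<and> F u \<le> 1 \<and> F (\<lambda>i. - u i) = F u) \<and>
     (\<forall>u v t. 0 < t \<longrightarrow> t < 1 \<longrightarrow> F u powr (1 - t) * F v powr t \<le> F (\<lambda>i. (1 - t) * u i + t * v i))"

definition gauss_marginal :: "nat \<Rightarrow> ((nat \<Rightarrow> real) \<Rightarrow> real) \<Rightarrow> (nat \<Rightarrow> real) \<Rightarrow> real" where
  "gauss_marginal k F u = (\<integral>y. std_normal_density y * F (u(k := y)) \<partial>lborel)"

lemma measurable_fun_upd_UNIV [measurable]:
  "(\<lambda>z. (fst z)(k := snd z)) \<in> (\<Pi>\<^sub>M i\<in>UNIV. borel) \<Otimes>\<^sub>M borel \<rightarrow>\<^sub>M (\<Pi>\<^sub>M i\<in>(UNIV::nat set). (borel::real measure))"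
  by (rule measurable_PiM_single') (auto simp: fun_upd_def space_PiM)

lemma measurable_fun_upd_right [measurable]:
  "(\<lambda>y. u(k := y)) \<in> borel \<rightarrow>\<^sub>M (\<Pi>\<^sub>M i\<in>(UNIV::nat set). (borel::real measure))"
  by (rule measurable_PiM_single') (auto simp: fun_upd_def space_PiM)

text \<open>Prekopa-Leindler in the variable \<open>k\<close>, applied to the slices through
  \<open>u\<close>, \<open>v\<close> and their convex combination, each weighted with the Gaussian
  density. Evenness follows from the substitution of \<open>-y\<close> for \<open>y\<close>.\<close>

lemma even_log_concave_gauss_marginal:
  assumes F: "even_log_concave F"
  shows "even_log_concave (gauss_marginal k F)"
proof -
  have [measurable]: "F \<in> borel_measurable (\<Pi>\<^sub>M i\<in>UNIV. borel)"
    and F0: "0 \<le> F u" and F1: "F u \<le> 1" and even: "F (\<lambda>i. - u i) = F u"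
    and lc: "\<And>t. 0 < t \<Longrightarrow> t < 1 \<Longrightarrow> F u powr (1 - t) * F v powr t \<le> F (\<lambda>i. (1 - t) * u i + t * v i)"
    for u v using F by (auto simp: even_log_concave_def)
  let ?\<phi> = std_normal_density
  have int\<phi>: "integrable lborel ?\<phi>" "(\<integral>y. ?\<phi> y \<partial>lborel) = 1"
    by (auto simp: integrable_normal_density integral_normal_density)
  have int: "integrable lborel (\<lambda>y. ?\<phi> y * F (u(k := y)))" for u
  proof (rule Bochner_Integration.integrable_bound[OF int\<phi>(1)])
    show "AE y in lborel. norm (?\<phi> y * F (u(k := y))) \<le> norm (?\<phi> y)"
      using F0 F1 by (auto simp: abs_mult mult_left_le)
  qed measurable
  have lc1: "(?\<phi> x * F (u(k := x))) powr (1 - t) * (?\<phi> y * F (v(k := y))) powr t \<le>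
     ?\<phi> ((1 - t) * x + t * y) * F ((\<lambda>i. (1 - t) * u i + t * v i)(k := (1 - t) * x + t * y))"
    if t: "0 < t" "t < 1" for u v t x y
  proof -
    have eq: "(\<lambda>i. (1 - t) * u i + t * v i)(k := (1 - t) * x + t * y) =
        (\<lambda>i. (1 - t) * (u(k := x)) i + t * (v(k := y)) i)" by auto
    have "(?\<phi> x * F (u(k := x))) powr (1 - t) * (?\<phi> y * F (v(k := y))) powr t =
      (?\<phi> x powr (1 - t) * ?\<phi> y powr t) * (F (u(k := x)) powr (1 - t) * F (v(k := y)) powr t)"
      using F0 by (simp add: powr_mult)
    also have "\<dots> \<le> ?\<phi> ((1 - t) * x + t * y) * F (\<lambda>i. (1 - t) * (u(k := x)) i + t * (v(k := y)) i)"
      by (intro mult_mono std_normal_density_log_concave lc t) simp_all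
    finally show ?thesis unfolding eq .
  qed
  \<comment> \<open>Superlevel sets of a log-concave function are convex; this is \<open>lc1\<close>
    with both base points equal to \<open>w\<close>, and it supplies the hypothesis
    \<open>qc\<close>.\<close>
  have conv: "convex {x. s < ?\<phi> x * F (w(k := x))}" for s w
    unfolding convex_alt
  proof (intro ballI allI impI)
    fix x y t assume x: "x \<in> {x. s < ?\<phi> x * F (w(k := x))}" and y: "y \<in> {x. s < ?\<phi> x * F (w(k := x))}"
      and t: "0 \<le> t \<and> (t::real) \<le> 1"
    consider "t = 0" | "t = 1" | "0 < t" "t < 1" using t by linarith
    then have "s < ?\<phi> ((1 - t) * x + t * y) * F (w(k := (1 - t) * x + t * y))"
    proof cases
      case 3
      let ?h = "\<lambda>x. ?\<phi> x * F (w(k := x))"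
      have w: "(\<lambda>i. (1 - t) * w i + t * w i) = w" by (auto simp: algebra_simps)
      define r where "r = min (?h x) (?h y)"
      have nn: "0 \<le> ?h x" "0 \<le> ?h y" using F0 by simp_all
      have "s < r" using x y by (simp add: r_def)
      also have "r = r powr (1 - t) * r powr t"
        using nn by (simp add: powr_add[symmetric] r_def)
      also have "\<dots> \<le> ?h x powr (1 - t) * ?h y powr t"
        using nn 3 by (intro mult_mono powr_mono2) (auto simp: r_def)
      also have "\<dots> \<le> ?h ((1 - t) * x + t * y)"
        using lc1[OF 3, of x w y w] unfolding w .
      finally show ?thesis .
    qed (use x y in auto)
    then show "(1 - t) *\<^sub>R x + t *\<^sub>R y \<in> {x. s < ?\<phi> x * F (w(k := x))}" by simp
  qed
  have "(\<lambda>u. \<integral>y. ?\<phi> y * F (u(k := y)) \<partial>lborel) \<in> borel_measurable (\<Pi>\<^sub>M i\<in>UNIV. borel)"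
    by measurable
  then have "gauss_marginal k F \<in> borel_measurable (\<Pi>\<^sub>M i\<in>UNIV. borel)"
    by (simp add: gauss_marginal_def[abs_def])
  moreover have "0 \<le> gauss_marginal k F u" for u
    unfolding gauss_marginal_def using F0 by (intro integral_nonneg_AE) simp
  moreover have "gauss_marginal k F u \<le> 1" for u
  proof -
    have "gauss_marginal k F u \<le> (\<integral>y. ?\<phi> y \<partial>lborel)"
      unfolding gauss_marginal_def using F0 F1 by (intro integral_mono int int\<phi>) (simp add: mult_left_le)
    then show ?thesis by (simp only: int\<phi>(2))
  qed
  moreover have "gauss_marginal k F (\<lambda>i. - u i) = gauss_marginal k F u" for u
  proof -
    have "gauss_marginal k F u = (\<integral>y. ?\<phi> (0 + (-1) * y) * F (u(k := 0 + (-1) * y)) \<partial>lborel)"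
      unfolding gauss_marginal_def by (subst lborel_integral_real_affine[where c="-1" and t=0]) simp_all
    also have "\<dots> = (\<integral>y. ?\<phi> y * F ((\<lambda>i. - u i)(k := y)) \<partial>lborel)"
    proof (rule Bochner_Integration.integral_cong[OF refl])
      fix y
      have "F (u(k := 0 + (-1) * y)) = F (\<lambda>i. - (u(k := 0 + (-1) * y)) i)" by (rule even[symmetric])
      also have "(\<lambda>i. - (u(k := 0 + (-1) * y)) i) = (\<lambda>i. - u i)(k := y)" by auto
      finally have eq: "F (u(k := 0 + (-1) * y)) = F ((\<lambda>i. - u i)(k := y))" .
      show "?\<phi> (0 + (-1) * y) * F (u(k := 0 + (-1) * y)) = ?\<phi> y * F ((\<lambda>i. - u i)(k := y))"
        unfolding eq by (simp add: std_normal_density_def)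
    qed
    finally show ?thesis by (simp add: gauss_marginal_def)
  qed
  moreover have "gauss_marginal k F u powr (1 - t) * gauss_marginal k F v powr t \<le>
      gauss_marginal k F (\<lambda>i. (1 - t) * u i + t * v i)" if t: "0 < t" "t < 1" for u v t
    unfolding gauss_marginal_def
  proof (rule prekopa_leindler_line[where c=1])
    have "?\<phi> x * F (w(k := x)) \<le> 1" for x w
      using F1[of "w(k:=x)"] F0[of "w(k:=x)"] std_normal_density_le_1[of x] by (intro mult_le_one) auto
    then show "?\<phi> x * F (u(k := x)) \<le> 1" "?\<phi> x * F (v(k := x)) \<le> 1" for x by blast+
  qed (use t int F0 in simp_all, (rule lc1[OF t] conv)+)
  ultimately show ?thesis unfolding even_log_concave_def by blast
qed

section \<open>Gaussian product measures and the correlation of a slab with an even log-concave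
  function\<close>

definition gauss :: "nat set \<Rightarrow> (nat \<Rightarrow> real) measure" where
  "gauss I = (\<Pi>\<^sub>M i\<in>I. std_normal_distribution)"

interpretation std_normal: prob_space std_normal_distribution
  by (rule prob_space_normal_density) simp

interpretation gauss: product_prob_space "\<lambda>i::nat. std_normal_distribution" UNIV
  by standard

lemma prob_space_gauss: "prob_space (gauss I)"
  unfolding gauss_def by (rule prob_space_PiM) (rule std_normal.prob_space_axioms)

lemma sets_gauss [measurable_cong]: "sets (gauss I) = sets (\<Pi>\<^sub>M i\<in>I. borel)"
  unfolding gauss_def by (rule sets_PiM_cong) auto

lemma space_gauss: "space (gauss I) = extensional I"
  by (simp add: gauss_def space_PiM PiE_def)

lemma measurable_override [measurable]:
  "(\<lambda>x i. if i \<in> I then x i else w i) \<in> gauss I \<rightarrow>\<^sub>M (\<Pi>\<^sub>M i\<in>(UNIV::nat set). (borel::real measure))"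
proof (rule measurable_PiM_single')
  fix i show "(\<lambda>x. if i \<in> I then x i else w i) \<in> gauss I \<rightarrow>\<^sub>M borel"
  proof (cases "i \<in> I")
    case True
    then have "(\<lambda>x. x i) \<in> gauss I \<rightarrow>\<^sub>M std_normal_distribution"
      unfolding gauss_def by (rule measurable_component_singleton)
    then show ?thesis using True by simp
  qed simp
qed (auto simp: space_PiM)

lemma std_normal_integral:
  assumes "f \<in> borel_measurable borel"
  shows "(\<integral>y. f y \<partial>std_normal_distribution) = (\<integral>y. std_normal_density y * f y \<partial>lborel)"
  using assms by (subst integral_real_density) simp_all

text \<open>By Fubini, integrating over \<open>insert k I\<close> is integrating
  \<open>gauss_marginal k F\<close> over \<open>I\<close>; the induction therefore has to range over
  all \<open>F\<close>.\<close>

lemma even_log_concave_gauss_integral: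
  assumes "finite I" "even_log_concave F"
  shows "even_log_concave (\<lambda>w. \<integral>x. F (\<lambda>i. if i \<in> I then x i else w i) \<partial>gauss I)"
  using assms
proof (induction I arbitrary: F)
  case empty
  have "measure (gauss {}) (space (gauss {})) = 1"
    using prob_space.prob_space[OF prob_space_gauss] .
  then show ?case using empty by simp
next
  case (insert k I)
  from insert.prems have F[measurable]: "F \<in> borel_measurable (\<Pi>\<^sub>M i\<in>UNIV. borel)"
    and F0: "\<And>u. 0 \<le> F u" and F1: "\<And>u. F u \<le> 1"
    by (auto simp: even_log_concave_def)
  have "(\<integral>x. F (\<lambda>i. if i \<in> insert k I then x i else w i) \<partial>gauss (insert k I)) =
     (\<integral>x. gauss_marginal k F (\<lambda>i. if i \<in> I then x i else w i) \<partial>gauss I)" for w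
  proof -
    interpret P: prob_space "gauss (insert k I)" by (rule prob_space_gauss)
    have "(\<lambda>x. F (\<lambda>i. if i \<in> insert k I then x i else w i)) \<in> borel_measurable (gauss (insert k I))"
      by measurable
    then have "integrable (gauss (insert k I)) (\<lambda>x. F (\<lambda>i. if i \<in> insert k I then x i else w i))"
      by (intro P.integrable_const_bound[where B=1]) (simp_all add: F0 F1 abs_of_nonneg)
    then have "(\<integral>x. F (\<lambda>i. if i \<in> insert k I then x i else w i) \<partial>gauss (insert k I)) =
      (\<integral>x. (\<integral>y. F (\<lambda>i. if i \<in> insert k I then (x(k := y)) i else w i) \<partial>std_normal_distribution) \<partial>gauss I)"
      unfolding gauss_def by (rule gauss.product_integral_insert[OF insert.hyps])
    also have "\<dots> = (\<integral>x. (\<integral>y. F ((\<lambda>i. if i \<in> I then x i else w i)(k := y)) \<partial>std_normal_distribution) \<partial>gauss I)"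
    proof -
      have "(\<lambda>i. if i \<in> insert k I then (x(k := y)) i else w i) = (\<lambda>i. if i \<in> I then x i else w i)(k := y)" for x y
        using insert.hyps by (auto simp: fun_eq_iff)
      then show ?thesis by (simp only: gauss_def)
    qed
    also have "\<dots> = (\<integral>x. gauss_marginal k F (\<lambda>i. if i \<in> I then x i else w i) \<partial>gauss I)"
      unfolding gauss_marginal_def
      by (intro Bochner_Integration.integral_cong refl std_normal_integral) measurable
    finally show ?thesis .
  qed
  then show ?case
    using insert.IH[OF even_log_concave_gauss_marginal[OF insert.prems, of k]] by simp
qed

lemma nn_integral_gauss_split:
  assumes "0 < d" and f: "f \<in> borel_measurable (gauss {..<d})"
  shows "(\<integral>\<^sup>+u. f u \<partial>gauss {..<d}) =
    (\<integral>\<^sup>+y. (\<integral>\<^sup>+x. f (x(0 := y)) \<partial>gauss {1..<d}) \<partial>std_normal_distribution)"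
proof -
  have eq: "{..<d} = insert 0 {1..<d}" using assms(1) by auto
  show ?thesis
    using f unfolding gauss_def eq by (intro gauss.product_nn_integral_insert_rev) simp_all
qed

text \<open>
  The integral over the remaining coordinates is even and log-concave in the first one, hence
  decreasing in its modulus, and so is positively correlated with the slab.
\<close>

lemma gauss_slab_correlation:
  assumes d: "0 < d" and F: "even_log_concave F"
    and dep: "\<And>u v. (\<And>i. i < d \<Longrightarrow> u i = v i) \<Longrightarrow> F u = F v"
  shows "measure std_normal_distribution {s. \<bar>s\<bar> < a} * (\<integral>u. F u \<partial>gauss {..<d})
    \<le> (\<integral>u. F u * indicator {u. \<bar>u 0\<bar> < a} u \<partial>gauss {..<d})"
proof -
  let ?I = "{1..<d}" and ?S = "{s::real. \<bar>s\<bar> < a}"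
  \<comment> \<open>\<open>h s\<close> is the integral of \<open>F\<close> over the coordinates from
    1 to \<open>d - 1\<close> with coordinate 0 fixed to \<open>s\<close>; the zeros from index
    \<open>d\<close> on are harmless by \<open>dep\<close>.\<close>
  define w where "w s = (\<lambda>i::nat. if i = 0 then s else (0::real))" for s
  define H where "H v = (\<integral>x. F (\<lambda>i. if i \<in> ?I then x i else v i) \<partial>gauss ?I)" for v
  define h where "h s = H (w s)" for s
  from F have Fm[measurable]: "F \<in> borel_measurable (\<Pi>\<^sub>M i\<in>UNIV. borel)"
    and F0: "\<And>u. 0 \<le> F u" and F1: "\<And>u. F u \<le> 1"
    by (auto simp: even_log_concave_def)
  have "even_log_concave H"
    unfolding H_def by (rule even_log_concave_gauss_integral) (use F in auto)
  then have [measurable]: "H \<in> borel_measurable (\<Pi>\<^sub>M i\<in>UNIV. borel)"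
    and H0: "0 \<le> H u" and H1: "H u \<le> 1" and even: "H (\<lambda>i. - u i) = H u"
    and lc: "\<And>t. 0 < t \<Longrightarrow> t < 1 \<Longrightarrow> H u powr (1 - t) * H v powr t \<le> H (\<lambda>i. (1 - t) * u i + t * v i)"
    for u v by (auto simp: even_log_concave_def)
  have [measurable]: "w \<in> borel \<rightarrow>\<^sub>M (\<Pi>\<^sub>M i\<in>UNIV. borel)"
    unfolding w_def by (rule measurable_PiM_single') (auto simp: space_PiM)
  have hm[measurable]: "h \<in> borel_measurable borel" unfolding h_def by measurable
  have h0: "0 \<le> h s" and h1: "h s \<le> 1" for s using H0 H1 by (simp_all add: h_def)
  have heven: "h (- s) = h s" for s
    using even[of "w s"] unfolding h_def w_def by (simp add: if_distrib cong: if_cong)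
  have hdec: "h r \<le> h s" if "\<bar>s\<bar> \<le> \<bar>r\<bar>" for r s
  proof (cases "\<bar>s\<bar> = \<bar>r\<bar>")
    case True
    then show ?thesis using heven[of r] by (auto simp: abs_eq_iff)
  next
    case False
    with that have lt: "\<bar>s\<bar> < \<bar>r\<bar>" by simp
    then have "r \<noteq> 0" by auto
    \<comment> \<open>The weight that writes \<open>s\<close> as a convex combination of
      \<open>r\<close> and \<open>- r\<close>. Log-concavity then bounds \<open>h s\<close> below by
      a geometric mean of \<open>h r\<close> and \<open>h (- r)\<close>, which are equal.\<close>
    define t where "t = (1 - s / r) / 2"
    have "\<bar>s / r\<bar> < 1" using lt \<open>r \<noteq> 0\<close> by (simp add: abs_divide)
    then have "- 1 < s / r" "s / r < 1" by linarith+
    then have t: "0 < t" "t < 1" unfolding t_def by auto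
    have "(\<lambda>i. (1 - t) * w r i + t * w (- r) i) = w s"
      using \<open>r \<noteq> 0\<close> by (auto simp: w_def t_def field_simps)
    then have "h r powr (1 - t) * h (- r) powr t \<le> h s"
      using lc[OF t, of "w r" "w (-r)"] by (simp add: h_def)
    moreover have "0 \<le> h r" using H0 by (simp add: h_def)
    ultimately show ?thesis by (simp add: heven powr_add[symmetric])
  qed
  have inner: "(\<integral>\<^sup>+x. ennreal (F (x(0 := y))) \<partial>gauss ?I) = ennreal (h y)" for y
  proof -
    interpret P: prob_space "gauss ?I" by (rule prob_space_gauss)
    have "F (x(0 := y)) = F (\<lambda>i. if i \<in> ?I then x i else w y i)" for x
      by (rule dep) (simp add: w_def)
    then have "(\<integral>\<^sup>+x. ennreal (F (x(0 := y))) \<partial>gauss ?I) =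
        (\<integral>\<^sup>+x. ennreal (F (\<lambda>i. if i \<in> ?I then x i else w y i)) \<partial>gauss ?I)"
      by (simp only:)
    also have "\<dots> = ennreal (h y)"
      unfolding h_def H_def
    proof (rule nn_integral_eq_integral)
      have "(\<lambda>x. F (\<lambda>i. if i \<in> ?I then x i else w y i)) \<in> borel_measurable (gauss ?I)"
        by measurable
      then show "integrable (gauss ?I) (\<lambda>x. F (\<lambda>i. if i \<in> ?I then x i else w y i))"
        by (intro P.integrable_const_bound[where B=1]) (simp_all add: F0 F1 abs_of_nonneg)
    qed (simp add: F0)
    finally show ?thesis .
  qed
  have Fm': "F \<in> borel_measurable (gauss {..<d})"
  proof -
    have "(\<lambda>u. F (\<lambda>i. if i \<in> {..<d} then u i else 0)) \<in> borel_measurable (gauss {..<d})"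
      by measurable
    moreover have "F (\<lambda>i. if i \<in> {..<d} then u i else 0) = F u" for u by (rule dep) simp
    ultimately show ?thesis by (simp only:)
  qed
  have m0: "(\<lambda>u. u 0) \<in> borel_measurable (gauss {..<d})"
    using measurable_component_singleton[of 0 "{..<d}" "\<lambda>_. std_normal_distribution"] d
    by (simp add: gauss_def)
  have ind0: "indicator {u. \<bar>u 0\<bar> < a} u = (indicator ?S (u 0) :: real)" for u :: "nat \<Rightarrow> real"
    by (simp add: indicator_def)
  have Fi: "(\<lambda>u. F u * indicator {u. \<bar>u 0\<bar> < a} u) \<in> borel_measurable (gauss {..<d})"
    unfolding ind0 using Fm' m0 by measurable
  interpret G: prob_space "gauss {..<d}" by (rule prob_space_gauss)
  have i1: "integrable (gauss {..<d}) F"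
    by (rule G.integrable_const_bound[where B=1]) (simp_all add: F0 F1 Fm' abs_of_nonneg)
  have i2: "integrable (gauss {..<d}) (\<lambda>u. F u * indicator {u. \<bar>u 0\<bar> < a} u)"
    by (rule G.integrable_const_bound[where B=1]) (simp_all add: F0 F1 Fi abs_of_nonneg split: split_indicator)
  have hint: "integrable std_normal_distribution h"
    by (rule std_normal.integrable_const_bound[where B=1]) (simp_all add: h0 h1 abs_of_nonneg)
  have hint2: "integrable std_normal_distribution (\<lambda>y. h y * indicator ?S y)"
    by (rule std_normal.integrable_const_bound[where B=1])
       (simp_all add: h0 h1 abs_of_nonneg split: split_indicator)
  have e1: "(\<integral>u. F u \<partial>gauss {..<d}) = (\<integral>y. h y \<partial>std_normal_distribution)"
  proof -
    have "ennreal (\<integral>u. F u \<partial>gauss {..<d}) = (\<integral>\<^sup>+u. ennreal (F u) \<partial>gauss {..<d})"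
      by (rule nn_integral_eq_integral[symmetric, OF i1]) (use F0 in simp)
    also have "\<dots> = (\<integral>\<^sup>+y. ennreal (h y) \<partial>std_normal_distribution)"
      unfolding nn_integral_gauss_split[OF d measurable_compose[OF Fm' measurable_ennreal]]
      by (simp only: inner)
    also have "\<dots> = ennreal (\<integral>y. h y \<partial>std_normal_distribution)"
      by (rule nn_integral_eq_integral[OF hint]) (simp add: h0)
    finally show ?thesis
      by (subst (asm) ennreal_inj) (simp_all add: F0 h0 integral_nonneg_AE)
  qed
  have e2: "(\<integral>u. F u * indicator {u. \<bar>u 0\<bar> < a} u \<partial>gauss {..<d}) =
      (\<integral>y. h y * indicator ?S y \<partial>std_normal_distribution)"
  proof -
    have "ennreal (\<integral>u. F u * indicator {u. \<bar>u 0\<bar> < a} u \<partial>gauss {..<d}) =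
        (\<integral>\<^sup>+u. ennreal (F u * indicator {u. \<bar>u 0\<bar> < a} u) \<partial>gauss {..<d})"
      by (rule nn_integral_eq_integral[symmetric, OF i2]) (use F0 in simp)
    also have "\<dots> = (\<integral>\<^sup>+y. ennreal (h y * indicator ?S y) \<partial>std_normal_distribution)"
      unfolding nn_integral_gauss_split[OF d measurable_compose[OF Fi measurable_ennreal]]
    proof (rule nn_integral_cong)
      fix y :: real
      show "(\<integral>\<^sup>+x. ennreal (F (x(0 := y)) * indicator {u. \<bar>u 0\<bar> < a} (x(0 := y))) \<partial>gauss ?I) =
        ennreal (h y * indicator ?S y)"
        using inner[of y] by (cases "\<bar>y\<bar> < a") simp_all
    qed
    also have "\<dots> = ennreal (\<integral>y. h y * indicator ?S y \<partial>std_normal_distribution)"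
      by (rule nn_integral_eq_integral[OF hint2]) (simp add: h0)
    finally show ?thesis
      by (subst (asm) ennreal_inj) (simp_all add: F0 h0 integral_nonneg_AE)
  qed
  define p where "p = measure std_normal_distribution ?S"
  have p01: "0 \<le> p" "p \<le> 1" by (auto simp: p_def)
  \<comment> \<open>Chebyshev's association argument: \<open>indicator ?S y - p\<close> and
    \<open>h y - c\<close> never have opposite signs, as both switch at
    \<open>\<bar>y\<bar> = a\<close>. After integrating their product the terms with
    \<open>c\<close> cancel.\<close>
  define c where "c = h a"
  have Sint: "integrable std_normal_distribution (indicator ?S :: real \<Rightarrow> real)"
    by (rule std_normal.integrable_const_bound[where B=1]) (auto simp: indicator_def)
  have "0 \<le> (\<integral>y. (h y * indicator ?S y - c * indicator ?S y) - (p * h y - p * c) \<partial>std_normal_distribution)"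
  proof (rule integral_nonneg_AE, rule AE_I2)
    fix y
    have "(h y * indicator ?S y - c * indicator ?S y) - (p * h y - p * c) = (indicator ?S y - p) * (h y - c)"
      by (simp add: algebra_simps)
    also have "\<dots> \<ge> 0"
    proof (cases "\<bar>y\<bar> < a")
      case True
      then show ?thesis using p01 hdec[of y a] by (simp add: c_def)
    next
      case False
      show ?thesis
      proof (cases "a \<ge> 0")
        case True
        then show ?thesis using False p01 hdec[of a y] by (simp add: c_def mult_nonneg_nonpos)
      next
        case False
        then have "?S = {}" by auto
        then show ?thesis by (simp add: p_def)
      qed
    qed
    finally show "0 \<le> (h y * indicator ?S y - c * indicator ?S y) - (p * h y - p * c)" .
  qed
  also have "\<dots> = (\<integral>y. h y * indicator ?S y \<partial>std_normal_distribution) - c * p -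
      (p * (\<integral>y. h y \<partial>std_normal_distribution) - p * c)"
    using hint hint2 Sint std_normal.prob_space by (simp add: p_def)
  finally show ?thesis unfolding e1 e2 p_def by simp
qed

section \<open>The standard Gaussian measure and the sphere\<close>

lemma sets_gauss_lebesgue_Rn: "sets (gauss {..<d}) = sets (lebesgue_Rn d)"
  by (simp only: sets_gauss sets_lebesgue_Rn)

lemma space_gauss_lebesgue_Rn: "space (gauss {..<d}) = space (lebesgue_Rn d)"
  by (simp add: space_gauss space_lebesgue_Rn)

text \<open>Written through the norm rather than as a product, so that rotation invariance and the
  fact that the level sets are balls can be read off.\<close>

definition gauss_density :: "nat \<Rightarrow> (nat \<Rightarrow> real) \<Rightarrow> real" where
  "gauss_density d u = (1 / sqrt (2 * pi)) ^ d * exp (- (L2_set u {..<d})\<^sup>2 / 2)"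

lemma measurable_gauss_density [measurable]: "gauss_density d \<in> borel_measurable (lebesgue_Rn d)"
  unfolding gauss_density_def[abs_def] by measurable

lemma gauss_density_eq_prod: "gauss_density d u = (\<Prod>i<d. std_normal_density (u i))"
proof -
  have "(L2_set u {..<d})\<^sup>2 = (\<Sum>i<d. (u i)\<^sup>2)"
    by (simp add: L2_set_def sum_nonneg)
  then have "exp (- (L2_set u {..<d})\<^sup>2 / 2) = (\<Prod>i<d. exp (- (u i)\<^sup>2 / 2))"
    by (simp add: exp_sum[symmetric] sum_negf sum_divide_distrib)
  then show ?thesis
    by (simp add: gauss_density_def std_normal_density_def prod.distrib prod_dividef power_divide)
qed

lemma gauss_eq_density: "gauss {..<d} = density (lebesgue_Rn d) (\<lambda>u. ennreal (gauss_density d u))"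
proof -
  let ?D = "density (lebesgue_Rn d) (\<lambda>u. ennreal (gauss_density d u))"
  have "?D = (\<Pi>\<^sub>M i\<in>{..<d}. std_normal_distribution)"
  proof (rule gauss.PiM_eqI)
    show "sets ?D = sets (\<Pi>\<^sub>M i\<in>{..<d}. std_normal_distribution)"
      using sets_gauss_lebesgue_Rn[of d] by (simp add: gauss_def)
    fix A :: "nat \<Rightarrow> real set"
    assume A: "\<And>i. i \<in> {..<d} \<Longrightarrow> A i \<in> sets std_normal_distribution"
    have "emeasure ?D (Pi\<^sub>E {..<d} A) =
        (\<integral>\<^sup>+u. ennreal (gauss_density d u) * indicator (Pi\<^sub>E {..<d} A) u \<partial>lebesgue_Rn d)"
      by (rule emeasure_density) (use A in \<open>auto simp: lebesgue_Rn_def intro!: sets_PiM_I_finite\<close>)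
    also have "\<dots> = (\<integral>\<^sup>+u. (\<Prod>i<d. ennreal (std_normal_density (u i)) * indicator (A i) (u i)) \<partial>lebesgue_Rn d)"
    proof (rule nn_integral_cong)
      fix u assume u: "u \<in> space (lebesgue_Rn d)"
      have "indicator (Pi\<^sub>E {..<d} A) u = (\<Prod>i<d. indicator (A i) (u i) :: ennreal)"
        using u by (auto simp: indicator_def space_lebesgue_Rn PiE_def Pi_def prod_zero_iff)
      then show "ennreal (gauss_density d u) * indicator (Pi\<^sub>E {..<d} A) u =
          (\<Prod>i<d. ennreal (std_normal_density (u i)) * indicator (A i) (u i))"
        by (simp add: gauss_density_eq_prod prod.distrib prod_ennreal)
    qed
    also have "\<dots> = (\<Prod>i<d. \<integral>\<^sup>+y. ennreal (std_normal_density y) * indicator (A i) y \<partial>lborel)"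
      unfolding lebesgue_Rn_def by (rule Rn.product_nn_integral_prod) (use A in auto)
    also have "\<dots> = (\<Prod>i\<in>{..<d}. emeasure std_normal_distribution (A i))"
      by (rule prod.cong) (use A in \<open>auto simp: emeasure_density\<close>)
    finally show "emeasure ?D (Pi\<^sub>E {..<d} A) = (\<Prod>i\<in>{..<d}. emeasure std_normal_distribution (A i))" .
  qed simp
  then show ?thesis by (simp add: gauss_def)
qed

lemma emeasure_gauss:
  assumes [measurable]: "A \<in> sets (lebesgue_Rn d)"
  shows "emeasure (gauss {..<d}) A = (\<integral>\<^sup>+u. ennreal (gauss_density d u) * indicator A u \<partial>lebesgue_Rn d)"
  unfolding gauss_eq_density by (rule emeasure_density) measurable

lemma measurable_apply_mat_Rn [measurable]: "apply_mat d Q \<in> lebesgue_Rn d \<rightarrow>\<^sub>M lebesgue_Rn d"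
  using measurable_apply_mat[OF measurable_ident] by (auto simp: id_def)

text \<open>Lebesgue measure is rotation invariant, and the density depends on the norm
  only.\<close>

lemma emeasure_gauss_rotation:
  assumes Q: "orthogonal_mat d Q" and A[measurable]: "A \<in> sets (lebesgue_Rn d)" and d: "0 < d"
  shows "emeasure (gauss {..<d}) {u \<in> space (lebesgue_Rn d). apply_mat d Q u \<in> A} = emeasure (gauss {..<d}) A"
proof -
  let ?L = "lebesgue_Rn d" and ?T = "apply_mat d Q"
  have eq: "{u \<in> space ?L. ?T u \<in> A} = ?T -` A \<inter> space ?L" by auto
  have distr: "distr ?L ?L ?T = ?L"
  proof (rule measure_eqI)
    fix X assume "X \<in> sets (distr ?L ?L ?T)"
    then have X: "X \<in> sets ?L" by simp
    have "emeasure (distr ?L ?L ?T) X = emeasure ?L (?T -` X \<inter> space ?L)"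
      by (rule emeasure_distr[OF measurable_apply_mat_Rn X])
    also have "?T -` X \<inter> space ?L = {u \<in> space ?L. ?T u \<in> X}" by auto
    finally show "emeasure (distr ?L ?L ?T) X = emeasure ?L X"
      using lebesgue_Rn_rotation_invariant[OF Q X d] by simp
  qed simp
  have "emeasure (gauss {..<d}) {u \<in> space ?L. ?T u \<in> A} =
      (\<integral>\<^sup>+u. ennreal (gauss_density d u) * indicator {u \<in> space ?L. ?T u \<in> A} u \<partial>?L)"
    unfolding eq by (rule emeasure_gauss) measurable
  also have "\<dots> = (\<integral>\<^sup>+u. ennreal (gauss_density d (?T u)) * indicator A (?T u) \<partial>?L)"
    by (intro nn_integral_cong) (simp add: gauss_density_def L2_set_apply_mat[OF Q] indicator_def)
  also have "\<dots> = (\<integral>\<^sup>+u. ennreal (gauss_density d u) * indicator A u \<partial>distr ?L ?L ?T)"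
    by (rule nn_integral_distr[symmetric]) measurable
  also have "\<dots> = emeasure (gauss {..<d}) A"
    unfolding distr by (rule emeasure_gauss[symmetric, OF A])
  finally show ?thesis .
qed

lemma measurable_scale_Rn_id [measurable]: "scale_Rn d c \<in> lebesgue_Rn d \<rightarrow>\<^sub>M lebesgue_Rn d"
  using measurable_scale_Rn[OF measurable_ident] by (auto simp: id_def)

lemma lebesgue_Rn_scale:
  assumes c: "0 < c" and A: "A \<in> sets (lebesgue_Rn d)"
  shows "ennreal (c ^ d) * emeasure (lebesgue_Rn d) {u \<in> space (lebesgue_Rn d). scale_Rn d c u \<in> A} =
    emeasure (lebesgue_Rn d) A"
proof -
  let ?L = "lebesgue_Rn d" and ?T = "scale_Rn d c"
  let ?D = "density (distr ?L ?L ?T) (\<lambda>_. ennreal (c ^ d))"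
  have line: "ennreal c * emeasure lborel ((*) c -` X) = emeasure lborel X" if X: "X \<in> sets borel" for X
  proof -
    have "emeasure lborel ((*) c -` X) = emeasure (distr lborel borel ((*) c)) X"
      using X by (subst emeasure_distr) auto
    also have "\<dots> = ennreal (inverse c) * emeasure lborel X"
      using c X by (simp add: lborel_distr_mult emeasure_density nn_integral_cmult_indicator)
    finally show ?thesis using c by (simp add: mult.assoc[symmetric] ennreal_mult'[symmetric])
  qed
  have "?D = (\<Pi>\<^sub>M i\<in>{..<d}. lborel)"
  proof (rule Rn.PiM_eqI)
    show "sets ?D = sets (\<Pi>\<^sub>M i\<in>{..<d}. lborel)" by (simp add: lebesgue_Rn_def)
    fix B :: "nat \<Rightarrow> real set" assume B: "\<And>i. i \<in> {..<d} \<Longrightarrow> B i \<in> sets lborel"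
    have B': "Pi\<^sub>E {..<d} B \<in> sets ?L" using B by (auto simp: lebesgue_Rn_def intro!: sets_PiM_I_finite)
    have eq: "?T -` Pi\<^sub>E {..<d} B \<inter> space ?L = Pi\<^sub>E {..<d} (\<lambda>i. (*) c -` B i)"
      by (auto simp: scale_Rn_def space_lebesgue_Rn PiE_def Pi_def)
    have "emeasure ?D (Pi\<^sub>E {..<d} B) = ennreal (c ^ d) * emeasure (distr ?L ?L ?T) (Pi\<^sub>E {..<d} B)"
      using B' by (simp add: emeasure_density nn_integral_cmult_indicator)
    also have "emeasure (distr ?L ?L ?T) (Pi\<^sub>E {..<d} B) = emeasure ?L (Pi\<^sub>E {..<d} (\<lambda>i. (*) c -` B i))"
      unfolding eq[symmetric] by (rule emeasure_distr) (use B' in measurable)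
    also have "\<dots> = (\<Prod>i<d. emeasure lborel ((*) c -` B i))"
    proof (rule emeasure_box_Rn)
      fix i assume "i < d"
      then show "(*) c -` B i \<in> sets borel"
        using B measurable_sets[of "(*) c" borel borel "B i"] by simp
    qed
    also have "ennreal (c ^ d) * (\<Prod>i<d. emeasure lborel ((*) c -` B i)) =
        (\<Prod>i<d. ennreal c * emeasure lborel ((*) c -` B i))"
      using c by (simp add: prod.distrib ennreal_power)
    also have "\<dots> = (\<Prod>i\<in>{..<d}. emeasure lborel (B i))"
      by (rule prod.cong) (use B line in auto)
    finally show "emeasure ?D (Pi\<^sub>E {..<d} B) = (\<Prod>i\<in>{..<d}. emeasure lborel (B i))" .
  qed simp
  then have "emeasure ?D A = emeasure ?L A" by (simp add: lebesgue_Rn_def)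
  moreover have "emeasure ?D A = ennreal (c ^ d) * emeasure (distr ?L ?L ?T) A"
    using A by (simp add: emeasure_density nn_integral_cmult_indicator)
  moreover have "emeasure (distr ?L ?L ?T) A = emeasure ?L (?T -` A \<inter> space ?L)"
    by (rule emeasure_distr[OF measurable_scale_Rn_id A])
  moreover have "?T -` A \<inter> space ?L = {u \<in> space ?L. ?T u \<in> A}" by auto
  ultimately show ?thesis by simp
qed

lemma L2_set_scale_Rn: "L2_set (scale_Rn d c u) {..<d} = \<bar>c\<bar> * L2_set u {..<d}"
proof -
  have "(\<Sum>i<d. (scale_Rn d c u i)\<^sup>2) = c\<^sup>2 * (\<Sum>i<d. (u i)\<^sup>2)"
    by (simp add: scale_Rn_def power_mult_distrib sum_distrib_left)
  then show ?thesis by (simp add: L2_set_def real_sqrt_mult)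
qed

lemma scale_Rn_scale_Rn: "scale_Rn d a (scale_Rn d b u) = scale_Rn d (a * b) u"
  by (auto simp: scale_Rn_def)

lemma scale_Rn_in_space: "scale_Rn d c u \<in> space (lebesgue_Rn d)"
  by (simp add: scale_Rn_def space_lebesgue_Rn)

lemma emeasure_cone_ball:
  assumes A: "A \<in> sets (lebesgue_Rn d)" and r: "0 < r"
    and cone: "\<And>c u. 0 < c \<Longrightarrow> u \<in> space (lebesgue_Rn d) \<Longrightarrow> scale_Rn d c u \<in> A \<longleftrightarrow> u \<in> A"
  shows "emeasure (lebesgue_Rn d) {u \<in> A. L2_set u {..<d} \<le> r} =
    ennreal (r ^ d) * emeasure (lebesgue_Rn d) (unit_ball d \<inter> A)"
proof -
  let ?L = "lebesgue_Rn d"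
  have "{u \<in> A. L2_set u {..<d} \<le> r} = A \<inter> {u \<in> space ?L. L2_set u {..<d} \<le> r}"
    using sets.sets_into_space[OF A] by auto
  also have "\<dots> \<in> sets ?L" using A by measurable
  finally have S: "{u \<in> A. L2_set u {..<d} \<le> r} \<in> sets ?L" .
  have "{u \<in> space ?L. scale_Rn d r u \<in> {u \<in> A. L2_set u {..<d} \<le> r}} = unit_ball d \<inter> A"
    using r cone by (auto simp: unit_ball_def L2_set_scale_Rn)
  with lebesgue_Rn_scale[OF r S] show ?thesis by simp
qed

text \<open>
  Integrating over the level sets of the Gaussian density, which are balls: on a cone, the
  Gaussian measure is proportional to the volume inside the unit ball.
\<close>

lemma emeasure_gauss_cone:
  assumes A[measurable]: "A \<in> sets (lebesgue_Rn d)" and d: "0 < d"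
    and cone: "\<And>c u. 0 < c \<Longrightarrow> u \<in> space (lebesgue_Rn d) \<Longrightarrow> scale_Rn d c u \<in> A \<longleftrightarrow> u \<in> A"
  shows "emeasure (gauss {..<d}) A =
    emeasure (lebesgue_Rn d) (unit_ball d \<inter> A) / emeasure (lebesgue_Rn d) (unit_ball d)"
proof -
  let ?L = "lebesgue_Rn d"
  interpret sigma_finite_measure ?L
    unfolding lebesgue_Rn_def by (rule Rn.sigma_finite) simp
  interpret P: pair_sigma_finite ?L lborel ..
  define C where "C = (1 / sqrt (2 * pi)) ^ d"
  have C: "0 < C" by (simp add: C_def)
  \<comment> \<open>\<open>\<rho> s\<close> is the radius of the ball on which the density is at
    least \<open>s\<close>; \<open>C\<close> is the maximum of the density. \<open>K\<close>
    collects the dilation factors and is the same for all cones.\<close>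
  define \<rho> where "\<rho> s = sqrt (2 * ln (C / s))" for s
  define K where "K = (\<integral>\<^sup>+s. ennreal (\<rho> s ^ d) * indicator {0<..<C} s \<partial>lborel)"
  have [measurable]: "\<rho> \<in> borel_measurable borel" unfolding \<rho>_def by measurable
  have level: "s \<le> gauss_density d u \<longleftrightarrow> L2_set u {..<d} \<le> \<rho> s" if s: "0 < s" "s < C" for s u
  proof -
    have "s \<le> gauss_density d u \<longleftrightarrow> s / C \<le> exp (- (L2_set u {..<d})\<^sup>2 / 2)"
    proof -
      have "gauss_density d u = exp (- (L2_set u {..<d})\<^sup>2 / 2) * C"
        by (simp add: gauss_density_def C_def mult.commute)
      then show ?thesis using C by (simp only: pos_divide_le_eq)
    qed
    also have "\<dots> \<longleftrightarrow> ln (s / C) \<le> - (L2_set u {..<d})\<^sup>2 / 2"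
    proof -
      have "s / C = exp (ln (s / C))" using s C by simp
      then show ?thesis by (metis exp_le_cancel_iff)
    qed
    also have "ln (s / C) = - ln (C / s)" using s C by (simp add: ln_div)
    also have "- ln (C / s) \<le> - (L2_set u {..<d})\<^sup>2 / 2 \<longleftrightarrow> (L2_set u {..<d})\<^sup>2 \<le> 2 * ln (C / s)"
      by auto
    also have "\<dots> \<longleftrightarrow> L2_set u {..<d} \<le> \<rho> s"
      unfolding \<rho>_def using real_sqrt_le_iff[of "(L2_set u {..<d})\<^sup>2" "2 * ln (C / s)"] by simp
    finally show ?thesis .
  qed
  have main: "emeasure (gauss {..<d}) X = K * emeasure ?L (unit_ball d \<inter> X)"
    if X[measurable]: "X \<in> sets ?L"
      and cone: "\<And>c u. 0 < c \<Longrightarrow> u \<in> space ?L \<Longrightarrow> scale_Rn d c u \<in> X \<longleftrightarrow> u \<in> X" for X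
  proof -
    have "emeasure (gauss {..<d}) X = (\<integral>\<^sup>+u. ennreal (gauss_density d u) * indicator X u \<partial>?L)"
      by (rule emeasure_gauss[OF X])
    also have "\<dots> = (\<integral>\<^sup>+u. (\<integral>\<^sup>+s. indicator {0<..gauss_density d u} s * indicator X u \<partial>lborel) \<partial>?L)"
      using C by (intro nn_integral_cong) (simp add: nn_integral_multc gauss_density_def C_def[symmetric])
    also have "\<dots> = (\<integral>\<^sup>+s. (\<integral>\<^sup>+u. indicator {0<..gauss_density d u} s * indicator X u \<partial>?L) \<partial>lborel)"
    proof (rule P.Fubini'[symmetric])
      show "(\<lambda>(u, s). indicator {0<..gauss_density d u} s * indicator X u :: ennreal) \<in> borel_measurable (?L \<Otimes>\<^sub>M lborel)"
        unfolding split_beta' indicator_def greaterThanAtMost_iff by measurable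
    qed
    also have "\<dots> = (\<integral>\<^sup>+s. ennreal (\<rho> s ^ d) * indicator {0<..<C} s * emeasure ?L (unit_ball d \<inter> X) \<partial>lborel)"
    proof (rule nn_integral_cong_AE)
      \<comment> \<open>At the level \<open>C\<close> the ball degenerates to the origin; for
        \<open>s > C\<close> the level set is empty.\<close>
      have "AE s in lborel. s \<noteq> C" by (rule AE_lborel_singleton)
      then show "AE s in lborel. (\<integral>\<^sup>+u. indicator {0<..gauss_density d u} s * indicator X u \<partial>?L) =
          ennreal (\<rho> s ^ d) * indicator {0<..<C} s * emeasure ?L (unit_ball d \<inter> X)"
      proof eventually_elim
        case (elim s)
        show ?case
        proof (cases "0 < s \<and> s < C")
          case True
          then have "0 < \<rho> s" by (simp add: \<rho>_def)
          have S: "{u \<in> X. L2_set u {..<d} \<le> \<rho> s} = X \<inter> {u \<in> space ?L. L2_set u {..<d} \<le> \<rho> s}"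
            using sets.sets_into_space[OF X] by auto
          have "(\<integral>\<^sup>+u. indicator {0<..gauss_density d u} s * indicator X u \<partial>?L) =
            (\<integral>\<^sup>+u. indicator {u \<in> X. L2_set u {..<d} \<le> \<rho> s} u \<partial>?L)"
            using True level by (intro nn_integral_cong) (auto simp: indicator_def)
          also have "\<dots> = emeasure ?L {u \<in> X. L2_set u {..<d} \<le> \<rho> s}"
            unfolding S by (rule nn_integral_indicator) measurable
          also have "\<dots> = ennreal (\<rho> s ^ d) * emeasure ?L (unit_ball d \<inter> X)"
            by (rule emeasure_cone_ball[OF X \<open>0 < \<rho> s\<close> cone])
          finally show ?thesis using True by simp
        next
          case False
          have "gauss_density d u \<le> C" for u
            using C by (simp add: gauss_density_def C_def[symmetric])
          then have "\<not> (0 < s \<and> s \<le> gauss_density d u)" for u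
            using False elim by (meson le_less order_trans)
          then have "indicator {0<..gauss_density d u} s = (0::ennreal)" for u by simp
          moreover have "indicator {0<..<C} s = (0::ennreal)" using False by simp
          ultimately show ?thesis by simp
        qed
      qed
    qed
    also have "\<dots> = K * emeasure ?L (unit_ball d \<inter> X)"
      unfolding K_def by (rule nn_integral_multc) measurable
    finally show ?thesis .
  qed
  \<comment> \<open>The whole space is itself a cone, and its total mass 1 determines
    \<open>K\<close>.\<close>
  have "emeasure (gauss {..<d}) (space ?L) = 1"
    using prob_space.emeasure_space_1[OF prob_space_gauss, of "{..<d}"] by (simp only: space_gauss_lebesgue_Rn)
  moreover have "emeasure (gauss {..<d}) (space ?L) = K * emeasure ?L (unit_ball d)"
  proof -
    have "unit_ball d \<inter> space ?L = unit_ball d" by (auto simp: unit_ball_def)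
    then show ?thesis by (subst main) (auto simp: scale_Rn_in_space)
  qed
  ultimately have K: "K * emeasure ?L (unit_ball d) = 1" by simp
  have "emeasure ?L (unit_ball d) \<noteq> 0" "emeasure ?L (unit_ball d) \<noteq> top"
    using emeasure_unit_ball_pos[OF d] emeasure_unit_ball_finite[of d] by auto
  with K have K': "K = 1 / emeasure ?L (unit_ball d)" by (metis mult_divide_eq_ennreal)
  have "emeasure (gauss {..<d}) A = K * emeasure ?L (unit_ball d \<inter> A)"
    by (rule main[OF A cone])
  also have "\<dots> = emeasure ?L (unit_ball d \<inter> A) * (1 / emeasure ?L (unit_ball d))"
    unfolding K' by (rule mult.commute)
  also have "\<dots> = emeasure ?L (unit_ball d \<inter> A) / emeasure ?L (unit_ball d)"
    by (simp add: ennreal_times_divide)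
  finally show ?thesis .
qed

section \<open>Transfer to the sphere, rotations and Sidak's inequality\<close>

lemma radial_proj_scale_Rn: "0 < c \<Longrightarrow> radial_proj d (scale_Rn d c u) = radial_proj d u"
  by (simp add: radial_proj_def scale_Rn_scale_Rn L2_set_scale_Rn)

text \<open>The preimage of \<open>A\<close> under \<open>radial_proj\<close> is a cone, and on
  cones the Gaussian measure agrees with the normalized volume in the unit ball, which defines
  \<open>sphere_measure\<close>.\<close>

lemma emeasure_sphere_measure_gauss:
  assumes A[measurable]: "A \<in> sets (lebesgue_Rn d)" and AS: "A \<subseteq> unit_sphere d" and d: "0 < d"
  shows "emeasure (sphere_measure d) A =
    emeasure (gauss {..<d}) {u \<in> space (lebesgue_Rn d). radial_proj d u \<in> A}"
proof -
  have "{u \<in> unit_ball d. radial_proj d u \<in> A} =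
    unit_ball d \<inter> {u \<in> space (lebesgue_Rn d). radial_proj d u \<in> A}"
    by (auto simp: unit_ball_def)
  then show ?thesis
    unfolding emeasure_sphere_measure[OF A AS]
    by (subst emeasure_gauss_cone[OF _ d]) (simp_all add: scale_Rn_in_space radial_proj_scale_Rn)
qed

text \<open>Householder reflection along \<open>v\<close>, the difference of \<open>x\<close> and
  the first basis vector: it is symmetric and swaps these two unit vectors. \<open>n\<close> is the
  squared norm of \<open>v\<close>.\<close>

lemma orthogonal_mat_first_row:
  assumes d: "0 < d" and x: "L2_set x {..<d} = 1"
  obtains Q where "orthogonal_mat d Q" "\<And>j. j < d \<Longrightarrow> Q 0 j = x j"
proof -
  have x2: "(\<Sum>i<d. (x i)\<^sup>2) = 1" using x by (simp add: L2_set_def)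
  define v where "v i = x i - of_bool (i = 0)" for i
  define n where "n = (\<Sum>i<d. (v i)\<^sup>2)"
  have "n = (\<Sum>i<d. (x i)\<^sup>2 - (if i = 0 then 2 * x 0 - 1 else 0))"
    unfolding n_def v_def by (intro sum.cong) (auto simp: power2_eq_square algebra_simps)
  also have "\<dots> = 2 - 2 * x 0"
    unfolding sum_subtractf x2 using d by simp
  finally have n: "n = 2 - 2 * x 0" .
  define Q where "Q i j = of_bool (i = j) - 2 * v i * v j / n" for i j :: nat
  show ?thesis
  proof (cases "n = 0")
    \<comment> \<open>Here \<open>x\<close> is already the first basis vector; division by
      \<open>n = 0\<close> gives 0, so \<open>Q\<close> is the identity matrix.\<close>
    case True
    have "(\<Sum>k<d. Q i k * Q j k) = of_bool (i = j)" "(\<Sum>k<d. Q k i * Q k j) = of_bool (i = j)"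
      if "i < d" "j < d" for i j
    proof -
      have "Q i k * Q j k = (if k = i then of_bool (i = j) else 0)"
        "Q k i * Q k j = (if k = i then of_bool (i = j) else 0)" for k
        using True by (auto simp: Q_def)
      then show "(\<Sum>k<d. Q i k * Q j k) = of_bool (i = j)" "(\<Sum>k<d. Q k i * Q k j) = of_bool (i = j)"
        using that by simp_all
    qed
    then have "orthogonal_mat d Q" unfolding orthogonal_mat_def by blast
    moreover have "Q 0 j = x j" if "j < d" for j
    proof -
      have "\<forall>i\<in>{..<d}. (v i)\<^sup>2 = 0"
        using True unfolding n_def by (subst (asm) sum_nonneg_eq_0_iff) auto
      with that show ?thesis using True by (auto simp: Q_def v_def)
    qed
    ultimately show ?thesis by (rule that)
  next
    case False
    have sum: "(\<Sum>k<d. Q i k * Q j k) = of_bool (i = j)" if "i < d" "j < d" for i j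
    proof -
      define c where "c = 4 * v i * v j / n\<^sup>2"
      have "(\<Sum>k<d. Q i k * Q j k) =
        (\<Sum>k<d. (if k = i then of_bool (i = j) else 0) - (if k = i then 2 * v j * v k / n else 0)
          - (if k = j then 2 * v i * v k / n else 0) + c * (v k)\<^sup>2)"
        by (intro sum.cong) (auto simp: Q_def c_def power2_eq_square algebra_simps)
      also have "\<dots> = of_bool (i = j) - 4 * v i * v j / n + c * n"
        using that by (simp add: sum.distrib sum_subtractf sum_distrib_left[symmetric] n_def[symmetric])
      also have "\<dots> = of_bool (i = j)" using False by (simp add: power2_eq_square c_def)
      finally show ?thesis .
    qed
    have sym: "Q i j = Q j i" for i j by (auto simp: Q_def)
    have "orthogonal_mat d Q"
      unfolding orthogonal_mat_def using sum sym by simp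
    moreover have "Q 0 j = x j" for j
    proof -
      have "2 * v 0 / n = -1" using n False by (simp add: v_def field_simps)
      then have "2 * v 0 * v j / n = - v j" by (metis mult_minus1 times_divide_eq_left)
      then show ?thesis by (auto simp: Q_def v_def)
    qed
    ultimately show ?thesis by (rule that)
  qed
qed

lemma inner_Rn_apply_mat:
  assumes Q: "orthogonal_mat d Q"
  shows "inner_Rn d (apply_mat d Q u) (apply_mat d Q v) = inner_Rn d u v"
proof -
  have "(\<Sum>i<d. apply_mat d Q u i * apply_mat d Q v i) = (\<Sum>i<d. (\<Sum>j<d. Q i j * u j) * (\<Sum>k<d. Q i k * v k))"
    by (simp add: apply_mat_def)
  also have "\<dots> = (\<Sum>i<d. \<Sum>j<d. \<Sum>k<d. (Q i j * Q i k) * (u j * v k))"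
    by (simp add: sum_product mult_ac)
  also have "\<dots> = (\<Sum>j<d. \<Sum>i<d. \<Sum>k<d. (Q i j * Q i k) * (u j * v k))"
    by (rule sum.swap)
  also have "\<dots> = (\<Sum>j<d. \<Sum>k<d. (\<Sum>i<d. Q i j * Q i k) * (u j * v k))"
    unfolding sum_distrib_right by (rule sum.cong[OF refl], rule sum.swap)
  also have "\<dots> = (\<Sum>j<d. \<Sum>k<d. of_bool (j = k) * (u j * v k))"
    using Q by (intro sum.cong) (auto simp: orthogonal_mat_def)
  also have "\<dots> = (\<Sum>j<d. u j * v j)" by simp
  finally show ?thesis by (simp add: inner_Rn_def)
qed

lemma measurable_inner_Rn [measurable]: "(\<lambda>u. inner_Rn d u x) \<in> borel_measurable (lebesgue_Rn d)"
  unfolding inner_Rn_def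
  by (intro borel_measurable_sum borel_measurable_times borel_measurable_const
      measurable_Rn_component[OF measurable_ident, unfolded id_def]) auto

text \<open>An intersection of symmetric slabs is convex and symmetric, and the indicator of such a
  set is even and log-concave.\<close>

lemma even_log_concave_slabs:
  fixes m :: nat
  shows "even_log_concave (indicator {u. \<forall>i<m. \<bar>inner_Rn d u (y i)\<bar> < a})"
proof -
  let ?K = "{u. \<forall>i<m. \<bar>inner_Rn d u (y i)\<bar> < a}"
  have [measurable]: "(\<lambda>u. inner_Rn d u z) \<in> borel_measurable (\<Pi>\<^sub>M i\<in>UNIV. borel)" for z
    unfolding inner_Rn_def by measurable
  have "?K = {u \<in> space (\<Pi>\<^sub>M i\<in>UNIV. borel). \<forall>i\<in>{..<m}. \<bar>inner_Rn d u (y i)\<bar> < a}"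
    by (auto simp: space_PiM)
  also have "\<dots> \<in> sets (\<Pi>\<^sub>M i\<in>UNIV. borel)"
  proof (rule sets.sets_Collect_finite_All)
    show "{u \<in> space (\<Pi>\<^sub>M i\<in>UNIV. borel). \<bar>inner_Rn d u (y i)\<bar> < a} \<in> sets (\<Pi>\<^sub>M i\<in>UNIV. borel)" for i
      by measurable
  qed simp
  finally have "(indicator ?K :: _ \<Rightarrow> real) \<in> borel_measurable (\<Pi>\<^sub>M i\<in>UNIV. borel)" by simp
  moreover have "inner_Rn d (\<lambda>i. - u i) z = - inner_Rn d u z" for u z
    by (simp add: inner_Rn_def sum_negf)
  moreover have "(\<lambda>i. (1 - t) * u i + t * v i) \<in> ?K" if "u \<in> ?K" "v \<in> ?K" "0 < t" "t < 1" for u v t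
  proof -
    have "inner_Rn d (\<lambda>i. (1 - t) * u i + t * v i) z = (1 - t) * inner_Rn d u z + t * inner_Rn d v z" for z
      by (simp add: inner_Rn_def sum_distrib_left sum.distrib[symmetric] algebra_simps)
    moreover have "\<bar>(1 - t) * p + t * q\<bar> < a" if "\<bar>p\<bar> < a" "\<bar>q\<bar> < a" for p q
    proof -
      have "\<bar>(1 - t) * p + t * q\<bar> \<le> (1 - t) * \<bar>p\<bar> + t * \<bar>q\<bar>"
        using \<open>0 < t\<close> \<open>t < 1\<close> abs_triangle_ineq[of "(1 - t) * p" "t * q"] by (simp add: abs_mult)
      also have "\<dots> < (1 - t) * a + t * a"
        using that \<open>0 < t\<close> \<open>t < 1\<close> by (intro add_strict_mono mult_strict_left_mono) auto
      finally show ?thesis by (simp add: algebra_simps)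
    qed
    ultimately show ?thesis using that by auto
  qed
  ultimately show ?thesis
    unfolding even_log_concave_def by (auto simp: indicator_def)
qed

text \<open>In the induction step a rotation carries the new direction to the first axis. The other
  \<open>m\<close> slabs stay slabs, with directions \<open>y i\<close>, and the slab correlation
  inequality splits off the factor of the new one.\<close>

lemma gauss_sidak:
  assumes d: "0 < d" and x: "\<And>i. i < m \<Longrightarrow> L2_set (x i) {..<d} = 1"
  shows "measure std_normal_distribution {s. \<bar>s\<bar> < a} ^ m \<le>
    measure (gauss {..<d}) {u \<in> space (lebesgue_Rn d). \<forall>i<m. \<bar>inner_Rn d u (x i)\<bar> < a}"
  using x
proof (induction m)
  case 0
  then show ?case
    using prob_space.prob_space[OF prob_space_gauss, of "{..<d}"] by (simp add: space_gauss_lebesgue_Rn)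
next
  case (Suc m)
  let ?L = "lebesgue_Rn d" and ?p = "measure std_normal_distribution {s. \<bar>s\<bar> < a}"
  obtain Q where Q: "orthogonal_mat d Q" and row: "\<And>j. j < d \<Longrightarrow> Q 0 j = x m j"
    using orthogonal_mat_first_row[OF d, of "x m"] Suc.prems by auto
  define y where "y i = apply_mat d Q (x i)" for i
  define K where "K = {u. \<forall>i<m. \<bar>inner_Rn d u (y i)\<bar> < a}"
  have KL: "{u \<in> space ?L. \<forall>i<m. \<bar>inner_Rn d u (z i)\<bar> < a} \<in> sets ?L" for z :: "nat \<Rightarrow> nat \<Rightarrow> real"
  proof -
    have "{u \<in> space ?L. \<forall>i\<in>{..<m}. \<bar>inner_Rn d u (z i)\<bar> < a} \<in> sets ?L" by measurable
    then show ?thesis by simp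
  qed
  have comp0: "inner_Rn d u (x m) = apply_mat d Q u 0" for u
    using d row by (simp add: apply_mat_def inner_Rn_def mult.commute)
  have c0: "(\<lambda>u. u 0) \<in> borel_measurable ?L"
    using measurable_Rn_component[OF measurable_ident d] by (simp add: id_def)
  have S0: "{u \<in> space ?L. \<bar>u 0\<bar> < a} \<in> sets ?L" using c0 by measurable
  interpret G: prob_space "gauss {..<d}" by (rule prob_space_gauss)
  have "?p ^ Suc m \<le> ?p * measure (gauss {..<d}) {u \<in> space ?L. \<forall>i<m. \<bar>inner_Rn d u (x i)\<bar> < a}"
    using Suc.IH Suc.prems by (simp add: mult_left_mono)
  also have "measure (gauss {..<d}) {u \<in> space ?L. \<forall>i<m. \<bar>inner_Rn d u (x i)\<bar> < a} =
      measure (gauss {..<d}) {u \<in> space ?L. \<forall>i<m. \<bar>inner_Rn d u (y i)\<bar> < a}"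
    using emeasure_gauss_rotation[OF Q KL d, of y]
    by (simp add: measure_def apply_mat_in_space y_def inner_Rn_apply_mat[OF Q])
  also have "\<dots> = (\<integral>u. indicator K u \<partial>gauss {..<d})"
    using KL[of y]
    by (subst Bochner_Integration.integral_indicator)
       (auto simp: K_def sets_gauss_lebesgue_Rn space_gauss_lebesgue_Rn intro!: arg_cong2[where f=measure])
  also have "?p * (\<integral>u. indicator K u \<partial>gauss {..<d}) \<le>
      (\<integral>u. indicator K u * indicator {u. \<bar>u 0\<bar> < a} u \<partial>gauss {..<d})"
  proof (rule gauss_slab_correlation[OF d])
    show "even_log_concave (indicator K)" unfolding K_def by (rule even_log_concave_slabs)
    fix u v :: "nat \<Rightarrow> real" assume "\<And>i. i < d \<Longrightarrow> u i = v i"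
    then have "inner_Rn d u z = inner_Rn d v z" for z by (simp add: inner_Rn_def)
    then show "indicator K u = (indicator K v :: real)" by (simp add: K_def indicator_def)
  qed
  also have "\<dots> = (\<integral>u. indicator (K \<inter> {u. \<bar>u 0\<bar> < a}) u \<partial>gauss {..<d})"
    by (intro Bochner_Integration.integral_cong) (auto simp: indicator_def)
  also have "\<dots> = measure (gauss {..<d}) (K \<inter> {u. \<bar>u 0\<bar> < a} \<inter> space ?L)"
    by (simp add: space_gauss_lebesgue_Rn)
  also have "K \<inter> {u. \<bar>u 0\<bar> < a} \<inter> space ?L =
      {u \<in> space ?L. \<forall>i<m. \<bar>inner_Rn d u (y i)\<bar> < a} \<inter> {u \<in> space ?L. \<bar>u 0\<bar> < a}"
    by (auto simp: K_def)
  also have "measure (gauss {..<d}) \<dots> = measure (gauss {..<d})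
      {u \<in> space ?L. apply_mat d Q u \<in> {u \<in> space ?L. \<forall>i<m. \<bar>inner_Rn d u (y i)\<bar> < a} \<inter> {u \<in> space ?L. \<bar>u 0\<bar> < a}}"
    using emeasure_gauss_rotation[OF Q sets.Int[OF KL[of y] S0] d] by (simp add: measure_def)
  also have "{u \<in> space ?L. apply_mat d Q u \<in> {u \<in> space ?L. \<forall>i<m. \<bar>inner_Rn d u (y i)\<bar> < a} \<inter> {u \<in> space ?L. \<bar>u 0\<bar> < a}} =
      {u \<in> space ?L. \<forall>i<Suc m. \<bar>inner_Rn d u (x i)\<bar> < a}"
    by (auto simp: apply_mat_in_space y_def inner_Rn_apply_mat[OF Q] less_Suc_eq comp0)
  finally show ?case .
qed

section \<open>Concentration and tail estimates\<close>

text \<open>\<open>y\<^sup>2 - 1\<close> has mean 0 and variance \<open>3 - 1 = 2\<close>, so the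
  cross term with \<open>a\<close> vanishes.\<close>

lemma nn_integral_std_normal_deviation:
  "(\<integral>\<^sup>+y. ennreal ((a + (y\<^sup>2 - 1))\<^sup>2) \<partial>std_normal_distribution) = ennreal (a\<^sup>2 + 2)"
proof -
  have m4: "has_bochner_integral lborel (\<lambda>y. std_normal_density y * y ^ 4) 3"
    using std_normal_moment_even[of 2] by (simp add: fact_numeral)
  have m2: "has_bochner_integral lborel (\<lambda>y. std_normal_density y * y\<^sup>2) 1"
    using std_normal_moment_even[of 1] by simp
  have m0: "has_bochner_integral lborel (\<lambda>y. std_normal_density y) 1"
    using std_normal_moment_even[of 0] by simp
  have eq: "std_normal_density y * (a + (y\<^sup>2 - 1))\<^sup>2 = std_normal_density y * y ^ 4 +
      (std_normal_density y * y\<^sup>2) * (2 * (a - 1)) + std_normal_density y * (a - 1)\<^sup>2" for y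
    by (simp add: power2_eq_square power4_eq_xxxx algebra_simps)
  have "has_bochner_integral lborel (\<lambda>y. std_normal_density y * (a + (y\<^sup>2 - 1))\<^sup>2)
      (3 + 1 * (2 * (a - 1)) + 1 * (a - 1)\<^sup>2)"
    unfolding eq by (intro has_bochner_integral_add has_bochner_integral_mult_left m4 m2 m0)
  moreover have "3 + 1 * (2 * (a - 1)) + 1 * (a - 1)\<^sup>2 = a\<^sup>2 + 2"
    by (simp add: power2_eq_square algebra_simps)
  ultimately have "has_bochner_integral lborel (\<lambda>y. std_normal_density y * (a + (y\<^sup>2 - 1))\<^sup>2) (a\<^sup>2 + 2)"
    by metis
  then have "(\<integral>\<^sup>+y. ennreal (std_normal_density y * (a + (y\<^sup>2 - 1))\<^sup>2) \<partial>lborel) = ennreal (a\<^sup>2 + 2)"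
    by (subst nn_integral_eq_integral) (auto simp: has_bochner_integral_iff)
  then show ?thesis
    by (subst nn_integral_density) (auto simp: ennreal_mult'[symmetric])
qed

text \<open>The variances add up. The shift \<open>a\<close> is there for the induction: it absorbs
  the contribution of the coordinate that is split off.\<close>

lemma nn_integral_gauss_deviation:
  assumes "finite I"
  shows "(\<integral>\<^sup>+x. ennreal ((a + (\<Sum>i\<in>I. (x i)\<^sup>2 - 1))\<^sup>2) \<partial>gauss I) = ennreal (a\<^sup>2 + 2 * real (card I))"
  using assms
proof (induction I arbitrary: a)
  case empty
  then show ?case using prob_space.emeasure_space_1[OF prob_space_gauss] by simp
next
  case (insert k I)
  have meas: "(\<lambda>x. ennreal ((a + (\<Sum>i\<in>insert k I. (x i)\<^sup>2 - 1))\<^sup>2)) \<in>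
      borel_measurable (\<Pi>\<^sub>M i\<in>insert k I. std_normal_distribution)"
    by measurable
  have "(\<integral>\<^sup>+x. ennreal ((a + (\<Sum>i\<in>insert k I. (x i)\<^sup>2 - 1))\<^sup>2) \<partial>gauss (insert k I)) =
    (\<integral>\<^sup>+y. (\<integral>\<^sup>+x. ennreal ((a + (\<Sum>i\<in>insert k I. ((x(k := y)) i)\<^sup>2 - 1))\<^sup>2) \<partial>gauss I) \<partial>std_normal_distribution)"
    unfolding gauss_def by (rule gauss.product_nn_integral_insert_rev[OF insert.hyps meas])
  also have "\<dots> = (\<integral>\<^sup>+y. (\<integral>\<^sup>+x. ennreal (((a + (y\<^sup>2 - 1)) + (\<Sum>i\<in>I. (x i)\<^sup>2 - 1))\<^sup>2) \<partial>gauss I) \<partial>std_normal_distribution)"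
  proof -
    have "a + (\<Sum>i\<in>insert k I. ((x(k := y)) i)\<^sup>2 - 1) = (a + (y\<^sup>2 - 1)) + (\<Sum>i\<in>I. (x i)\<^sup>2 - 1)" for x y
    proof -
      have "(\<Sum>i\<in>I. ((x(k := y)) i)\<^sup>2 - 1) = (\<Sum>i\<in>I. (x i)\<^sup>2 - 1)"
        using insert.hyps by (intro sum.cong) auto
      then show ?thesis using insert.hyps by simp
    qed
    then show ?thesis by (simp only:)
  qed
  also have "\<dots> = (\<integral>\<^sup>+y. ennreal ((a + (y\<^sup>2 - 1))\<^sup>2) + ennreal (2 * real (card I)) \<partial>std_normal_distribution)"
    by (simp add: insert.IH)
  also have "\<dots> = ennreal (a\<^sup>2 + 2) + ennreal (2 * real (card I))"
    using std_normal.emeasure_space_1 by (simp add: nn_integral_add nn_integral_std_normal_deviation)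
  also have "\<dots> = ennreal (a\<^sup>2 + 2 * real (card (insert k I)))"
    using insert.hyps by (simp add: algebra_simps flip: ennreal_plus)
  finally show ?case .
qed

lemma measurable_sum_squares [measurable]:
  "(\<lambda>x. \<Sum>i\<in>I. (x i)\<^sup>2) \<in> borel_measurable (gauss I)"
  unfolding gauss_def by measurable

text \<open>Chebyshev's inequality for the squared norm, whose variance is
  \<open>2 * card I\<close>.\<close>

lemma gauss_norm_concentration:
  assumes I: "finite I" and c: "0 < c"
  shows "measure (gauss I) {x \<in> space (gauss I). c \<le> \<bar>(\<Sum>i\<in>I. (x i)\<^sup>2) - real (card I)\<bar>}
    \<le> 2 * real (card I) / c\<^sup>2"
proof -
  interpret G: prob_space "gauss I" by (rule prob_space_gauss)
  let ?X = "{x \<in> space (gauss I). c \<le> \<bar>(\<Sum>i\<in>I. (x i)\<^sup>2) - real (card I)\<bar>}"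
  have X: "?X \<in> sets (gauss I)" by measurable
  have "ennreal (c\<^sup>2) * emeasure (gauss I) ?X = (\<integral>\<^sup>+x. ennreal (c\<^sup>2) * indicator ?X x \<partial>gauss I)"
    by (rule nn_integral_cmult_indicator[symmetric, OF X])
  also have "\<dots> \<le> (\<integral>\<^sup>+x. ennreal ((0 + (\<Sum>i\<in>I. (x i)\<^sup>2 - 1))\<^sup>2) \<partial>gauss I)"
  proof (rule nn_integral_mono)
    fix x
    have "c\<^sup>2 \<le> ((\<Sum>i\<in>I. (x i)\<^sup>2) - real (card I))\<^sup>2" if "x \<in> ?X"
      using that c by (simp add: abs_le_square_iff[symmetric])
    then show "ennreal (c\<^sup>2) * indicator ?X x \<le> ennreal ((0 + (\<Sum>i\<in>I. (x i)\<^sup>2 - 1))\<^sup>2)"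
      using I by (cases "x \<in> ?X") (auto simp: sum_subtractf ennreal_leI)
  qed
  also have "\<dots> = ennreal (2 * real (card I))"
    by (simp only: nn_integral_gauss_deviation[OF I]) simp
  finally have "c\<^sup>2 * measure (gauss I) ?X \<le> 2 * real (card I)"
    by (simp add: G.emeasure_eq_measure ennreal_mult'[symmetric])
  then show ?thesis using c by (simp add: field_simps)
qed

section \<open>Two-sided Gaussian tails\<close>

definition gauss_tail :: "real \<Rightarrow> real" where
  "gauss_tail t = measure std_normal_distribution {s. t \<le> \<bar>s\<bar>}"

lemma measure_std_normal:
  assumes "X \<in> sets borel"
  shows "ennreal (measure std_normal_distribution X) = (\<integral>\<^sup>+s. ennreal (std_normal_density s) * indicator X s \<partial>lborel)"
  using assms by (simp add: std_normal.emeasure_eq_measure[symmetric] emeasure_density)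

lemma std_normal_density_antimono: "0 \<le> a \<Longrightarrow> a \<le> \<bar>s\<bar> \<Longrightarrow> std_normal_density s \<le> std_normal_density a"
  using power_mono[of a "\<bar>s\<bar>" 2] by (simp add: std_normal_density_def divide_right_mono)

lemma gauss_tail_nonneg: "0 \<le> gauss_tail t"
  by (simp add: gauss_tail_def)

text \<open>A Mills ratio bound: on an interval of length \<open>1 / (1 + A)\<close> to the right of
  \<open>A\<close> the density drops by at most a factor \<open>exp 2\<close>, which is below 9, and
  this interval contributes to the tail.\<close>

lemma gauss_tail_lower:
  assumes A: "0 \<le> A"
  shows "std_normal_density A \<le> 9 * (1 + A) * gauss_tail A"
proof -
  define e where "e = 1 / (1 + A)"
  have e: "0 < e" "e \<le> 1" "A * e \<le> 1" using A by (simp_all add: e_def field_simps)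
  have "A * e + e\<^sup>2 / 2 \<le> 2" using e power_le_one[of e 2] by simp
  then have "exp (A * e + e\<^sup>2 / 2) \<le> exp (1 :: real) ^ 2" by (simp add: exp_double[symmetric])
  also have "\<dots> \<le> 3 ^ 2" using exp_le by (intro power_mono) auto
  finally have exp9: "exp (A * e + e\<^sup>2 / 2) \<le> 9" by simp
  have "std_normal_density A = exp (A * e + e\<^sup>2 / 2) * std_normal_density (A + e)"
  proof -
    have "- A\<^sup>2 / 2 = (A * e + e\<^sup>2 / 2) + - (A + e)\<^sup>2 / 2"
      by (simp add: power2_eq_square field_simps)
    then show ?thesis unfolding std_normal_density_def by (simp only: exp_add) simp
  qed
  also have "\<dots> \<le> 9 * std_normal_density (A + e)" using exp9 by (simp add: mult_right_mono)
  finally have le: "std_normal_density A \<le> 9 * std_normal_density (A + e)" .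
  have "ennreal (std_normal_density (A + e) * e) =
      (\<integral>\<^sup>+s. ennreal (std_normal_density (A + e)) * indicator {A..A + e} s \<partial>lborel)"
    using e by (simp add: nn_integral_cmult_indicator ennreal_mult)
  also have "\<dots> \<le> (\<integral>\<^sup>+s. ennreal (std_normal_density s) * indicator {s. A \<le> \<bar>s\<bar>} s \<partial>lborel)"
  proof (rule nn_integral_mono)
    fix s :: real
    show "ennreal (std_normal_density (A + e)) * indicator {A..A + e} s \<le>
      ennreal (std_normal_density s) * indicator {s. A \<le> \<bar>s\<bar>} s"
      using std_normal_density_antimono[of s "A + e"] A e
      by (auto simp: indicator_def ennreal_leI)
  qed
  also have "\<dots> = ennreal (gauss_tail A)"
    unfolding gauss_tail_def by (rule measure_std_normal[symmetric]) measurable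
  finally have "std_normal_density (A + e) * e \<le> gauss_tail A"
    by (simp add: gauss_tail_nonneg)
  then have "std_normal_density (A + e) \<le> (1 + A) * gauss_tail A"
    using A by (simp add: e_def field_simps)
  then have "9 * std_normal_density (A + e) \<le> 9 * ((1 + A) * gauss_tail A)" by simp
  with le show ?thesis by (simp only: mult.assoc)
qed

text \<open>The two intervals between the thresholds have total length \<open>2 * (B - A)\<close>
  and density at most that at \<open>A\<close>, which is in turn bounded by the tail with constant
  9. The error is relative to the tail, so it remains small for tails of order
  \<open>1 / N\<close>.\<close>

lemma gauss_tail_diff:
  assumes A: "0 \<le> A" and AB: "A \<le> B"
  shows "gauss_tail A - gauss_tail B \<le> 18 * (B - A) * (1 + A) * gauss_tail A"
proof -
  let ?X = "{s. A \<le> \<bar>s\<bar> \<and> \<bar>s\<bar> < B}"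
  have X: "?X \<in> sets borel" by measurable
  have "gauss_tail A = measure std_normal_distribution ({s. B \<le> \<bar>s\<bar>} \<union> ?X)"
    unfolding gauss_tail_def using AB by (intro arg_cong2[where f=measure] refl) auto
  also have "\<dots> \<le> gauss_tail B + measure std_normal_distribution ?X"
    unfolding gauss_tail_def by (rule measure_Un_le) auto
  finally have 1: "gauss_tail A - gauss_tail B \<le> measure std_normal_distribution ?X" by simp
  have "ennreal (measure std_normal_distribution ?X) =
      (\<integral>\<^sup>+s. ennreal (std_normal_density s) * indicator ?X s \<partial>lborel)"
    by (rule measure_std_normal[OF X])
  also have "\<dots> \<le> (\<integral>\<^sup>+s. ennreal (std_normal_density A) * indicator ({A..B} \<union> {-B..-A}) s \<partial>lborel)"
    using A by (intro nn_integral_mono) (auto simp: indicator_def abs_if intro!: ennreal_leI std_normal_density_antimono split: if_splits)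
  also have "\<dots> = ennreal (std_normal_density A) * emeasure lborel ({A..B} \<union> {-B..-A})"
    by (rule nn_integral_cmult_indicator) simp
  also have "\<dots> \<le> ennreal (std_normal_density A) * (emeasure lborel {A..B} + emeasure lborel {-B..-A})"
    by (intro mult_left_mono emeasure_subadditive) auto
  also have "\<dots> = ennreal (std_normal_density A * (2 * (B - A)))"
    using AB by (simp add: ennreal_mult ennreal_plus[symmetric] del: ennreal_plus)
  finally have "measure std_normal_distribution ?X \<le> std_normal_density A * (2 * (B - A))"
    using AB by simp
  also have "\<dots> \<le> (9 * (1 + A) * gauss_tail A) * (2 * (B - A))"
    using gauss_tail_lower[OF A] AB by (intro mult_right_mono) auto
  finally show ?thesis using 1 by (simp add: algebra_simps)
qed

section \<open>The height of a cap\<close>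

lemma measure_sphere_measure_gauss:
  assumes "A \<in> sets (lebesgue_Rn d)" "A \<subseteq> unit_sphere d" "0 < d"
  shows "measure (sphere_measure d) A =
    measure (gauss {..<d}) {u \<in> space (lebesgue_Rn d). radial_proj d u \<in> A}"
  using emeasure_sphere_measure_gauss[OF assms] by (simp add: measure_def)

lemma AE_gauss_component_neq_0:
  assumes "i \<in> I"
  shows "AE x in gauss I. x i \<noteq> 0"
  unfolding gauss_def
proof (rule AE_PiM_component[OF _ assms])
  show "prob_space std_normal_distribution" by (rule std_normal.prob_space_axioms)
  have "AE s in lborel. s \<noteq> (0::real)" by (rule AE_lborel_singleton)
  then show "AE s in std_normal_distribution. s \<noteq> 0" by (subst AE_density) auto
qed

lemma AE_gauss_norm_pos:
  assumes "0 < d"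
  shows "AE u in gauss {..<d}. 0 < L2_set u {..<d}"
proof -
  have "AE u in gauss {..<d}. u 0 \<noteq> 0"
    by (rule AE_gauss_component_neq_0) (use assms in simp)
  then show ?thesis
  proof eventually_elim
    case (elim u)
    with assms have "L2_set u {..<d} \<noteq> 0" by (auto simp: L2_set_eq_0_iff)
    then show ?case by (metis L2_set_nonneg order_less_le)
  qed
qed

text \<open>The law of one coordinate of a uniformly distributed point of the sphere, represented by
  a normalized Gaussian vector. At the origin the quotient is 0 by convention, which is a null event
  for \<open>d > 0\<close>.\<close>

definition coord_distr :: "nat \<Rightarrow> real measure" where
  "coord_distr d = distr (gauss {..<d}) borel (\<lambda>u. u 0 / L2_set u {..<d})"

lemma measurable_coord_ratio:
  assumes "0 < d"
  shows "(\<lambda>u. u 0 / L2_set u {..<d}) \<in> borel_measurable (gauss {..<d})"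
proof -
  have [measurable]: "(\<lambda>u. u 0) \<in> borel_measurable (lebesgue_Rn d)"
    using measurable_Rn_component[OF measurable_ident assms] by (simp add: id_def)
  have "(\<lambda>u. u 0 / L2_set u {..<d}) \<in> borel_measurable (lebesgue_Rn d)" by measurable
  then show ?thesis by (simp add: measurable_cong_sets[OF sets_gauss_lebesgue_Rn refl])
qed

lemma measure_coord_distr:
  assumes "0 < d" "T \<in> sets borel"
  shows "measure (coord_distr d) T =
    measure (gauss {..<d}) {u \<in> space (lebesgue_Rn d). u 0 / L2_set u {..<d} \<in> T}"
  unfolding coord_distr_def
  by (subst measure_distr[OF measurable_coord_ratio])
     (use assms in \<open>auto simp: space_gauss_lebesgue_Rn intro!: arg_cong2[where f=measure]\<close>)

lemma real_distribution_coord_distr: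
  assumes "0 < d"
  shows "real_distribution (coord_distr d)"
  unfolding coord_distr_def
  by (rule prob_space.real_distribution_distr[OF prob_space_gauss measurable_coord_ratio[OF assms]])

lemma inner_Rn_radial_proj: "inner_Rn d (radial_proj d u) x = inner_Rn d u x / L2_set u {..<d}"
  by (simp add: inner_Rn_def radial_proj_def scale_Rn_def sum_divide_distrib)

text \<open>Rotating \<open>x\<close> to the first axis shows that the measure does not depend on
  \<open>x\<close>; all questions about single caps and slabs become questions about one law on the
  line. The two Gaussian events differ at most at the origin.\<close>

lemma measure_sphere_slab:
  assumes d: "0 < d" and x: "x \<in> unit_sphere d" and T[measurable]: "T \<in> sets borel"
  shows "measure (sphere_measure d) {u \<in> unit_sphere d. inner_Rn d u x \<in> T} = measure (coord_distr d) T"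
proof -
  let ?L = "lebesgue_Rn d"
  obtain Q where Q: "orthogonal_mat d Q" and row: "\<And>j. j < d \<Longrightarrow> Q 0 j = x j"
    using orthogonal_mat_first_row[OF d, of x] x by (auto simp: unit_sphere_def)
  have comp0: "inner_Rn d u x = apply_mat d Q u 0" for u
    using d row by (simp add: apply_mat_def inner_Rn_def mult.commute)
  have "{u \<in> unit_sphere d. inner_Rn d u x \<in> T} = unit_sphere d \<inter> {u \<in> space ?L. inner_Rn d u x \<in> T}"
    by (auto simp: unit_sphere_def)
  also have "\<dots> \<in> sets ?L" by measurable
  finally have S: "{u \<in> unit_sphere d. inner_Rn d u x \<in> T} \<in> sets ?L" .
  have c0: "(\<lambda>u. u 0) \<in> borel_measurable ?L"
    using measurable_Rn_component[OF measurable_ident d] by (simp add: id_def)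
  have S0: "{u \<in> space ?L. u 0 / L2_set u {..<d} \<in> T} \<in> sets ?L" using c0 by measurable
  have S1: "{u \<in> space ?L. inner_Rn d u x / L2_set u {..<d} \<in> T} \<in> sets ?L" by measurable
  have S2: "{u \<in> space ?L. radial_proj d u \<in> {u \<in> unit_sphere d. inner_Rn d u x \<in> T}} \<in> sets ?L"
    using S by measurable
  have "measure (sphere_measure d) {u \<in> unit_sphere d. inner_Rn d u x \<in> T} =
      measure (gauss {..<d}) {u \<in> space ?L. radial_proj d u \<in> {u \<in> unit_sphere d. inner_Rn d u x \<in> T}}"
    by (rule measure_sphere_measure_gauss[OF S _ d]) auto
  also have "\<dots> = measure (gauss {..<d}) {u \<in> space ?L. inner_Rn d u x / L2_set u {..<d} \<in> T}"
  proof (rule measure_eq_AE)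
    show "AE u in gauss {..<d}. (u \<in> {u \<in> space ?L. radial_proj d u \<in> {u \<in> unit_sphere d. inner_Rn d u x \<in> T}}) =
        (u \<in> {u \<in> space ?L. inner_Rn d u x / L2_set u {..<d} \<in> T})"
      using AE_gauss_norm_pos[OF d]
    proof eventually_elim
      case (elim u)
      then have "radial_proj d u \<in> unit_sphere d"
        using L2_set_radial_proj[of u d] by (simp add: unit_sphere_def radial_proj_in_space)
      then show ?case by (simp add: inner_Rn_radial_proj)
    qed
  qed (use S1 S2 in \<open>simp_all add: sets_gauss_lebesgue_Rn\<close>)
  also have "\<dots> = measure (gauss {..<d}) {u \<in> space ?L. apply_mat d Q u \<in> {u \<in> space ?L. u 0 / L2_set u {..<d} \<in> T}}"
    by (simp add: comp0 apply_mat_in_space L2_set_apply_mat[OF Q])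
  also have "\<dots> = measure (coord_distr d) T"
    using emeasure_gauss_rotation[OF Q S0 d] measure_coord_distr[OF d T] by (simp add: measure_def)
  finally show ?thesis .
qed

text \<open>A concrete point of the sphere, at which statements about all centres can be
  instantiated.\<close>

definition pole :: "nat \<Rightarrow> nat \<Rightarrow> real" where
  "pole d = (\<lambda>i\<in>{..<d}. of_bool (i = 0))"

lemma inner_Rn_scale_right: "inner_Rn d u (scale_Rn d c x) = c * inner_Rn d u x"
  by (simp add: inner_Rn_def scale_Rn_def sum_distrib_left mult_ac)

lemma inner_Rn_commute: "inner_Rn d u x = inner_Rn d x u"
  by (simp add: inner_Rn_def mult.commute)

lemma pole_in_unit_sphere:
  assumes "0 < d"
  shows "pole d \<in> unit_sphere d"
proof -
  have "(\<Sum>i<d. (pole d i)\<^sup>2) = (\<Sum>i<d. if i = 0 then 1 else 0)"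
    by (intro sum.cong) (auto simp: pole_def)
  then show ?thesis using assms by (simp add: unit_sphere_def space_lebesgue_Rn L2_set_def pole_def)
qed

lemma scale_Rn_minus_in_unit_sphere: "x \<in> unit_sphere d \<Longrightarrow> scale_Rn d (-1) x \<in> unit_sphere d"
  by (simp add: unit_sphere_def L2_set_scale_Rn scale_Rn_in_space)

text \<open>The law is the same for a centre and for its antipode.\<close>

lemma coord_distr_symmetric:
  assumes d: "0 < d" and T: "T \<in> sets borel"
  shows "measure (coord_distr d) (uminus -` T) = measure (coord_distr d) T"
proof -
  have T': "uminus -` T \<in> sets borel" using T measurable_sets[of uminus borel borel T] by simp
  have "measure (coord_distr d) T =
      measure (sphere_measure d) {u \<in> unit_sphere d. inner_Rn d u (scale_Rn d (-1) (pole d)) \<in> T}"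
    by (rule measure_sphere_slab[symmetric, OF d scale_Rn_minus_in_unit_sphere[OF pole_in_unit_sphere[OF d]] T])
  also have "\<dots> = measure (sphere_measure d) {u \<in> unit_sphere d. inner_Rn d u (pole d) \<in> uminus -` T}"
    by (simp add: inner_Rn_scale_right)
  also have "\<dots> = measure (coord_distr d) (uminus -` T)"
    by (rule measure_sphere_slab[OF d pole_in_unit_sphere[OF d] T'])
  finally show ?thesis ..
qed

lemma coord_distr_two_sided:
  assumes d: "0 < d" and a: "0 < a"
  shows "measure (coord_distr d) {s. a \<le> \<bar>s\<bar>} = 2 * measure (coord_distr d) {a..}"
proof -
  interpret real_distribution "coord_distr d" by (rule real_distribution_coord_distr[OF d])
  have eq: "{s. a \<le> \<bar>s\<bar>} = {a..} \<union> uminus -` {a..}" by (auto simp: abs_if)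
  have "uminus -` {a..} \<in> sets (borel::real measure)"
    using measurable_sets[of uminus borel borel "{a..}"] by simp
  then have "prob {s. a \<le> \<bar>s\<bar>} = prob {a..} + prob (uminus -` {a..})"
    unfolding eq using a by (intro finite_measure_Union) auto
  then show ?thesis using coord_distr_symmetric[OF d, of "{a..}"] by simp
qed

lemma L2_set_split:
  fixes d :: nat
  assumes "0 < d"
  shows "(L2_set (x(0 := y)) {..<d})\<^sup>2 = y\<^sup>2 + (\<Sum>i\<in>{1..<d}. (x i)\<^sup>2)"
proof -
  have "{..<d} = insert 0 {1..<d}" using assms by auto
  then have "(\<Sum>i<d. ((x(0 := y)) i)\<^sup>2) = y\<^sup>2 + (\<Sum>i\<in>{1..<d}. ((x(0 := y)) i)\<^sup>2)"
    by (simp only:) (subst sum.insert; simp)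
  also have "(\<Sum>i\<in>{1..<d}. ((x(0 := y)) i)\<^sup>2) = (\<Sum>i\<in>{1..<d}. (x i)\<^sup>2)"
    by (rule sum.cong) auto
  finally show ?thesis by (simp add: L2_set_def sum_nonneg)
qed

lemma nn_integral_gauss_split_inner:
  assumes "0 < d" and f: "f \<in> borel_measurable (gauss {..<d})"
  shows "(\<integral>\<^sup>+u. f u \<partial>gauss {..<d}) =
    (\<integral>\<^sup>+x. (\<integral>\<^sup>+y. f (x(0 := y)) \<partial>std_normal_distribution) \<partial>gauss {1..<d})"
proof -
  have eq: "{..<d} = insert 0 {1..<d}" using assms(1) by auto
  show ?thesis
    using f unfolding gauss_def eq by (intro gauss.product_nn_integral_insert) simp_all
qed

lemma AE_gauss_rest_pos:
  assumes "2 \<le> d"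
  shows "AE x in gauss {1..<d}. 0 < (\<Sum>i\<in>{1..<d}. (x i)\<^sup>2)"
proof -
  have "AE x in gauss {1..<d}. x 1 \<noteq> 0"
    by (rule AE_gauss_component_neq_0) (use assms in simp)
  then show ?thesis
  proof eventually_elim
    case (elim x)
    then show ?case using assms by (intro sum_pos2[of _ 1]) auto
  qed
qed

text \<open>Conditioning on all coordinates but the first: only the sum of their squares matters,
  and for a fixed value of it what remains is a statement about one Gaussian variable.\<close>

lemma emeasure_coord_distr:
  assumes d: "0 < d" and T[measurable]: "T \<in> sets borel"
  shows "emeasure (coord_distr d) T =
    (\<integral>\<^sup>+x. emeasure std_normal_distribution {y. y / sqrt (y\<^sup>2 + (\<Sum>i\<in>{1..<d}. (x i)\<^sup>2)) \<in> T} \<partial>gauss {1..<d})"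
proof -
  note m = measurable_coord_ratio[OF d]
  have "emeasure (coord_distr d) T =
      (\<integral>\<^sup>+u. indicator T (u 0 / L2_set u {..<d}) \<partial>gauss {..<d})"
  proof -
    have "emeasure (coord_distr d) T = (\<integral>\<^sup>+t. indicator T t \<partial>coord_distr d)"
      by (rule nn_integral_indicator[symmetric]) (simp add: coord_distr_def)
    also have "\<dots> = (\<integral>\<^sup>+u. indicator T (u 0 / L2_set u {..<d}) \<partial>gauss {..<d})"
      unfolding coord_distr_def by (rule nn_integral_distr[OF m]) simp
    finally show ?thesis .
  qed
  also have "\<dots> = (\<integral>\<^sup>+x. (\<integral>\<^sup>+y. indicator T ((x(0 := y)) 0 / L2_set (x(0 := y)) {..<d})
      \<partial>std_normal_distribution) \<partial>gauss {1..<d})"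
    by (rule nn_integral_gauss_split_inner[OF d]) (use m in measurable)
  also have "\<dots> = (\<integral>\<^sup>+x. emeasure std_normal_distribution
      {y. y / sqrt (y\<^sup>2 + (\<Sum>i\<in>{1..<d}. (x i)\<^sup>2)) \<in> T} \<partial>gauss {1..<d})"
  proof (rule nn_integral_cong)
    fix x
    have L2: "L2_set (x(0 := y)) {..<d} = sqrt (y\<^sup>2 + (\<Sum>i\<in>{1..<d}. (x i)\<^sup>2))" for y
      using L2_set_split[OF d, of x y] by (metis L2_set_nonneg real_sqrt_unique)
    have "{y. y / sqrt (y\<^sup>2 + (\<Sum>i\<in>{1..<d}. (x i)\<^sup>2)) \<in> T} \<in> sets borel" by measurable
    then have "(\<integral>\<^sup>+y. indicator {y. y / sqrt (y\<^sup>2 + (\<Sum>i\<in>{1..<d}. (x i)\<^sup>2)) \<in> T} y \<partial>std_normal_distribution) =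
        emeasure std_normal_distribution {y. y / sqrt (y\<^sup>2 + (\<Sum>i\<in>{1..<d}. (x i)\<^sup>2)) \<in> T}"
      by (intro nn_integral_indicator) simp
    then show "(\<integral>\<^sup>+y. indicator T ((x(0 := y)) 0 / L2_set (x(0 := y)) {..<d}) \<partial>std_normal_distribution) =
        emeasure std_normal_distribution {y. y / sqrt (y\<^sup>2 + (\<Sum>i\<in>{1..<d}. (x i)\<^sup>2)) \<in> T}"
      unfolding L2 by (simp add: indicator_def)
  qed
  finally show ?thesis .
qed

text \<open>For a positive sum \<open>S\<close> of the remaining squares, the ratio equals
  \<open>a\<close> for at most two values of the first coordinate. \<open>S\<close> is almost surely
  positive because \<open>d\<close> is at least 2.\<close>

lemma coord_distr_no_atom:
  assumes d: "2 \<le> d"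
  shows "measure (coord_distr d) {a} = 0"
proof -
  have "emeasure (coord_distr d) {a} =
    (\<integral>\<^sup>+x. emeasure std_normal_distribution {y. y / sqrt (y\<^sup>2 + (\<Sum>i\<in>{1..<d}. (x i)\<^sup>2)) \<in> {a}} \<partial>gauss {1..<d})"
    by (rule emeasure_coord_distr) (use d in auto)
  also have "\<dots> = (\<integral>\<^sup>+x. 0 \<partial>gauss {1..<d})"
  proof (rule nn_integral_cong_AE, use AE_gauss_rest_pos[OF d] in eventually_elim)
    case (elim x)
    define S where "S = (\<Sum>i\<in>{1..<d}. (x i)\<^sup>2)"
    have S: "0 < S" using elim by (simp add: S_def)
    let ?Y = "{y. y / sqrt (y\<^sup>2 + S) \<in> {a}}"
    define c where "c = sqrt (a\<^sup>2 * S / (1 - a\<^sup>2))"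
    have "?Y \<subseteq> {c, - c}"
    proof
      fix y assume "y \<in> ?Y"
      then have a: "a = y / sqrt (y\<^sup>2 + S)" by simp
      have pos: "0 < y\<^sup>2 + S" using S by (simp add: add_nonneg_pos)
      have a2: "a\<^sup>2 = y\<^sup>2 / (y\<^sup>2 + S)" using pos by (simp add: a power_divide)
      have "1 - a\<^sup>2 = S / (y\<^sup>2 + S)" using pos by (simp add: a2 field_simps)
      then have "a\<^sup>2 * S / (1 - a\<^sup>2) = y\<^sup>2" using S pos by (simp add: a2)
      then have "c = \<bar>y\<bar>" by (simp add: c_def)
      then show "y \<in> {c, - c}" by auto
    qed
    then have "emeasure lborel ?Y \<le> emeasure lborel {c, - c}" by (rule emeasure_mono) simp
    also have "emeasure lborel {c, - c} = 0" by (intro emeasure_lborel_countable) simp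
    finally have null: "emeasure lborel ?Y = 0" by simp
    have "?Y \<in> sets borel" by measurable
    with null have "?Y \<in> null_sets lborel" by (simp add: null_sets_def)
    then have "?Y \<in> null_sets std_normal_distribution"
      using absolutely_continuousI_density[of "\<lambda>x. ennreal (std_normal_density x)" lborel]
      by (auto simp: absolutely_continuous_def)
    then show ?case by (simp add: null_sets_def S_def)
  qed
  also have "\<dots> = 0" by simp
  finally show ?thesis by (simp add: measure_def)
qed

text \<open>Makes the tail strictly decreasing on \<open>[0, 1)\<close>, hence the height of a cap
  unique. For fixed \<open>S > 0\<close> the ratio is increasing in the first coordinate, so the
  event contains a nondegenerate interval.\<close>

lemma coord_distr_interval_pos:
  assumes d: "2 \<le> d" and ab: "0 \<le> a" "a < b" "b < 1"
  shows "0 < measure (coord_distr d) {a..<b}"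
proof -
  interpret real_distribution "coord_distr d" by (rule real_distribution_coord_distr) (use d in simp)
  interpret G: prob_space "gauss {1..<d}" by (rule prob_space_gauss)
  let ?S = "\<lambda>x. \<Sum>i\<in>{1..<d}. (x i)\<^sup>2 :: real"
  let ?Y = "\<lambda>S. {y. y / sqrt (y\<^sup>2 + S) \<in> {a..<b}}"
  have pos: "0 < emeasure std_normal_distribution (?Y S)" if S: "0 < S" for S
  proof -
    \<comment> \<open>The inverse of the ratio \<open>y / sqrt (y\<^sup>2 + S)\<close> on
      \<open>[0, 1)\<close>.\<close>
    define f where "f t = sqrt (S * (t\<^sup>2 / (1 - t\<^sup>2)))" for t
    have ratio: "f t / sqrt ((f t)\<^sup>2 + S) = t" if t: "0 \<le> t" "t < 1" for t
    proof -
      have t2: "t\<^sup>2 < 1" using t by (simp add: abs_square_less_1)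
      have "(f t)\<^sup>2 = S * (t\<^sup>2 / (1 - t\<^sup>2))" using S t2 by (simp add: f_def)
      then have "(f t)\<^sup>2 + S = S / (1 - t\<^sup>2)" using t2 by (simp add: field_simps)
      then have "f t / sqrt ((f t)\<^sup>2 + S) = sqrt (S * (t\<^sup>2 / (1 - t\<^sup>2)) / (S / (1 - t\<^sup>2)))"
        unfolding f_def by (simp only: real_sqrt_divide)
      also have "S * (t\<^sup>2 / (1 - t\<^sup>2)) / (S / (1 - t\<^sup>2)) = t\<^sup>2" using S t2 by simp
      finally show ?thesis using t by simp
    qed
    have mono: "s / sqrt (s\<^sup>2 + S) < t / sqrt (t\<^sup>2 + S)" if st: "0 \<le> s" "s < t" for s t
    proof -
      have p: "0 < s\<^sup>2 + S" "0 < t\<^sup>2 + S" using S by (simp_all add: add_nonneg_pos)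
      have "s\<^sup>2 < t\<^sup>2" using st by (simp add: power_strict_mono)
      then have "s\<^sup>2 / (s\<^sup>2 + S) < t\<^sup>2 / (t\<^sup>2 + S)" using p S by (simp add: field_simps)
      then have "sqrt (s\<^sup>2 / (s\<^sup>2 + S)) < sqrt (t\<^sup>2 / (t\<^sup>2 + S))" by simp
      then show ?thesis using st by (simp add: real_sqrt_divide)
    qed
    have fnn: "0 \<le> f t" if "0 \<le> t" "t < 1" for t
      using that S by (simp add: f_def abs_square_le_1)
    have ra: "f a / sqrt ((f a)\<^sup>2 + S) = a" and rb: "f b / sqrt ((f b)\<^sup>2 + S) = b"
      using ab by (auto intro!: ratio)
    have fab: "f a < f b"
    proof (rule ccontr)
      assume "\<not> f a < f b"
      then have "f b = f a \<or> f b < f a" by auto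
      then show False
        using mono[of "f b" "f a"] ra rb fnn[of b] ab by (elim disjE) simp_all
    qed
    have "{f a<..<f b} \<subseteq> ?Y S"
    proof
      fix y assume y: "y \<in> {f a<..<f b}"
      have "0 \<le> f a" using ab by (intro fnn) auto
      then show "y \<in> ?Y S"
        using mono[of "f a" y] mono[of y "f b"] y ra rb by simp
    qed
    moreover have "?Y S \<in> sets std_normal_distribution" by measurable
    ultimately have "emeasure std_normal_distribution {f a<..<f b} \<le> emeasure std_normal_distribution (?Y S)"
      by (rule emeasure_mono)
    moreover have "0 < emeasure std_normal_distribution {f a<..<f b}"
    proof -
      have "ennreal (std_normal_density (f b)) * emeasure lborel {f a<..<f b} =
        (\<integral>\<^sup>+s. ennreal (std_normal_density (f b)) * indicator {f a<..<f b} s \<partial>lborel)"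
        by (rule nn_integral_cmult_indicator[symmetric]) simp
      also have "\<dots> \<le> (\<integral>\<^sup>+s. ennreal (std_normal_density s) * indicator {f a<..<f b} s \<partial>lborel)"
      proof (rule nn_integral_mono)
        fix s :: real
        have "0 \<le> f a" using ab by (intro fnn) auto
        then show "ennreal (std_normal_density (f b)) * indicator {f a<..<f b} s \<le>
            ennreal (std_normal_density s) * indicator {f a<..<f b} s"
          using std_normal_density_antimono[of s "f b"] by (auto simp: indicator_def intro!: ennreal_leI)
      qed
      also have "\<dots> = emeasure std_normal_distribution {f a<..<f b}"
        by (rule emeasure_density[symmetric]) auto
      finally have "ennreal (std_normal_density (f b)) * emeasure lborel {f a<..<f b} \<le>
        emeasure std_normal_distribution {f a<..<f b}" .
      moreover have "0 < ennreal (std_normal_density (f b)) * emeasure lborel {f a<..<f b}"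
        using fab by (simp add: ennreal_zero_less_mult_iff normal_density_pos)
      ultimately show ?thesis by (rule order.strict_trans2[rotated])
    qed
    ultimately show ?thesis by (rule order.strict_trans2[rotated])
  qed
  have "emeasure (coord_distr d) {a..<b} \<noteq> 0"
  proof
    assume 0: "emeasure (coord_distr d) {a..<b} = 0"
    have "(\<integral>\<^sup>+x. emeasure std_normal_distribution (?Y (?S x)) \<partial>gauss {1..<d}) = 0"
      using 0 d by (subst emeasure_coord_distr[symmetric]) auto
    moreover have "(\<lambda>x. emeasure std_normal_distribution (?Y (?S x))) \<in> borel_measurable (gauss {1..<d})"
    proof -
      let ?P = "gauss {1..<d} \<Otimes>\<^sub>M std_normal_distribution"
      let ?Q = "{z \<in> space ?P. snd z / sqrt ((snd z)\<^sup>2 + ?S (fst z)) \<in> {a..<b}}"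
      have "?Q \<in> sets ?P" by measurable
      then have "(\<lambda>x. emeasure std_normal_distribution (Pair x -` ?Q)) \<in> borel_measurable (gauss {1..<d})"
        by (rule std_normal.measurable_emeasure_Pair)
      moreover have "Pair x -` ?Q = ?Y (?S x)" if "x \<in> space (gauss {1..<d})" for x
        using that by (auto simp: space_pair_measure)
      ultimately show ?thesis by (simp cong: measurable_cong)
    qed
    ultimately have "AE x in gauss {1..<d}. emeasure std_normal_distribution (?Y (?S x)) = 0"
      using nn_integral_0_iff_AE by blast
    with AE_gauss_rest_pos[OF d] have "AE x in gauss {1..<d}. False"
    proof eventually_elim
      case (elim x)
      with pos[OF elim(1)] show ?case by (simp only: less_irrefl)
    qed
    then show False by simp
  qed
  then show ?thesis by (simp add: emeasure_eq_measure zero_less_measure_iff)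
qed

text \<open>\<open>cap_height\<close> is a definite description, so existence and uniqueness have to
  be established. The tail is continuous, at least 1/2 at 0 and zero at 1, while
  \<open>1 / N\<close> is at most 1/3; the intermediate value theorem gives a height strictly
  between 0 and 1.\<close>

lemma cap_height_props:
  assumes d: "2 \<le> d" and N: "3 \<le> N"
  shows "0 < cap_height d N" "cap_height d N < 1"
    and "measure (coord_distr d) {cap_height d N..} = 1 / real N"
proof -
  have d0: "0 < d" using d by simp
  interpret real_distribution "coord_distr d" by (rule real_distribution_coord_distr[OF d0])
  have cap: "measure (sphere_measure d) (cap_of_height d a x) = prob {a..}" if "x \<in> unit_sphere d" for a x
    using measure_sphere_slab[OF d0 that, of "{a..}"] by (simp add: cap_of_height_def)
  have F: "prob {a..} = 1 - cdf (coord_distr d) a" for a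
  proof -
    have "prob {a..} = 1 - prob {..<a}"
      using prob_compl[of "{..<a}"] by (simp add: Compl_eq_Diff_UNIV[symmetric])
    also have "prob {..<a} = prob {..a}"
    proof -
      have "prob {..a} = prob {..<a} + prob {a}"
        by (subst finite_measure_Union[symmetric]) (auto intro!: arg_cong[where f=prob])
      then show ?thesis using coord_distr_no_atom[OF d] by simp
    qed
    finally show ?thesis by (simp add: cdf_def)
  qed
  have "1 \<le> prob {0..} + prob (uminus -` {0..})"
  proof -
    have "uminus -` {0..} = {..(0::real)}" by auto
    moreover have "prob UNIV \<le> prob {0..} + prob {..0}"
    proof -
      have "UNIV = {0..} \<union> {..(0::real)}" by auto
      then show ?thesis by (metis measure_Un_le atLeast_borel atMost_borel sets_M)
    qed
    ultimately show ?thesis using prob_space by simp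
  qed
  then have F0: "1 / 2 \<le> prob {0..}" using coord_distr_symmetric[OF d0, of "{0..}"] by simp
  \<comment> \<open>The ratio never exceeds 1, so only a possible atom at 1 could
    contribute.\<close>
  have F1: "prob {1..} = 0"
  proof -
    have "prob {1..} = measure (gauss {..<d}) {u \<in> space (lebesgue_Rn d). u 0 / L2_set u {..<d} \<in> {1..}}"
      by (rule measure_coord_distr[OF d0]) simp
    also have "{u \<in> space (lebesgue_Rn d). u 0 / L2_set u {..<d} \<in> {1..}} =
      {u \<in> space (lebesgue_Rn d). u 0 / L2_set u {..<d} \<in> {1}}"
    proof -
      have "u 0 / L2_set u {..<d} \<le> 1" for u :: "nat \<Rightarrow> real"
      proof -
        have "u 0 \<le> \<bar>u 0\<bar>" by simp
        also have "\<dots> \<le> L2_set (\<lambda>i. \<bar>u i\<bar>) {..<d}" by (rule member_le_L2_set) (use d0 in auto)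
        also have "\<dots> = L2_set u {..<d}" by (simp add: L2_set_def)
        finally show ?thesis by (simp add: divide_le_eq_1 L2_set_nonneg) (metis L2_set_nonneg less_eq_real_def not_less)
      qed
      then have "u 0 / L2_set u {..<d} \<in> {1..} \<longleftrightarrow> u 0 / L2_set u {..<d} \<in> {1}" for u :: "nat \<Rightarrow> real"
        by (metis atLeast_iff order_antisym order_refl singletonD singletonI)
      then show ?thesis by (simp only:)
    qed
    also have "measure (gauss {..<d}) \<dots> = prob {1}"
      by (rule measure_coord_distr[symmetric, OF d0]) simp
    finally show ?thesis using coord_distr_no_atom[OF d] by simp
  qed
  have N': "0 < 1 / real N" "1 / real N \<le> 1 / 3" using N by (simp_all add: field_simps)
  have "\<exists>a\<ge>0. a \<le> 1 \<and> cdf (coord_distr d) a = 1 - 1 / real N"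
  proof (rule IVT)
    show "cdf (coord_distr d) 0 \<le> 1 - 1 / real N" using F[of 0] F0 N' by linarith
    show "1 - 1 / real N \<le> cdf (coord_distr d) 1" using F[of 1] F1 N' by linarith
    show "\<forall>x. 0 \<le> x \<and> x \<le> 1 \<longrightarrow> isCont (cdf (coord_distr d)) x"
      using isCont_cdf coord_distr_no_atom[OF d] by blast
  qed simp
  then obtain a where a: "0 \<le> a" "a \<le> 1" "prob {a..} = 1 / real N" using F by auto
  have a01: "a \<in> {0<..<1}"
    using a F0 F1 N' by (cases "a = 0"; cases "a = 1") auto
  have uniq: "b = a" if b: "b \<in> {0<..<1}" "prob {b..} = 1 / real N" for b
  proof -
    have "\<not> s < t" if st: "s \<in> {0<..<1}" "t \<in> {0<..<1}" "prob {s..} = prob {t..}" for s t :: real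
    proof
      assume "s < t"
      then have "prob {s..} = prob {s..<t} + prob {t..}"
        by (subst finite_measure_Union[symmetric]) (auto intro!: arg_cong[where f=prob])
      then show False using coord_distr_interval_pos[OF d, of s t] st \<open>s < t\<close> by simp
    qed
    from this[of a b] this[of b a] show ?thesis using a(3) a01 b by force
  qed
  have "cap_height d N = a"
    unfolding cap_height_def
  proof (rule the_equality)
    show "a \<in> {0<..<1} \<and> (\<forall>x\<in>unit_sphere d. measure (sphere_measure d) (cap_of_height d a x) = 1 / real N)"
      using a01 cap a by simp
    fix b assume "b \<in> {0<..<1} \<and> (\<forall>x\<in>unit_sphere d. measure (sphere_measure d) (cap_of_height d b x) = 1 / real N)"
    then show "b = a" using uniq cap pole_in_unit_sphere[OF d0] by auto
  qed
  then show "0 < cap_height d N" "cap_height d N < 1"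
    and "measure (coord_distr d) {cap_height d N..} = 1 / real N"
    using a01 a(3) by auto
qed

text \<open>The classical cone estimate: the part of the unit ball that lies in the cone over a cap
  of height \<open>a\<close> is contained in the ball of radius \<open>sqrt (1 - a\<^sup>2)\<close>
  around \<open>a\<close> times the pole. The apex lies in that ball exactly when
  \<open>a\<^sup>2 <= 1 / 2\<close>.\<close>

lemma coord_distr_volume_bound:
  assumes d: "0 < d" and a: "0 \<le> a" "a\<^sup>2 \<le> 1 / 2"
  shows "measure (coord_distr d) {a..} \<le> exp (- (a\<^sup>2 * real d / 2))"
proof -
  let ?L = "lebesgue_Rn d"
  interpret G: prob_space "gauss {..<d}" by (rule prob_space_gauss)
  define \<rho> where "\<rho> = sqrt (1 - a\<^sup>2)"
  have \<rho>: "0 < \<rho>" using a by (simp add: \<rho>_def)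
  have [measurable]: "(\<lambda>u. u 0) \<in> borel_measurable ?L"
    using measurable_Rn_component[OF measurable_ident d] by (simp add: id_def)
  define A where "A = {u \<in> space ?L. a \<le> u 0 / L2_set u {..<d}}"
  have A[measurable]: "A \<in> sets ?L" unfolding A_def by measurable
  define y where "y = scale_Rn d (- a) (pole d)"
  define X where "X = {v \<in> space ?L. L2_set v {..<d} \<le> \<rho>}"
  have X[measurable]: "X \<in> sets ?L" unfolding X_def by measurable
  have shift: "(\<lambda>u. add_Rn d u y) \<in> ?L \<rightarrow>\<^sub>M ?L"
    unfolding add_Rn_def
    by (intro measurable_into_Rn borel_measurable_add measurable_Rn_component[OF measurable_ident_sets]) auto
  have "measure (coord_distr d) {a..} = measure (gauss {..<d}) A"
    using measure_coord_distr[OF d, of "{a..}"] by (simp add: A_def)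
  moreover have "emeasure (gauss {..<d}) A = emeasure ?L (unit_ball d \<inter> A) / emeasure ?L (unit_ball d)"
  proof (rule emeasure_gauss_cone[OF A d])
    fix c :: real and u assume c: "0 < c" and u: "u \<in> space ?L"
    have "scale_Rn d c u 0 = c * u 0" using d by (simp add: scale_Rn_def)
    then have "scale_Rn d c u 0 / L2_set (scale_Rn d c u) {..<d} = u 0 / L2_set u {..<d}"
      using c by (simp add: L2_set_scale_Rn)
    then show "scale_Rn d c u \<in> A \<longleftrightarrow> u \<in> A"
      using u by (simp only: A_def mem_Collect_eq scale_Rn_in_space)
  qed
  moreover have "emeasure ?L (unit_ball d \<inter> A) \<le> ennreal (\<rho> ^ d) * emeasure ?L (unit_ball d)"
  proof -
    have "unit_ball d \<inter> A \<subseteq> (\<lambda>u. add_Rn d u y) -` X \<inter> space ?L"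
    proof
      fix u assume u: "u \<in> unit_ball d \<inter> A"
      define r where "r = L2_set u {..<d}"
      have r: "0 \<le> r" "r \<le> 1" using u by (auto simp: r_def unit_ball_def L2_set_nonneg)
      have u0: "a * r \<le> u 0"
      proof (cases "r = 0")
        case True
        then have "u 0 = 0" using d by (auto simp: r_def L2_set_eq_0_iff)
        then show ?thesis using True by simp
      next
        case False
        then have "0 < r" using r by simp
        moreover have "a \<le> u 0 / r" using u by (simp add: A_def r_def)
        ultimately show ?thesis by (simp add: pos_le_divide_eq)
      qed
      have "(L2_set (add_Rn d u y) {..<d})\<^sup>2 = (\<Sum>i<d. (u i - a * of_bool (i = 0))\<^sup>2)"
        by (simp add: L2_set_def sum_nonneg add_Rn_def y_def scale_Rn_def pole_def)
      also have "\<dots> = (\<Sum>i<d. (u i)\<^sup>2 + (if i = 0 then a\<^sup>2 - 2 * a * u 0 else 0))"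
        by (intro sum.cong) (auto simp: power2_eq_square algebra_simps)
      also have "\<dots> = r\<^sup>2 + (a\<^sup>2 - 2 * a * u 0)"
        using d by (simp add: sum.distrib r_def L2_set_def sum_nonneg)
      also have "\<dots> \<le> r\<^sup>2 + (a\<^sup>2 - 2 * a * (a * r))"
        using mult_left_mono[OF u0, of "2 * a"] a by simp
      also have "\<dots> \<le> 1 - a\<^sup>2"
      proof -
        have "r * (r - 2 * a\<^sup>2) \<le> 1 - 2 * a\<^sup>2"
        proof -
          \<comment> \<open>Equality holds on the sphere, \<open>r = 1\<close>; nonnegativity of the
            second factor down to \<open>r = 0\<close> is where \<open>a\<^sup>2 <= 1 / 2\<close> is
            used.\<close>
          have "0 \<le> (1 - r) * (1 + r - 2 * a\<^sup>2)" using r a by (intro mult_nonneg_nonneg) auto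
          then show ?thesis by (simp add: algebra_simps)
        qed
        then show ?thesis by (simp add: power2_eq_square algebra_simps)
      qed
      finally have "(L2_set (add_Rn d u y) {..<d})\<^sup>2 \<le> \<rho>\<^sup>2" using a by (simp add: \<rho>_def)
      then have "L2_set (add_Rn d u y) {..<d} \<le> \<rho>" by (rule power2_le_imp_le) (use \<rho> in simp)
      then show "u \<in> (\<lambda>u. add_Rn d u y) -` X \<inter> space ?L"
        using u by (auto simp: X_def unit_ball_def add_Rn_def space_lebesgue_Rn)
    qed
    then have "emeasure ?L (unit_ball d \<inter> A) \<le> emeasure ?L ((\<lambda>u. add_Rn d u y) -` X \<inter> space ?L)"
      by (rule emeasure_mono) (rule measurable_sets[OF shift X])
    also have "\<dots> = emeasure (distr ?L ?L (\<lambda>u. add_Rn d u y)) X"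
      by (rule emeasure_distr[symmetric, OF shift X])
    also have "\<dots> = emeasure ?L {v \<in> space ?L. L2_set v {..<d} \<le> \<rho>}"
      unfolding lebesgue_Rn_translate X_def ..
    also have "\<dots> = ennreal (\<rho> ^ d) * emeasure ?L (unit_ball d \<inter> space ?L)"
      by (rule emeasure_cone_ball[OF sets.top \<rho>]) (simp add: scale_Rn_in_space)
    also have "unit_ball d \<inter> space ?L = unit_ball d" by (auto simp: unit_ball_def)
    finally show ?thesis .
  qed
  ultimately have "ennreal (measure (coord_distr d) {a..}) \<le>
      ennreal (\<rho> ^ d) * emeasure ?L (unit_ball d) / emeasure ?L (unit_ball d)"
    by (simp only: G.emeasure_eq_measure[symmetric] divide_right_mono_ennreal)
  also have "\<dots> = ennreal (\<rho> ^ d)"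
    using emeasure_unit_ball_pos[OF d] emeasure_unit_ball_finite[of d]
    by (intro ennreal_mult_divide_eq) auto
  finally have "measure (coord_distr d) {a..} \<le> \<rho> ^ d" using \<rho> by simp
  also have "\<rho> ^ d \<le> exp (- (a\<^sup>2 / 2)) ^ d"
  proof (rule power_mono)
    have "\<rho> \<le> sqrt (exp (- a\<^sup>2))"
      unfolding \<rho>_def using exp_ge_add_one_self[of "- a\<^sup>2"] by simp
    also have "\<dots> = exp (- (a\<^sup>2 / 2))"
      by (intro real_sqrt_unique) (simp_all add: exp_double[symmetric])
    finally show "\<rho> \<le> exp (- (a\<^sup>2 / 2))" .
  qed (use \<rho> in simp)
  also have "\<dots> = exp (- (a\<^sup>2 * real d / 2))"
    by (subst exp_of_nat_mult[symmetric]) (simp add: algebra_simps)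
  finally show ?thesis .
qed

text \<open>If the remaining squares sum to at most \<open>s\<close>, a first coordinate of modulus
  at least \<open>B\<close> already forces the ratio up to \<alpha>; the hypothesis on
  \<open>s\<close> is this implication in the extreme case. The first coordinate is independent of
  the others, hence the product.\<close>

lemma coord_distr_tail_lower:
  assumes d: "0 < d" and \<alpha>: "0 \<le> \<alpha>" and B: "0 < B" and s: "\<alpha>\<^sup>2 * s \<le> (1 - \<alpha>\<^sup>2) * B\<^sup>2"
  shows "gauss_tail B * measure (gauss {1..<d}) {x \<in> space (gauss {1..<d}). (\<Sum>i\<in>{1..<d}. (x i)\<^sup>2) \<le> s}
    \<le> measure (coord_distr d) {t. \<alpha> \<le> \<bar>t\<bar>}"
proof -
  interpret real_distribution "coord_distr d" by (rule real_distribution_coord_distr[OF d])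
  interpret G: prob_space "gauss {1..<d}" by (rule prob_space_gauss)
  let ?S = "\<lambda>x. \<Sum>i\<in>{1..<d}. (x i)\<^sup>2 :: real"
  let ?Z = "{x \<in> space (gauss {1..<d}). ?S x \<le> s}"
  have Z: "?Z \<in> sets (gauss {1..<d})" by measurable
  have le: "\<alpha> \<le> \<bar>y / sqrt (y\<^sup>2 + S)\<bar>" if y: "B \<le> \<bar>y\<bar>" and S: "0 \<le> S" "S \<le> s" for y S
  proof -
    have "B\<^sup>2 \<le> y\<^sup>2" using y B by (simp add: abs_le_square_iff[symmetric])
    show ?thesis
    proof (cases "\<alpha>\<^sup>2 \<le> 1")
      case True
      have "\<alpha>\<^sup>2 * S \<le> \<alpha>\<^sup>2 * s" using S by (simp add: mult_left_mono)
      also have "\<dots> \<le> (1 - \<alpha>\<^sup>2) * B\<^sup>2" by (rule s)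
      also have "\<dots> \<le> (1 - \<alpha>\<^sup>2) * y\<^sup>2" using True \<open>B\<^sup>2 \<le> y\<^sup>2\<close> by (simp add: mult_left_mono)
      finally have "\<alpha>\<^sup>2 * (y\<^sup>2 + S) \<le> y\<^sup>2" by (simp add: algebra_simps)
      then have "sqrt (\<alpha>\<^sup>2 * (y\<^sup>2 + S)) \<le> sqrt (y\<^sup>2)" by (rule real_sqrt_le_mono)
      then have "\<alpha> * sqrt (y\<^sup>2 + S) \<le> \<bar>y\<bar>" using \<alpha> by (simp add: real_sqrt_mult)
      moreover have "0 < sqrt (y\<^sup>2 + S)" using y B S by (auto intro: add_pos_nonneg)
      ultimately show ?thesis by (simp add: abs_divide pos_le_divide_eq)
    next
      \<comment> \<open>For \<alpha> above 1 the right side of the hypothesis is negative and its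
        left side is not.\<close>
      case False
      then have "(1 - \<alpha>\<^sup>2) * B\<^sup>2 < 0" using B by (simp add: mult_neg_pos)
      moreover have "0 \<le> \<alpha>\<^sup>2 * s" using S by simp
      ultimately show ?thesis using s by simp
    qed
  qed
  have "ennreal (gauss_tail B * measure (gauss {1..<d}) ?Z) =
      ennreal (gauss_tail B) * emeasure (gauss {1..<d}) ?Z"
    unfolding G.emeasure_eq_measure by (rule ennreal_mult) (simp_all add: gauss_tail_nonneg)
  also have "\<dots> = (\<integral>\<^sup>+x. ennreal (gauss_tail B) * indicator ?Z x \<partial>gauss {1..<d})"
    by (rule nn_integral_cmult_indicator[symmetric, OF Z])
  also have "\<dots> \<le> (\<integral>\<^sup>+x. emeasure std_normal_distribution {y. y / sqrt (y\<^sup>2 + ?S x) \<in> {t. \<alpha> \<le> \<bar>t\<bar>}} \<partial>gauss {1..<d})"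
  proof (rule nn_integral_mono)
    fix x
    have "emeasure std_normal_distribution {s. B \<le> \<bar>s\<bar>} \<le>
        emeasure std_normal_distribution {y. y / sqrt (y\<^sup>2 + ?S x) \<in> {t. \<alpha> \<le> \<bar>t\<bar>}}" if "x \<in> ?Z"
    proof (rule emeasure_mono)
      have "0 \<le> ?S x" by (rule sum_nonneg) simp
      moreover have "?S x \<le> s" using that by simp
      ultimately have "\<alpha> \<le> \<bar>y / sqrt (y\<^sup>2 + ?S x)\<bar>" if "B \<le> \<bar>y\<bar>" for y
        by (rule le[OF that])
      then show "{s. B \<le> \<bar>s\<bar>} \<subseteq> {y. y / sqrt (y\<^sup>2 + ?S x) \<in> {t. \<alpha> \<le> \<bar>t\<bar>}}"
        unfolding subset_iff mem_Collect_eq by blast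
      have "{y. y / sqrt (y\<^sup>2 + ?S x) \<in> {t. \<alpha> \<le> \<bar>t\<bar>}} \<in> sets borel" by measurable
      then show "{y. y / sqrt (y\<^sup>2 + ?S x) \<in> {t. \<alpha> \<le> \<bar>t\<bar>}} \<in> sets std_normal_distribution" by simp
    qed
    then show "ennreal (gauss_tail B) * indicator ?Z x \<le>
        emeasure std_normal_distribution {y. y / sqrt (y\<^sup>2 + ?S x) \<in> {t. \<alpha> \<le> \<bar>t\<bar>}}"
      by (cases "x \<in> ?Z") (simp_all add: gauss_tail_def std_normal.emeasure_eq_measure)
  qed
  also have "\<dots> = emeasure (coord_distr d) {t. \<alpha> \<le> \<bar>t\<bar>}"
    by (rule emeasure_coord_distr[symmetric, OF d]) measurable
  finally show ?thesis by (simp add: emeasure_eq_measure)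
qed

section \<open>The maximal coverage\<close>

text \<open>The inequality is strict because caps are closed: a closed cap and its antipode together
  are the complement of an open slab.\<close>

definition uncovered :: "nat \<Rightarrow> real \<Rightarrow> nat \<Rightarrow> (nat \<Rightarrow> nat \<Rightarrow> real) \<Rightarrow> (nat \<Rightarrow> real) set" where
  "uncovered d a n x = {u \<in> unit_sphere d. \<forall>i<n. \<bar>inner_Rn d u (x i)\<bar> < a}"

lemma sets_sphere_measure: "A \<in> sets (sphere_measure d) \<longleftrightarrow> A \<in> sets (lebesgue_Rn d) \<and> A \<subseteq> unit_sphere d"
proof -
  have "unit_sphere d \<inter> space (lebesgue_Rn d) = unit_sphere d" by (auto simp: unit_sphere_def)
  then show ?thesis
    by (simp add: sphere_measure_def sets_restrict_space_iff conj_commute)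
qed

lemma sets_uncovered: "uncovered d a n x \<in> sets (sphere_measure d)"
proof -
  have "{u \<in> space (lebesgue_Rn d). \<forall>i\<in>{..<n}. \<bar>inner_Rn d u (x i)\<bar> < a} \<in> sets (lebesgue_Rn d)"
    by measurable
  then have "unit_sphere d \<inter> {u \<in> space (lebesgue_Rn d). \<forall>i\<in>{..<n}. \<bar>inner_Rn d u (x i)\<bar> < a} \<in> sets (lebesgue_Rn d)"
    by (intro sets.Int) measurable
  moreover have "unit_sphere d \<inter> {u \<in> space (lebesgue_Rn d). \<forall>i\<in>{..<n}. \<bar>inner_Rn d u (x i)\<bar> < a} = uncovered d a n x"
    by (auto simp: uncovered_def unit_sphere_def)
  ultimately show ?thesis by (auto simp: sets_sphere_measure uncovered_def)
qed

lemma antipodal_coverage_eq: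
  assumes "0 < d"
  shows "antipodal_coverage d N x =
    1 - measure (sphere_measure d) (uncovered d (cap_height d N) (N div 2) x)"
proof -
  interpret prob_space "sphere_measure d" by (rule prob_space_sphere_measure[OF assms])
  have "(\<Union>i<N div 2. cap d N (x i) \<union> cap d N (scale_Rn d (-1) (x i))) =
      space (sphere_measure d) - uncovered d (cap_height d N) (N div 2) x"
    by (auto simp: uncovered_def space_sphere_measure cap_def cap_of_height_def inner_Rn_scale_right
        abs_if not_less split: if_splits)
  then show ?thesis
    unfolding antipodal_coverage_def by (simp only: prob_compl[OF sets_uncovered])
qed

section \<open>Existence of an optimal configuration\<close>

lemma bounded_convergent_subseq_finite:
  fixes f :: "nat \<Rightarrow> 'i \<Rightarrow> real"
  assumes "finite I" and "\<And>k i. i \<in> I \<Longrightarrow> \<bar>f k i\<bar> \<le> B"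
  shows "\<exists>r l. strict_mono (r :: nat \<Rightarrow> nat) \<and> (\<forall>i\<in>I. (\<lambda>k. f (r k) i) \<longlonglongrightarrow> l i)"
  using assms
proof (induction I)
  case empty
  show ?case by (rule exI[of _ id]) (simp add: strict_mono_def)
next
  case (insert j I)
  have "\<exists>r l. strict_mono (r :: nat \<Rightarrow> nat) \<and> (\<forall>i\<in>I. (\<lambda>k. f (r k) i) \<longlonglongrightarrow> l i)"
    by (rule insert.IH) (use insert.prems in simp)
  then obtain r l where r: "strict_mono (r :: nat \<Rightarrow> nat)"
    and l: "\<And>i. i \<in> I \<Longrightarrow> (\<lambda>k. f (r k) i) \<longlonglongrightarrow> l i" by blast
  have "f (r k) j \<in> {-B..B}" for k using insert.prems[of j "r k"] by (simp add: abs_le_iff)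
  moreover have "seq_compact {-B..B}" by (rule compact_imp_seq_compact) simp
  ultimately obtain c s where s: "strict_mono s" and c: "((\<lambda>k. f (r k) j) \<circ> s) \<longlonglongrightarrow> c"
    unfolding seq_compact_def by meson
  have "(\<lambda>k. f ((r \<circ> s) k) i) \<longlonglongrightarrow> (l(j := c)) i" if "i \<in> insert j I" for i
  proof (cases "i = j")
    case True
    then show ?thesis using c by (simp add: comp_def)
  next
    case False
    then have "i \<in> I" using that by simp
    from LIMSEQ_subseq_LIMSEQ[OF l[OF this] s] show ?thesis using False by (simp add: comp_def)
  qed
  moreover have "strict_mono (r \<circ> s)" using r s by (rule strict_mono_o)
  ultimately show ?case by blast
qed

lemma abs_le_L2_set: "i < d \<Longrightarrow> \<bar>u i\<bar> \<le> L2_set u {..<d}" for d :: nat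
proof -
  assume "i < d"
  then have "\<bar>u i\<bar> \<le> L2_set (\<lambda>i. \<bar>u i\<bar>) {..<d}" by (intro member_le_L2_set) auto
  then show ?thesis by (simp add: L2_set_def)
qed

text \<open>
  Caps are closed, so along a convergent sequence of configurations the limit superior of the
  covered sets is covered by the limit; this gives upper semicontinuity, which is enough for the
  supremum to be attained.
\<close>

lemma minimal_uncovered_exists:
  assumes d: "0 < d"
  shows "\<exists>x. (\<forall>i<n. x i \<in> unit_sphere d) \<and> (\<forall>y. (\<forall>i<n. y i \<in> unit_sphere d) \<longrightarrow>
    measure (sphere_measure d) (uncovered d a n x) \<le> measure (sphere_measure d) (uncovered d a n y))"
proof -
  interpret prob_space "sphere_measure d" by (rule prob_space_sphere_measure[OF d])
  let ?V = "{prob (uncovered d a n x) | x. \<forall>i<n. x i \<in> unit_sphere d}"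
  define s where "s = Inf ?V"
  have "prob (uncovered d a n (\<lambda>_. pole d)) \<in> ?V"
    using pole_in_unit_sphere[OF d] by blast
  then have ne: "?V \<noteq> {}" by blast
  have bdd: "bdd_below ?V" by (rule bdd_belowI[of _ 0]) auto
  have le: "s \<le> prob (uncovered d a n x)" if "\<forall>i<n. x i \<in> unit_sphere d" for x
    unfolding s_def by (rule cInf_lower[OF _ bdd]) (use that in blast)
  have "\<exists>x. (\<forall>i<n. x i \<in> unit_sphere d) \<and> prob (uncovered d a n x) < s + 1 / real (Suc k)" for k
  proof -
    have "Inf ?V < s + 1 / real (Suc k)" by (simp add: s_def)
    then obtain v where "v \<in> ?V" "v < s + 1 / real (Suc k)"
      using cInf_less_iff[OF ne bdd] by blast
    then show ?thesis by blast
  qed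
  then obtain X where X: "\<And>k i. i < n \<Longrightarrow> X k i \<in> unit_sphere d"
    and Xs: "\<And>k. prob (uncovered d a n (X k)) < s + 1 / real (Suc k)" by metis
  have bd: "\<bar>(\<lambda>(i, j). X k i j) p\<bar> \<le> 1" if "p \<in> {..<n} \<times> {..<d}" for k p
    using that abs_le_L2_set[of "snd p" d "X k (fst p)"] X[of "fst p" k] by (auto simp: unit_sphere_def)
  \<comment> \<open>Compactness of the configuration space, applied to the \<open>n * d\<close>
    coordinates of a minimizing sequence.\<close>
  have "\<exists>r l. strict_mono (r :: nat \<Rightarrow> nat) \<and>
      (\<forall>p\<in>{..<n} \<times> {..<d}. (\<lambda>k. (\<lambda>(i, j). X (r k) i j) p) \<longlonglongrightarrow> l p)"
    by (rule bounded_convergent_subseq_finite[where f="\<lambda>k (i, j). X k i j", OF _ bd]) auto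
  then obtain r l where r: "strict_mono (r :: nat \<Rightarrow> nat)"
    and l: "\<And>p. p \<in> {..<n} \<times> {..<d} \<Longrightarrow> (\<lambda>k. (\<lambda>(i, j). X (r k) i j) p) \<longlonglongrightarrow> l p"
    by blast
  define y where "y i = (\<lambda>j\<in>{..<d}. l (i, j))" for i
  have lim: "(\<lambda>k. X (r k) i j) \<longlonglongrightarrow> y i j" if "i < n" "j < d" for i j
    using l[of "(i, j)"] that by (simp add: y_def)
  have y: "y i \<in> unit_sphere d" if i: "i < n" for i
  proof -
    have "(\<lambda>k. L2_set (X (r k) i) {..<d}) \<longlonglongrightarrow> L2_set (y i) {..<d}"
      unfolding L2_set_def by (intro tendsto_intros lim i) auto
    moreover have "L2_set (X (r k) i) {..<d} = 1" for k using X[OF i] by (simp add: unit_sphere_def)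
    ultimately have "L2_set (y i) {..<d} = 1" by (simp add: LIMSEQ_const_iff)
    then show ?thesis by (simp add: unit_sphere_def y_def space_lebesgue_Rn)
  qed
  \<comment> \<open>The finitely many strict inequalities at the limit persist for nearby
    configurations.\<close>
  have ev: "eventually (\<lambda>k. u \<in> uncovered d a n (X (r k))) sequentially" if u: "u \<in> uncovered d a n y" for u
  proof -
    have "eventually (\<lambda>k. \<bar>inner_Rn d u (X (r k) i)\<bar> < a) sequentially" if "i \<in> {..<n}" for i
    proof -
      have "(\<lambda>k. \<bar>inner_Rn d u (X (r k) i)\<bar>) \<longlonglongrightarrow> \<bar>inner_Rn d u (y i)\<bar>"
        unfolding inner_Rn_def by (intro tendsto_intros lim) (use that in auto)
      then show ?thesis by (rule order_tendstoD) (use u that in \<open>auto simp: uncovered_def\<close>)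
    qed
    then have "eventually (\<lambda>k. \<forall>i\<in>{..<n}. \<bar>inner_Rn d u (X (r k) i)\<bar> < a) sequentially"
      by (intro eventually_ball_finite) auto
    then show ?thesis by eventually_elim (use u in \<open>auto simp: uncovered_def\<close>)
  qed
  \<comment> \<open>The union of the \<open>B m\<close> is the limit inferior of the uncovered sets
    and contains the one of \<open>y\<close>; each \<open>B m\<close> lies in a set of measure below
    \<open>s + 1 / Suc (r m)\<close>, and \<open>r m >= m\<close>.\<close>
  define B where "B m = (\<Inter>k\<in>{m..}. uncovered d a n (X (r k)))" for m
  have B: "B m \<in> events" for m
    unfolding B_def by (intro sets.countable_INT) (auto simp: sets_uncovered)
  have "incseq B" by (auto simp: incseq_def B_def)
  then have "(\<lambda>m. prob (B m)) \<longlonglongrightarrow> prob (\<Union>m. B m)"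
    using B by (intro finite_Lim_measure_incseq) auto
  moreover have "(\<lambda>m. s + 1 / real (Suc m)) \<longlonglongrightarrow> s + 0"
    by (intro tendsto_intros LIMSEQ_inverse_real_of_nat[unfolded inverse_eq_divide])
  moreover have "prob (B m) \<le> s + 1 / real (Suc m)" for m
  proof -
    have "prob (B m) \<le> prob (uncovered d a n (X (r m)))"
      by (rule finite_measure_mono) (auto simp: B_def sets_uncovered)
    also have "\<dots> \<le> s + 1 / real (Suc (r m))" using Xs less_imp_le by blast
    also have "\<dots> \<le> s + 1 / real (Suc m)"
      using seq_suble[OF r, of m] by (simp add: frac_le)
    finally show ?thesis .
  qed
  ultimately have "prob (\<Union>m. B m) \<le> s + 0"
    by (intro LIMSEQ_le) auto
  moreover have "prob (uncovered d a n y) \<le> prob (\<Union>m. B m)"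
  proof (rule finite_measure_mono)
    show "uncovered d a n y \<subseteq> (\<Union>m. B m)"
    proof
      fix u assume "u \<in> uncovered d a n y"
      from ev[OF this] obtain m where "\<forall>k\<ge>m. u \<in> uncovered d a n (X (r k))"
        unfolding eventually_sequentially by blast
      then show "u \<in> (\<Union>m. B m)" by (auto simp: B_def)
    qed
  qed (use B in auto)
  ultimately have "prob (uncovered d a n y) \<le> s" by simp
  then have "prob (uncovered d a n y) \<le> prob (uncovered d a n z)" if "\<forall>i<n. z i \<in> unit_sphere d" for z
    using le[OF that] by simp
  then show ?thesis using y by (intro exI[of _ y]) simp
qed

text \<open>Together these give \<open>GREATEST\<close> in \<open>max_antipodal_coverage\<close> its
  intended value, since a least uncovered set means a greatest coverage.\<close>

lemma
  assumes d: "0 < d"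
  shows max_antipodal_coverage_attained: "\<exists>x. (\<forall>i<N div 2. x i \<in> unit_sphere d) \<and>
      max_antipodal_coverage d N = antipodal_coverage d N x" (is ?attained)
    and antipodal_coverage_le_max: "\<forall>i<N div 2. y i \<in> unit_sphere d \<Longrightarrow>
      antipodal_coverage d N y \<le> max_antipodal_coverage d N"
proof -
  let ?u = "\<lambda>x. measure (sphere_measure d) (uncovered d (cap_height d N) (N div 2) x)"
  obtain x where "(\<forall>i<N div 2. x i \<in> unit_sphere d) \<and>
      (\<forall>y. (\<forall>i<N div 2. y i \<in> unit_sphere d) \<longrightarrow> ?u x \<le> ?u y)"
    using minimal_uncovered_exists[OF d] by (rule exE)
  then have x: "\<forall>i<N div 2. x i \<in> unit_sphere d" and min: "\<And>y. \<forall>i<N div 2. y i \<in> unit_sphere d \<Longrightarrow> ?u x \<le> ?u y"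
    by simp_all
  have le: "antipodal_coverage d N y \<le> antipodal_coverage d N x"
    if "\<forall>i<N div 2. y i \<in> unit_sphere d" for y
    using min[OF that] by (simp add: antipodal_coverage_eq[OF d])
  have max: "max_antipodal_coverage d N = antipodal_coverage d N x"
    unfolding max_antipodal_coverage_def
  proof (rule Greatest_equality)
    show "\<exists>y. (\<forall>i<N div 2. y i \<in> unit_sphere d) \<and> antipodal_coverage d N x = antipodal_coverage d N y"
      using x by (intro exI[of _ x]) simp
  next
    fix v assume "\<exists>y. (\<forall>i<N div 2. y i \<in> unit_sphere d) \<and> v = antipodal_coverage d N y"
    then obtain y where "(\<forall>i<N div 2. y i \<in> unit_sphere d) \<and> v = antipodal_coverage d N y"
      by (rule exE)
    then show "v \<le> antipodal_coverage d N x" using le[of y] by simp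
  qed
  show ?attained using x max by (intro exI[of _ x]) simp
  show "antipodal_coverage d N y \<le> max_antipodal_coverage d N" if "\<forall>i<N div 2. y i \<in> unit_sphere d"
    unfolding max by (rule le[OF that])
qed

section \<open>Averaging over a random centre and the greedy choice\<close>

lemma measurable_inner_Rn_pair:
  "(\<lambda>z. inner_Rn d (snd z) (fst z)) \<in> borel_measurable (sphere_measure d \<Otimes>\<^sub>M sphere_measure d)"
proof -
  have id: "(\<lambda>x. x) \<in> sphere_measure d \<rightarrow>\<^sub>M lebesgue_Rn d"
    unfolding sphere_measure_def by (rule measurable_restrict_space1) simp
  have "fst \<in> sphere_measure d \<Otimes>\<^sub>M sphere_measure d \<rightarrow>\<^sub>M lebesgue_Rn d"
    "snd \<in> sphere_measure d \<Otimes>\<^sub>M sphere_measure d \<rightarrow>\<^sub>M lebesgue_Rn d"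
    by (rule measurable_compose[OF measurable_fst id]) (rule measurable_compose[OF measurable_snd id])
  then show ?thesis
    unfolding inner_Rn_def
    by (intro borel_measurable_sum borel_measurable_times measurable_Rn_component) auto
qed

text \<open>The right-hand side is the average of the left-hand side over a random centre \<open>x\<close>, by Fubini.\<close>

lemma exists_good_centre:
  assumes d: "0 < d" and U: "U \<in> sets (sphere_measure d)"
  shows "\<exists>x\<in>unit_sphere d. measure (sphere_measure d) (U \<inter> {u \<in> unit_sphere d. \<bar>inner_Rn d u x\<bar> < a})
    \<le> measure (coord_distr d) {t. \<bar>t\<bar> < a} * measure (sphere_measure d) U"
proof (rule ccontr)
  interpret prob_space "sphere_measure d" by (rule prob_space_sphere_measure[OF d])
  interpret P: pair_sigma_finite "sphere_measure d" "sphere_measure d" ..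
  let ?M = "sphere_measure d" and ?p = "measure (coord_distr d) {t. \<bar>t\<bar> < a}"
  let ?g = "\<lambda>x. prob (U \<inter> {u \<in> unit_sphere d. \<bar>inner_Rn d u x\<bar> < a})"
  assume "\<not> ?thesis"
  then have gt: "?p * prob U < ?g x" if "x \<in> unit_sphere d" for x using that by force
  define Q where "Q = {z \<in> space (?M \<Otimes>\<^sub>M ?M). snd z \<in> U \<and> \<bar>inner_Rn d (snd z) (fst z)\<bar> < a}"
  have Q: "Q \<in> sets (?M \<Otimes>\<^sub>M ?M)"
    unfolding Q_def using U measurable_inner_Rn_pair[of d] by measurable
  have US: "U \<subseteq> unit_sphere d" using U by (simp add: sets_sphere_measure)
  have s1: "Pair x -` Q = U \<inter> {u \<in> unit_sphere d. \<bar>inner_Rn d u x\<bar> < a}" if "x \<in> unit_sphere d" for x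
    using that US by (auto simp: Q_def space_pair_measure space_sphere_measure)
  \<comment> \<open>By symmetry of the inner product, the centres whose slab contains
    \<open>u\<close> form a slab around \<open>u\<close>, of measure \<open>?p\<close> for every
    \<open>u\<close>.\<close>
  have s2: "(\<lambda>x. (x, u)) -` Q = (if u \<in> U then {x \<in> unit_sphere d. inner_Rn d x u \<in> {t. \<bar>t\<bar> < a}} else {})" for u
    using US by (auto simp: Q_def space_pair_measure space_sphere_measure inner_Rn_commute[of d u])
  have slab: "emeasure ?M {x \<in> unit_sphere d. inner_Rn d x u \<in> {t. \<bar>t\<bar> < a}} = ennreal ?p" if "u \<in> U" for u
    using measure_sphere_slab[OF d, of u "{t. \<bar>t\<bar> < a}"] that US by (auto simp: emeasure_eq_measure)
  have "(\<integral>\<^sup>+x. ennreal (?g x) \<partial>?M) = (\<integral>\<^sup>+x. emeasure ?M (Pair x -` Q) \<partial>?M)"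
    by (intro nn_integral_cong) (simp add: s1 space_sphere_measure emeasure_eq_measure)
  also have "\<dots> = emeasure (?M \<Otimes>\<^sub>M ?M) Q"
    by (rule emeasure_pair_measure_alt[symmetric, OF Q])
  also have "\<dots> = (\<integral>\<^sup>+u. emeasure ?M ((\<lambda>x. (x, u)) -` Q) \<partial>?M)"
    by (rule P.emeasure_pair_measure_alt2[OF Q])
  also have "\<dots> = (\<integral>\<^sup>+u. ennreal ?p * indicator U u \<partial>?M)"
    by (intro nn_integral_cong) (simp add: s2 slab[simplified] indicator_def)
  also have "\<dots> = ennreal (?p * prob U)"
    using U by (simp add: nn_integral_cmult_indicator emeasure_eq_measure ennreal_mult)
  finally have int: "(\<integral>\<^sup>+x. ennreal (?g x) \<partial>?M) = ennreal (?p * prob U)" .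
  have gm: "?g \<in> borel_measurable ?M"
  proof -
    have "(\<lambda>x. measure ?M (Pair x -` Q)) \<in> borel_measurable ?M"
      using measurable_emeasure_Pair[OF Q] by (simp add: measure_def)
    moreover have "?g x = measure ?M (Pair x -` Q)" if "x \<in> space ?M" for x
      using that by (simp add: s1 space_sphere_measure)
    ultimately show ?thesis by (subst measurable_cong[where g="\<lambda>x. measure ?M (Pair x -` Q)"]) auto
  qed
  have gi: "integrable ?M ?g" by (rule integrable_const_bound[where B=1]) (use gm in auto)
  have "ennreal (expectation ?g) = ennreal (?p * prob U)"
    using int nn_integral_eq_integral[OF gi] by simp
  then have "expectation ?g = ?p * prob U"
    by (subst (asm) ennreal_inj) (auto intro!: integral_nonneg_AE)
  moreover have "?p * prob U < expectation ?g"
    using gi by (rule expectation_greater) (use gt in \<open>auto simp: space_sphere_measure intro!: AE_I2\<close>)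
  ultimately show False by simp
qed

lemma greedy_uncovered:
  assumes d: "0 < d"
  shows "\<exists>x. (\<forall>i<n. x i \<in> unit_sphere d) \<and>
    measure (sphere_measure d) (uncovered d a n x) \<le> measure (coord_distr d) {t. \<bar>t\<bar> < a} ^ n"
proof (induction n)
  case 0
  interpret prob_space "sphere_measure d" by (rule prob_space_sphere_measure[OF d])
  show ?case by simp
next
  case (Suc n)
  let ?p = "measure (coord_distr d) {t. \<bar>t\<bar> < a}"
  from Suc obtain x where x: "\<forall>i<n. x i \<in> unit_sphere d"
    and le: "measure (sphere_measure d) (uncovered d a n x) \<le> ?p ^ n" by blast
  obtain z where z: "z \<in> unit_sphere d"
    and zle: "measure (sphere_measure d) (uncovered d a n x \<inter> {u \<in> unit_sphere d. \<bar>inner_Rn d u z\<bar> < a})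
      \<le> ?p * measure (sphere_measure d) (uncovered d a n x)"
    using exists_good_centre[OF d sets_uncovered] by blast
  have "uncovered d a (Suc n) (x(n := z)) = uncovered d a n x \<inter> {u \<in> unit_sphere d. \<bar>inner_Rn d u z\<bar> < a}"
    by (auto simp: uncovered_def less_Suc_eq)
  moreover have "?p * measure (sphere_measure d) (uncovered d a n x) \<le> ?p * ?p ^ n"
    using le by (rule mult_left_mono) simp
  ultimately have "measure (sphere_measure d) (uncovered d a (Suc n) (x(n := z))) \<le> ?p * ?p ^ n"
    using zle by simp
  moreover have "\<forall>i<Suc n. (x(n := z)) i \<in> unit_sphere d" using x z by (auto simp: less_Suc_eq)
  ultimately show ?case unfolding power_Suc by (intro exI[of _ "x(n := z)"] conjI)
qed

section \<open>Bounds for the maximal coverage in a fixed dimension\<close>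

lemma coord_distr_slab_cap_height:
  assumes "2 \<le> d" "3 \<le> N"
  shows "measure (coord_distr d) {t. cap_height d N \<le> \<bar>t\<bar>} = 2 / real N"
    and "measure (coord_distr d) {t. \<bar>t\<bar> < cap_height d N} = 1 - 2 / real N"
proof -
  have d: "0 < d" using assms by simp
  interpret real_distribution "coord_distr d" by (rule real_distribution_coord_distr[OF d])
  show 1: "prob {t. cap_height d N \<le> \<bar>t\<bar>} = 2 / real N"
    using coord_distr_two_sided[OF d cap_height_props(1)[OF assms]] cap_height_props(3)[OF assms] by simp
  have "{t. \<bar>t\<bar> < cap_height d N} = UNIV - {t. cap_height d N \<le> \<bar>t\<bar>}" by auto
  then show "prob {t. \<bar>t\<bar> < cap_height d N} = 1 - 2 / real N"
    using prob_compl[of "{t. cap_height d N \<le> \<bar>t\<bar>}"] 1 by simp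
qed

lemma max_antipodal_coverage_ge:
  assumes d: "2 \<le> d" and N: "3 \<le> N"
  shows "1 - (1 - 2 / real N) ^ (N div 2) \<le> max_antipodal_coverage d N"
proof -
  have d0: "0 < d" using d by simp
  obtain x where x: "\<forall>i<N div 2. x i \<in> unit_sphere d"
    and le: "measure (sphere_measure d) (uncovered d (cap_height d N) (N div 2) x) \<le> (1 - 2 / real N) ^ (N div 2)"
    using greedy_uncovered[OF d0, of "N div 2" "cap_height d N"]
    unfolding coord_distr_slab_cap_height(2)[OF d N] by blast
  show ?thesis
    using antipodal_coverage_le_max[OF d0 x] le by (simp add: antipodal_coverage_eq[OF d0])
qed

text \<open>For a Gaussian vector of norm at least \<open>r\<close>, a projection of modulus below
  \<open>a * r\<close> becomes one below \<open>a\<close> after normalization. So only small norms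
  have to be discarded, and Sidak's inequality bounds the rest.\<close>

lemma uncovered_ge:
  assumes d: "0 < d" and x: "\<And>i. i < n \<Longrightarrow> x i \<in> unit_sphere d" and r: "0 < r" and a: "0 \<le> a"
  shows "(1 - gauss_tail (a * r)) ^ n \<le> measure (sphere_measure d) (uncovered d a n x) +
    measure (gauss {..<d}) {u \<in> space (gauss {..<d}). L2_set u {..<d} < r}"
proof -
  let ?L = "lebesgue_Rn d"
  interpret G: prob_space "gauss {..<d}" by (rule prob_space_gauss)
  let ?A = "{u \<in> space ?L. radial_proj d u \<in> uncovered d a n x}"
  let ?B = "{u \<in> space ?L. L2_set u {..<d} < r}"
  let ?E = "{u \<in> space ?L. \<forall>i<n. \<bar>inner_Rn d u (x i)\<bar> < a * r}"
  have unc: "uncovered d a n x \<in> sets ?L" "uncovered d a n x \<subseteq> unit_sphere d"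
    using sets_uncovered[of d a n x] by (auto simp: sets_sphere_measure)
  then have A: "?A \<in> sets ?L" by measurable
  have B: "?B \<in> sets ?L" by measurable
  have "{t. \<bar>t\<bar> < a * r} = UNIV - {s. a * r \<le> \<bar>s\<bar>}" by auto
  then have "measure std_normal_distribution {t. \<bar>t\<bar> < a * r} = 1 - gauss_tail (a * r)"
    using std_normal.prob_compl[of "{s. a * r \<le> \<bar>s\<bar>}"] by (simp add: gauss_tail_def)
  then have "(1 - gauss_tail (a * r)) ^ n \<le> measure (gauss {..<d}) ?E"
    using gauss_sidak[OF d, of n x "a * r"] x by (simp add: unit_sphere_def)
  also have "\<dots> \<le> measure (gauss {..<d}) (?A \<union> ?B)"
  proof (rule G.finite_measure_mono)
    show "?E \<subseteq> ?A \<union> ?B"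
    proof
      fix u assume u: "u \<in> ?E"
      show "u \<in> ?A \<union> ?B"
      proof (cases "L2_set u {..<d} < r")
        case False
        define R where "R = L2_set u {..<d}"
        have R: "r \<le> R" "0 < R" using False r by (simp_all add: R_def)
        have "radial_proj d u \<in> unit_sphere d"
          using L2_set_radial_proj[of u d] R by (simp add: unit_sphere_def radial_proj_in_space R_def)
        moreover have "\<bar>inner_Rn d (radial_proj d u) (x i)\<bar> < a" if "i < n" for i
        proof -
          have "\<bar>inner_Rn d u (x i)\<bar> < a * r" using u that by simp
          also have "\<dots> \<le> a * R" using a R by (simp add: mult_left_mono)
          finally show ?thesis
            using R by (simp add: inner_Rn_radial_proj R_def[symmetric] abs_divide pos_divide_less_eq)
        qed
        ultimately show ?thesis using u by (simp add: uncovered_def)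
      qed (use u in simp)
    qed
  qed (use A B in \<open>simp add: sets_gauss_lebesgue_Rn\<close>)
  also have "\<dots> \<le> measure (gauss {..<d}) ?A + measure (gauss {..<d}) ?B"
    by (rule measure_Un_le) (use A B in \<open>simp_all add: sets_gauss_lebesgue_Rn\<close>)
  also have "measure (gauss {..<d}) ?A = measure (sphere_measure d) (uncovered d a n x)"
    by (rule measure_sphere_measure_gauss[symmetric, OF unc d])
  finally show ?thesis by (simp add: space_gauss_lebesgue_Rn)
qed

lemma max_antipodal_coverage_le:
  assumes d: "2 \<le> d" and N: "3 \<le> N" and r: "0 < r"
  shows "max_antipodal_coverage d N \<le> 1 - (1 - gauss_tail (cap_height d N * r)) ^ (N div 2) +
    measure (gauss {..<d}) {u \<in> space (gauss {..<d}). L2_set u {..<d} < r}"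
proof -
  have d0: "0 < d" using d by simp
  obtain x where "(\<forall>i<N div 2. x i \<in> unit_sphere d) \<and>
      max_antipodal_coverage d N = antipodal_coverage d N x"
    using max_antipodal_coverage_attained[OF d0] by (rule exE)
  then have x: "\<forall>i<N div 2. x i \<in> unit_sphere d"
    and eq: "max_antipodal_coverage d N = antipodal_coverage d N x" by simp_all
  have "(1 - gauss_tail (cap_height d N * r)) ^ (N div 2) \<le>
      measure (sphere_measure d) (uncovered d (cap_height d N) (N div 2) x) +
      measure (gauss {..<d}) {u \<in> space (gauss {..<d}). L2_set u {..<d} < r}"
    using x cap_height_props(1)[OF d N] by (intro uncovered_ge[OF d0 _ r]) auto
  then show ?thesis unfolding eq antipodal_coverage_eq[OF d0] by linarith
qed

section \<open>Asymptotics\<close>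

text \<open>The volume bound compares \<open>1 / N\<close> with an exponential but requires a
  squared height of at most 1/2. That is obtained by contradiction: a larger cap height would allow
  the bound at height \<open>sqrt (1 / 2)\<close>, giving
  \<open>d / 4 <= ln N <= sqrt d / 4\<close>.\<close>

lemma cap_height_le:
  assumes d: "3 \<le> d" and N: "3 \<le> N" and small: "ln (real N) / sqrt (real d) \<le> 1 / 4"
  shows "(cap_height d N)\<^sup>2 \<le> 2 * ln (real N) / real d" and "(cap_height d N)\<^sup>2 \<le> 1 / 2"
proof -
  have d0: "0 < d" and d2: "2 \<le> d" using d by simp_all
  interpret real_distribution "coord_distr d" by (rule real_distribution_coord_distr[OF d0])
  let ?a = "cap_height d N" and ?L = "ln (real N)"
  note a = cap_height_props[OF d2 N]
  \<comment> \<open>Stated for heights below the cap height, so that it can be used before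
    \<open>half\<close> is known.\<close>
  have bound: "b\<^sup>2 * real d / 2 \<le> ?L" if b: "0 \<le> b" "b\<^sup>2 \<le> 1 / 2" "b \<le> ?a" for b
  proof -
    have "exp (- ?L) = 1 / real N" using N by (simp add: exp_minus inverse_eq_divide)
    also have "\<dots> = prob {?a..}" using a by simp
    also have "\<dots> \<le> prob {b..}" using b by (intro finite_measure_mono) auto
    also have "\<dots> \<le> exp (- (b\<^sup>2 * real d / 2))" by (rule coord_distr_volume_bound[OF d0 b(1,2)])
    finally show ?thesis by simp
  qed
  show half: "?a\<^sup>2 \<le> 1 / 2"
  proof (rule ccontr)
    assume "\<not> ?thesis"
    then have "sqrt (1 / 2) \<le> sqrt (?a\<^sup>2)" by (intro real_sqrt_le_mono) simp
    then have "sqrt (1 / 2) \<le> ?a" using a(1) by simp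
    then have "(sqrt (1 / 2))\<^sup>2 * real d / 2 \<le> ?L" by (intro bound) auto
    then have "real d / 4 \<le> ?L" by simp
    also have "\<dots> \<le> sqrt (real d) / 4" using small d by (simp add: field_simps)
    finally have "real d \<le> sqrt (real d)" by simp
    then have "(real d)\<^sup>2 \<le> (sqrt (real d))\<^sup>2" by (rule power_mono) simp
    then have "real d * real d \<le> real d * 1" by (simp add: power2_eq_square)
    then show False using d by (simp add: mult_le_cancel_left)
  qed
  from bound[OF _ half order_refl] a(1) d show "?a\<^sup>2 \<le> 2 * ?L / real d"
    by (simp add: field_simps)
qed

text \<open>A bound for the relative loss in \<open>gauss_tail_diff\<close>, which also supplies the
  18: the first summand bounds the difference of the squared thresholds, its square root the
  difference of the thresholds.\<close>

definition tail_gap :: "real \<Rightarrow> real" where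
  "tail_gap e = 18 * ((8 * sqrt e + 8 * e\<^sup>2) + sqrt (8 * sqrt e + 8 * e\<^sup>2))"

text \<open>
  With \<open>w = 1 / sqrt e\<close>, the squared norm of a Gaussian vector is \<open>d \<plusminus> w sqrt d\<close> up to probability
  \<open>2 / w\<^sup>2 = 2 e\<close>; \<open>A\<close> and \<open>B\<close> below are the resulting lower and upper thresholds for the first coordinate.
\<close>

lemma gauss_tail_cap_height:
  fixes d N :: nat
  defines "e \<equiv> ln (real N) / sqrt (real d)"
  defines "r \<equiv> sqrt (real d - sqrt (real d / e))"
  assumes d: "3 \<le> d" and N: "3 \<le> N" and small: "e \<le> 1 / 4"
  shows "0 < r"
    and "measure (gauss {..<d}) {u \<in> space (gauss {..<d}). L2_set u {..<d} < r} \<le> 2 * e"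
    and "gauss_tail (cap_height d N * r) * (1 - tail_gap e) * (1 - 2 * e) \<le> 2 / real N"
proof -
  have d0: "0 < d" and d2: "2 \<le> d" using d by simp_all
  define L where "L = ln (real N)"
  \<comment> \<open>From \<open>N >= 3 > exp 1\<close>. It yields \<open>e * d > 1\<close>, hence
    \<open>c < d\<close> below, so that \<open>r\<close> is positive.\<close>
  have L: "1 \<le> L"
  proof -
    have "exp 1 \<le> real N" using exp_le N by linarith
    then show ?thesis unfolding L_def using N by (subst ln_ge_iff) auto
  qed
  have e: "0 < e" "e = L / sqrt (real d)" using L d by (simp_all add: e_def L_def)
  define c where "c = sqrt (real d / e)"
  have c: "0 < c" using e(1) d by (simp add: c_def)
  have c2: "c\<^sup>2 = real d / e" using e(1) by (simp add: c_def)
  have "1 < e * real d"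
  proof -
    have "1 < sqrt (real d)" using d by simp
    also have "\<dots> \<le> L * sqrt (real d)" using mult_right_mono[OF L, of "sqrt (real d)"] by simp
    also have "\<dots> = e * real d" using d by (simp add: e(2) nonzero_eq_divide_eq mult.assoc)
    finally show ?thesis .
  qed
  then have "real d / e < real d * real d" using e(1) d by (simp add: field_simps)
  then have "c\<^sup>2 < (real d)\<^sup>2" by (simp only: c2 power2_eq_square[of "real d"])
  then have cd: "c < real d" by (rule power2_less_imp_less) simp
  have r2: "r\<^sup>2 = real d - c" using cd by (simp add: r_def c_def[symmetric])
  show r: "0 < r" using cd by (simp add: r_def c_def[symmetric])
  \<comment> \<open>Used both for the full vector and for the \<open>d - 1\<close> coordinates other
    than the first.\<close>
  have conc: "2 * real (card I) / c\<^sup>2 \<le> 2 * e" if "card I \<le> d" for I :: "nat set"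
  proof -
    have "2 * real (card I) / c\<^sup>2 \<le> 2 * real d / c\<^sup>2" using that by (intro divide_right_mono) auto
    also have "\<dots> = 2 * e" using e(1) d by (simp add: c2)
    finally show ?thesis .
  qed
  interpret G: prob_space "gauss {..<d}" by (rule prob_space_gauss)
  interpret G1: prob_space "gauss {1..<d}" by (rule prob_space_gauss)
  have "measure (gauss {..<d}) {u \<in> space (gauss {..<d}). L2_set u {..<d} < r} \<le>
    measure (gauss {..<d}) {u \<in> space (gauss {..<d}). c \<le> \<bar>(\<Sum>i<d. (u i)\<^sup>2) - real (card {..<d})\<bar>}"
  proof (rule G.finite_measure_mono)
    show "{u \<in> space (gauss {..<d}). L2_set u {..<d} < r} \<subseteq>
      {u \<in> space (gauss {..<d}). c \<le> \<bar>(\<Sum>i<d. (u i)\<^sup>2) - real (card {..<d})\<bar>}"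
    proof safe
      fix u assume "L2_set u {..<d} < r"
      then have "(L2_set u {..<d})\<^sup>2 < r\<^sup>2" by (intro power_strict_mono L2_set_nonneg) auto
      then have "(\<Sum>i<d. (u i)\<^sup>2) < real d - c" by (simp add: r2 L2_set_def sum_nonneg)
      then show "c \<le> \<bar>(\<Sum>i<d. (u i)\<^sup>2) - real (card {..<d})\<bar>" using c by simp
    qed
  qed measurable
  also have "\<dots> \<le> 2 * real (card {..<d}) / c\<^sup>2" by (rule gauss_norm_concentration[OF _ c]) simp
  also have "\<dots> \<le> 2 * e" by (rule conc) simp
  finally show "measure (gauss {..<d}) {u \<in> space (gauss {..<d}). L2_set u {..<d} < r} \<le> 2 * e" .
  define \<alpha> where "\<alpha> = cap_height d N"
  have \<alpha>: "0 < \<alpha>" "\<alpha>\<^sup>2 \<le> 2 * L / real d" "\<alpha>\<^sup>2 \<le> 1 / 2"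
    using cap_height_props(1)[OF d2 N] cap_height_le[OF d N] small by (simp_all add: \<alpha>_def e_def L_def)
  define A where "A = \<alpha> * r"
  \<comment> \<open>\<open>A\<close> comes from a full squared norm of \<open>d - c\<close>.
    \<open>B\<close> comes from a bound \<open>d + c\<close> on the remaining coordinates alone,
    which is why the denominator appears: it turns the hypothesis of
    \<open>coord_distr_tail_lower\<close> into an equality.\<close>
  define B where "B = sqrt (\<alpha>\<^sup>2 * (real d + c) / (1 - \<alpha>\<^sup>2))"
  have A: "0 < A" using \<alpha> r by (simp add: A_def)
  have A2: "A\<^sup>2 = \<alpha>\<^sup>2 * (real d - c)" by (simp add: A_def power_mult_distrib r2)
  have B2: "B\<^sup>2 = \<alpha>\<^sup>2 * (real d + c) / (1 - \<alpha>\<^sup>2)" using \<alpha> c by (simp add: B_def)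
  have B: "0 < B" using \<alpha> c d by (simp add: B_def add_pos_pos)
  have BA: "B\<^sup>2 - A\<^sup>2 = \<alpha>\<^sup>2 / (1 - \<alpha>\<^sup>2) * (2 * c + \<alpha>\<^sup>2 * (real d - c))"
    using \<alpha> unfolding A2 B2 by (simp add: field_simps)
  have gap0: "0 \<le> B\<^sup>2 - A\<^sup>2" unfolding BA using \<alpha> c cd by simp
  have AB: "A \<le> B" by (rule power2_le_imp_le) (use gap0 B in simp_all)
  \<comment> \<open>The norm deviation contributes \<open>L * c / d = sqrt e\<close>, the
    denominator of \<open>B\<close> contributes \<open>L * L / d = e\<^sup>2\<close>; both vanish
    exactly when \<open>e\<close> does.\<close>
  have gap: "B\<^sup>2 - A\<^sup>2 \<le> 8 * sqrt e + 8 * e\<^sup>2"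
  proof -
    have f1: "\<alpha>\<^sup>2 / (1 - \<alpha>\<^sup>2) \<le> 2 * (2 * L / real d)"
    proof -
      have "\<alpha>\<^sup>2 / (1 - \<alpha>\<^sup>2) \<le> \<alpha>\<^sup>2 / (1 / 2)" using \<alpha> by (intro divide_left_mono) auto
      then show ?thesis using \<alpha> by simp
    qed
    have f2: "2 * c + \<alpha>\<^sup>2 * (real d - c) \<le> 2 * c + 2 * L"
    proof -
      have "\<alpha>\<^sup>2 * (real d - c) \<le> (2 * L / real d) * real d"
        using \<alpha> c cd L by (intro mult_mono) auto
      then show ?thesis using d by simp
    qed
    have "B\<^sup>2 - A\<^sup>2 \<le> (2 * (2 * L / real d)) * (2 * c + 2 * L)"
      unfolding BA using \<alpha> c cd L by (intro mult_mono f1 f2) auto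
    also have "\<dots> = 8 * (L * c / real d) + 8 * (L * L / real d)" by (simp add: algebra_simps add_divide_distrib)
    also have "L * L / real d = e\<^sup>2" using e by (simp add: power_divide power2_eq_square)
    also have "L * c / real d = sqrt e"
    proof -
      have Lc: "L = e * sqrt (real d)" "c = sqrt (real d) / sqrt e"
        using d by (simp add: e(2)) (simp add: c_def real_sqrt_divide)
      have "L * c = (e / sqrt e) * (sqrt (real d) * sqrt (real d))"
        unfolding Lc by (simp only: times_divide_eq_right times_divide_eq_left mult_ac)
      also have "e / sqrt e = sqrt e" using e(1) by (simp add: real_div_sqrt)
      finally show ?thesis using d by simp
    qed
    finally show ?thesis .
  qed
  \<comment> \<open>Both \<open>(B - A) * A\<close> and \<open>(B - A)\<^sup>2\<close> are at most
    \<open>(B - A) * (B + A)\<close>, so no separate bound on the size of \<open>A\<close> is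
    required.\<close>
  have tail_gap: "18 * (B - A) * (1 + A) \<le> tail_gap e"
  proof -
    have "(B - A) * A \<le> (B - A) * (B + A)" using A B AB by (intro mult_left_mono) auto
    then have 1: "(B - A) * A \<le> B\<^sup>2 - A\<^sup>2" by (simp add: power2_eq_square algebra_simps)
    have "(B - A) * (B - A) \<le> (B - A) * (B + A)" using A AB by (intro mult_left_mono) auto
    then have "(B - A)\<^sup>2 \<le> B\<^sup>2 - A\<^sup>2" by (simp add: power2_eq_square algebra_simps)
    then have 2: "B - A \<le> sqrt (B\<^sup>2 - A\<^sup>2)" by (rule real_le_rsqrt)
    have "sqrt (B\<^sup>2 - A\<^sup>2) \<le> sqrt (8 * sqrt e + 8 * e\<^sup>2)" using gap by (rule real_sqrt_le_mono)
    from add_mono[OF order_trans[OF 1 gap] order_trans[OF 2 this]]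
    have "18 * ((B - A) * A + (B - A)) \<le> tail_gap e"
      unfolding tail_gap_def by (rule mult_left_mono) simp
    moreover have "18 * (B - A) * (1 + A) = 18 * ((B - A) * A + (B - A))" by (simp add: algebra_simps)
    ultimately show ?thesis by (simp only:)
  qed
  have "gauss_tail A * (1 - tail_gap e) \<le> gauss_tail A * (1 - 18 * (B - A) * (1 + A))"
    using tail_gap gauss_tail_nonneg by (intro mult_left_mono) auto
  also have "\<dots> \<le> gauss_tail B"
    using gauss_tail_diff[of A B] A AB by (simp add: algebra_simps)
  finally have t1: "gauss_tail A * (1 - tail_gap e) \<le> gauss_tail B" .
  let ?S = "{x \<in> space (gauss {1..<d}). (\<Sum>i\<in>{1..<d}. (x i)\<^sup>2) \<le> real d + c}"
  let ?D = "{x \<in> space (gauss {1..<d}). c \<le> \<bar>(\<Sum>i\<in>{1..<d}. (x i)\<^sup>2) - real (card {1..<d})\<bar>}"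
  have S: "1 - 2 * e \<le> measure (gauss {1..<d}) ?S"
  proof -
    have D: "?D \<in> sets (gauss {1..<d})" by measurable
    have "measure (gauss {1..<d}) ?D \<le> 2 * real (card {1..<d}) / c\<^sup>2"
      by (rule gauss_norm_concentration[OF _ c]) simp
    also have "\<dots> \<le> 2 * e" by (rule conc) simp
    finally have "1 - 2 * e \<le> measure (gauss {1..<d}) (space (gauss {1..<d}) - ?D)"
      using G1.prob_compl[OF D] by simp
    also have "\<dots> \<le> measure (gauss {1..<d}) ?S"
    proof (rule G1.finite_measure_mono)
      show "space (gauss {1..<d}) - ?D \<subseteq> ?S"
      proof
        fix x assume x: "x \<in> space (gauss {1..<d}) - ?D"
        then have "\<not> c \<le> \<bar>(\<Sum>i\<in>{1..<d}. (x i)\<^sup>2) - real (card {1..<d})\<bar>" by blast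
        moreover have "real (card {1..<d}) \<le> real d" by simp
        ultimately have "(\<Sum>i\<in>{1..<d}. (x i)\<^sup>2) \<le> real d + c" by linarith
        then show "x \<in> ?S" using x by blast
      qed
    qed measurable
    finally show ?thesis .
  qed
  have "gauss_tail A * (1 - tail_gap e) * (1 - 2 * e) \<le> gauss_tail B * (1 - 2 * e)"
    using t1 small by (intro mult_right_mono) auto
  also have "\<dots> \<le> gauss_tail B * measure (gauss {1..<d}) ?S"
    using S gauss_tail_nonneg by (rule mult_left_mono)
  also have "\<dots> \<le> measure (coord_distr d) {t. \<alpha> \<le> \<bar>t\<bar>}"
  proof (rule coord_distr_tail_lower[OF d0])
    show "\<alpha>\<^sup>2 * (real d + c) \<le> (1 - \<alpha>\<^sup>2) * B\<^sup>2" using \<alpha> by (simp add: B2)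
  qed (use \<alpha> B in auto)
  also have "\<dots> = 2 / real N"
    unfolding \<alpha>_def by (rule coord_distr_slab_cap_height[OF d2 N])
  finally show "gauss_tail (cap_height d N * r) * (1 - tail_gap e) * (1 - 2 * e) \<le> 2 / real N"
    by (simp add: A_def \<alpha>_def)
qed

text \<open>Bounds the expected number of slab complements hit: \<open>N / 2\<close> times the
  Gaussian tail is at most this number, which tends to 1 as \<open>e\<close> tends to 0.\<close>

definition tail_ratio :: "real \<Rightarrow> real" where
  "tail_ratio e = 1 / ((1 - tail_gap e) * (1 - 2 * e))"

text \<open>With a Gaussian tail of at most \<open>x = tail_ratio e / n\<close>, the power
  \<open>(1 - x) ^ n\<close> is bounded below by an exponential through
  \<open>ln (1 - x) >= - x - 2 * x\<^sup>2\<close>, valid for \<open>x\<close> up to 1/2.\<close>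

lemma max_antipodal_coverage_upper:
  fixes d N :: nat
  defines "e \<equiv> ln (real N) / sqrt (real d)" and "n \<equiv> N div 2"
  assumes d: "3 \<le> d" and N: "3 \<le> N" "even N" and small: "e \<le> 1 / 4"
    and gap: "tail_gap e < 1" and \<rho>: "tail_ratio e / real n \<le> 1 / 2"
  shows "max_antipodal_coverage d N \<le>
    1 - exp (- tail_ratio e - 2 * (tail_ratio e)\<^sup>2 / real n) + 2 * e"
proof -
  define r where "r = sqrt (real d - sqrt (real d / e))"
  define q where "q = gauss_tail (cap_height d N * r)"
  note props = gauss_tail_cap_height[OF d N(1), folded e_def, OF small, folded r_def]
  have n: "real N = 2 * real n" "0 < n" using N by (auto simp: n_def elim!: evenE)
  define x where "x = tail_ratio e / real n"
  have pos: "0 < (1 - tail_gap e) * (1 - 2 * e)" using gap small by simp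
  have x0: "0 \<le> x" using pos by (simp add: x_def tail_ratio_def)
  have "q * ((1 - tail_gap e) * (1 - 2 * e)) \<le> 1 / real n"
    using props(3) n by (simp add: q_def mult.assoc)
  then have "q \<le> (1 / real n) / ((1 - tail_gap e) * (1 - 2 * e))"
    using pos by (simp only: pos_le_divide_eq)
  then have q: "q \<le> x" by (simp add: x_def tail_ratio_def mult.commute)
  have x: "x \<le> 1 / 2" using \<rho> by (simp add: x_def)
  have "- x - 2 * x\<^sup>2 \<le> ln (1 - x)" by (rule ln_one_minus_pos_lower_bound[OF x0 x])
  then have "exp (- x - 2 * x\<^sup>2) \<le> 1 - x" using x by (subst (asm) ln_ge_iff) auto
  then have "exp (- x - 2 * x\<^sup>2) ^ n \<le> (1 - x) ^ n" by (rule power_mono) simp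
  also have "\<dots> \<le> (1 - q) ^ n" using q x by (intro power_mono) auto
  finally have "exp (real n * (- x - 2 * x\<^sup>2)) \<le> (1 - q) ^ n" by (simp only: exp_of_nat_mult)
  moreover have "real n * (- x - 2 * x\<^sup>2) = - tail_ratio e - 2 * (tail_ratio e)\<^sup>2 / real n"
    using n(2) by (simp add: x_def power2_eq_square field_simps)
  moreover have "max_antipodal_coverage d N \<le> 1 - (1 - q) ^ n + 2 * e"
    using max_antipodal_coverage_le[OF _ N(1) props(1), of d] props(2) d by (simp add: q_def n_def)
  ultimately show ?thesis by simp
qed

theorem theorem1:
  fixes N :: "nat \<Rightarrow> nat"
  assumes "\<And>d. d \<ge> 3 \<Longrightarrow> even (N d)"
    and "\<And>d. d \<ge> 3 \<Longrightarrow> N d \<ge> 3"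
    and "filterlim N at_top at_top"
    and "(\<lambda>d. ln (real (N d))) \<in> o(\<lambda>d. sqrt (real d))"
  shows "(\<lambda>d. max_antipodal_coverage d (N d)) \<longlonglongrightarrow> 1 - exp (-1)"
proof -
  define e where "e d = ln (real (N d)) / sqrt (real d)" for d
  define n where "n d = real (N d div 2)" for d
  have e0: "e \<longlonglongrightarrow> 0"
    using smalloD_tendsto[OF assms(4)] by (simp add: e_def[abs_def])
  have n: "filterlim n at_top sequentially"
  proof -
    have "filterlim (\<lambda>d. real (N d)) at_top sequentially"
      using filterlim_compose[OF filterlim_real_sequentially assms(3)] .
    then have "filterlim (\<lambda>d. 1 / 2 * real (N d)) at_top sequentially"
      by (intro filterlim_tendsto_pos_mult_at_top[OF tendsto_const]) auto
    then show ?thesis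
    proof (rule filterlim_at_top_mono)
      show "eventually (\<lambda>d. 1 / 2 * real (N d) \<le> n d) sequentially"
        using eventually_ge_at_top[of 3]
      proof eventually_elim
        case (elim d)
        then obtain k where "N d = 2 * k" using assms(1) by (auto elim: evenE)
        then show ?case by (simp add: n_def)
      qed
    qed
  qed
  have gap: "(\<lambda>d. tail_gap (e d)) \<longlonglongrightarrow> tail_gap 0"
    unfolding tail_gap_def by (intro tendsto_intros e0)
  have gap0: "tail_gap 0 = 0" by (simp add: tail_gap_def)
  have ratio: "(\<lambda>d. tail_ratio (e d)) \<longlonglongrightarrow> 1 / ((1 - 0) * (1 - 2 * 0))"
    unfolding tail_ratio_def using gap gap0 by (intro tendsto_intros e0) auto
  have rn: "(\<lambda>d. c d / n d) \<longlonglongrightarrow> 0" if "c \<longlonglongrightarrow> l" for c and l :: real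
    using that filterlim_at_top_imp_at_infinity[OF n] by (rule tendsto_divide_0)
  have upper: "(\<lambda>d. 1 - exp (- tail_ratio (e d) - 2 * (tail_ratio (e d))\<^sup>2 / n d) + 2 * e d)
      \<longlonglongrightarrow> 1 - exp (- (1 / ((1 - 0) * (1 - 2 * 0))) - 0) + 2 * 0"
  proof -
    have "(\<lambda>d. 2 * (tail_ratio (e d))\<^sup>2) \<longlonglongrightarrow> 2 * (1 / ((1 - 0) * (1 - 2 * 0)))\<^sup>2"
      by (intro tendsto_intros ratio)
    from rn[OF this] show ?thesis by (intro tendsto_intros e0 ratio)
  qed
  have "eventually (\<lambda>d. e d < 1 / 4) sequentially"
    using e0 by (rule order_tendstoD) simp
  moreover have "eventually (\<lambda>d. tail_gap (e d) < 1) sequentially"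
    using gap by (rule order_tendstoD) (simp add: gap0)
  moreover have "eventually (\<lambda>d. tail_ratio (e d) / n d < 1 / 2) sequentially"
    using rn[OF ratio] by (rule order_tendstoD) simp
  ultimately have le: "eventually (\<lambda>d. max_antipodal_coverage d (N d) \<le>
      1 - exp (- tail_ratio (e d) - 2 * (tail_ratio (e d))\<^sup>2 / n d) + 2 * e d) sequentially"
    using eventually_ge_at_top[of 3]
  proof eventually_elim
    case (elim d)
    then show ?case
      unfolding e_def n_def using assms(1,2)
      by (intro max_antipodal_coverage_upper) auto
  qed
  \<comment> \<open>With \<open>N = 2 * m\<close> the greedy bound leaves
    \<open>(1 - 1 / m) ^ m\<close>, which never exceeds \<open>exp (-1)\<close>.\<close>
  have ge: "eventually (\<lambda>d. 1 - exp (-1) \<le> max_antipodal_coverage d (N d)) sequentially"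
    using eventually_ge_at_top[of 3]
  proof eventually_elim
    case (elim d)
    define m where "m = N d div 2"
    have m: "real (N d) = 2 * real m" "0 < m"
      using assms(1,2)[OF elim] by (auto simp: m_def elim!: evenE)
    have "(1 - 2 / real (N d)) ^ m \<le> exp (- 1 / real m) ^ m"
      using m exp_ge_add_one_self[of "- 1 / real m"] by (intro power_mono) auto
    also have "\<dots> = exp (-1)" using m by (simp flip: exp_of_nat_mult)
    finally show ?case
      using max_antipodal_coverage_ge[of d "N d"] assms(2)[OF elim] elim by (simp add: m_def)
  qed
  show ?thesis
    by (rule tendsto_sandwich[OF ge le tendsto_const]) (use upper in simp)
qed

end
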